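(* Suppose $n\geqslant 7$. Let $\rho:WB_n\to GL_{n-1}(\mathbb{C})$ be an $(n-1)$-dimensional representation of the welded braid group $WB_n$ such that its restriction $\rho|_{B_n}$ to the braid group $B_n$ is irreducible. Then there exists a unique quadruple $(y,k,z,\beta')$ such that $\rho$ is equivalent to $X_n(y,k)\otimes\beta'$, where $y,z\in\mathbb{C}^*$, $P_n(z)=1+z+z^2+\dots+z^{n-1}\neq 0$, $k\in\{-1,1\}$, and $\beta'$ is a representation of $WB_n$ with $\beta'\in\{\widetilde{\beta_n}(z),\widehat{\beta_n}(z)\}$ if $z\neq 1$, and $\beta'=\widetilde{\beta_n}(1)$ if $z=1$.
   Context: The welded braid group $WB_n$ is the group generated by $\alpha_1,\dots,\alpha_{n-1},\sigma_1,\dots,\sigma_{n-1}$ with defining relations: $\alpha_i^2=1$ ($1\leqslant i\leqslant n-1$); $\alpha_i\alpha_j=\alpha_j\alpha_i$, $\sigma_i\sigma_j=\sigma_j\sigma_i$, $\alpha_i\sigma_j=\sigma_j\alpha_i$ for $|i-j|\geqslant 2$; and, for $1\leqslant i\leqslant n-2$, $\alpha_i\alpha_{i+1}\alpha_i=\alpha_{i+1}\alpha_i\alpha_{i+1}$, $\sigma_i\sigma_{i+1}\sigma_i=\sigma_{i+1}\sigma_i\sigma_{i+1}$, $\alpha_i\alpha_{i+1}\sigma_i=\sigma_{i+1}\alpha_i\alpha_{i+1}$, $\sigma_i\sigma_{i+1}\alpha_i=\alpha_{i+1}\sigma_i\sigma_{i+1}$. The subgroup generated by the $\sigma_i$ is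 isomorphic to the braid group on $n$ strings and is denoted $B_n$. Matrices act on column vectors. For $y\in\mathbb{C}^*$, $k\in\{-1,1\}$, $X_n(y,k):WB_n\to\mathbb{C}^*$ is the one-dimensional representation $\sigma_i\mapsto y$, $\alpha_i\mapsto k$ for all $i$. For $z\in\mathbb{C}^*$ the representations $\widetilde{\beta_n}(z),\widehat{\beta_n}(z):WB_n\to GL_{n-1}(\mathbb{C})$ are given by (here $I_m$ is the $m\times m$ identity, $\oplus$ denotes block-diagonal sum, and $2\leqslant i\leqslant n-2$): $$\widetilde{\beta_n}(z)(\sigma_1)=\begin{pmatrix}-z&1\\0&1\end{pmatrix}\oplus I_{n-3},\quad \widetilde{\beta_n}(z)(\sigma_i)=I_{i-2}\oplus\begin{pmatrix}1&0&0\\ z&-z&1\\0&0&1\end{pmatrix}\oplus I_{n-i-2},\quad \widetilde{\beta_n}(z)(\sigma_{n-1})=I_{n-3}\oplus\begin{pmatrix}1&0\\ z&-z\end{pmatrix},$$ $$\widetilde{\beta_n}(z)(\alpha_1)=\begin{pmatrix}-1&1\\0&1\end{pmatrix}\oplus I_{n-3},\quad \widetilde{\beta_n}(z)(\alpha_i)=I_{i-2}\oplus\begin{pmatrix}1&0&0\\1&-1&1\\0&0&1\end{pmatrix}\oplus I_{n-i-2},\quad \widetilde{\beta_n}(z)(\alpha_{n-1})=I_{n-3}\oplus\begin{pmatrix}1&0\\1&-1\end{pmatrix},$$ $$\widehat{\beta_n}(z)(\sigma_1)=\begin{pmatrix}-z&0\\1&1\end{pmatrix}\oplus I_{n-3},\quad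 \widehat{\beta_n}(z)(\sigma_i)=I_{i-2}\oplus\begin{pmatrix}1&z&0\\0&-z&0\\0&1&1\end{pmatrix}\oplus I_{n-i-2},\quad \widehat{\beta_n}(z)(\sigma_{n-1})=I_{n-3}\oplus\begin{pmatrix}1&z\\0&-z\end{pmatrix},$$ $$\widehat{\beta_n}(z)(\alpha_1)=\begin{pmatrix}-1&0\\ \frac1z&1\end{pmatrix}\oplus I_{n-3},\quad \widehat{\beta_n}(z)(\alpha_i)=I_{i-2}\oplus\begin{pmatrix}1&z&0\\0&-1&0\\0&\frac1z&1\end{pmatrix}\oplus I_{n-i-2},\quad \widehat{\beta_n}(z)(\alpha_{n-1})=I_{n-3}\oplus\begin{pmatrix}1&z\\0&-1\end{pmatrix}.$$ *)

theory Defs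
  imports "HOL-Algebra.Algebra" "Jordan_Normal_Form.VS_Connect"
begin

section \<open>Groups given by generators and relations\<close>

text \<open>A letter \<open>(x, True)\<close> stands for the generator \<open>x\<close>, and \<open>(x, False)\<close> for its formal inverse.\<close>

type_synonym 'a gword = "('a \<times> bool) list"

abbreviation words :: "'a set \<Rightarrow> 'a gword set" where
  "words S \<equiv> lists (S \<times> UNIV)"

text \<open>The congruence on words over \<open>S\<close> generated by free cancellation and the relations
  \<open>r = s\<close> for \<open>(r, s) \<in> R\<close>.\<close>

inductive pres_eq :: "'a set \<Rightarrow> ('a gword \<times> 'a gword) set \<Rightarrow> 'a gword \<Rightarrow> 'a gword \<Rightarrow> bool"
  for S R where
  refl: "u \<in> words S \<Longrightarrow> pres_eq S R u u"
| sym: "pres_eq S R u v \<Longrightarrow> pres_eq S R v u"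
| trans: "pres_eq S R u v \<Longrightarrow> pres_eq S R v w \<Longrightarrow> pres_eq S R u w"
| cancel: "u \<in> words S \<Longrightarrow> v \<in> words S \<Longrightarrow> x \<in> S \<Longrightarrow>
    pres_eq S R (u @ [(x, b), (x, \<not> b)] @ v) (u @ v)"
| rel: "u \<in> words S \<Longrightarrow> v \<in> words S \<Longrightarrow> r \<in> words S \<Longrightarrow> s \<in> words S \<Longrightarrow> (r, s) \<in> R \<Longrightarrow>
    pres_eq S R (u @ r @ v) (u @ s @ v)"

definition pres_rel :: "'a set \<Rightarrow> ('a gword \<times> 'a gword) set \<Rightarrow> 'a gword rel" where
  "pres_rel S R = {(u, v). pres_eq S R u v}"

definition presented_group ::
    "'a set \<Rightarrow> ('a gword \<times> 'a gword) set \<Rightarrow> 'a gword set monoid" where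
  "presented_group S R = \<lparr>
     carrier = words S // pres_rel S R,
     monoid.mult = (\<lambda>A B. \<Union>u\<in>A. \<Union>v\<in>B. pres_rel S R `` {u @ v}),
     one = pres_rel S R `` {[]}\<rparr>"

definition pres_gen :: "'a set \<Rightarrow> ('a gword \<times> 'a gword) set \<Rightarrow> 'a \<Rightarrow> 'a gword set" where
  "pres_gen S R x = pres_rel S R `` {[(x, True)]}"

fun eval_word :: "('b, 'c) monoid_scheme \<Rightarrow> ('a \<Rightarrow> 'b) \<Rightarrow> 'a gword \<Rightarrow> 'b" where
  "eval_word H f [] = \<one>\<^bsub>H\<^esub>"
| "eval_word H f ((x, b) # w) = (if b then f x else inv\<^bsub>H\<^esub> (f x)) \<otimes>\<^bsub>H\<^esub> eval_word H f w"

text \<open>The map to \<open>H\<close> sending each generator \<open>x\<close> to \<open>f x\<close>.  It is meaningful when \<open>f\<close> respects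
  the relations, since evaluation is then constant on each class;
  see \<open>pres_lift_hom\<close> and \<open>pres_lift_gen\<close> below.\<close>

definition pres_lift :: "('b, 'c) monoid_scheme \<Rightarrow> ('a \<Rightarrow> 'b) \<Rightarrow> 'a gword set \<Rightarrow> 'b" where
  "pres_lift H f A = the_elem (eval_word H f ` A)"

lemma pres_eq_words: "pres_eq S R u v \<Longrightarrow> u \<in> words S \<and> v \<in> words S"
  by (induction rule: pres_eq.induct) auto

lemma equiv_pres_rel: "equiv (words S) (pres_rel S R)"
  unfolding equiv_def refl_on_def sym_def trans_def pres_rel_def
  by (auto dest: pres_eq_words intro: pres_eq.intros)

lemma pres_eq_append_left: "pres_eq S R u v \<Longrightarrow> w \<in> words S \<Longrightarrow> pres_eq S R (w @ u) (w @ v)"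
proof (induction rule: pres_eq.induct)
  case (refl u)
  then show ?case by (intro pres_eq.refl) auto
next
  case (sym u v)
  then show ?case by (blast intro: pres_eq.sym)
next
  case (trans u v w')
  then show ?case by (blast intro: pres_eq.trans)
next
  case (cancel u v x b)
  then show ?case using pres_eq.cancel[of "w @ u" S v x R b] by simp
next
  case (rel u v r s)
  then show ?case using pres_eq.rel[of "w @ u" S v r s R] by simp
qed

lemma pres_eq_append_right: "pres_eq S R u v \<Longrightarrow> w \<in> words S \<Longrightarrow> pres_eq S R (u @ w) (v @ w)"
proof (induction rule: pres_eq.induct)
  case (refl u)
  then show ?case by (intro pres_eq.refl) auto
next
  case (sym u v)
  then show ?case by (blast intro: pres_eq.sym)
next
  case (trans u v w')
  then show ?case by (blast intro: pres_eq.trans)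
next
  case (cancel u v x b)
  then show ?case using pres_eq.cancel[of u S "v @ w" x R b] by simp
next
  case (rel u v r s)
  then show ?case using pres_eq.rel[of u S "v @ w" r s R] by simp
qed

lemma pres_eq_append:
  "pres_eq S R u u' \<Longrightarrow> pres_eq S R v v' \<Longrightarrow> pres_eq S R (u @ v) (u' @ v')"
  by (meson pres_eq.trans pres_eq_append_left pres_eq_append_right pres_eq_words)

lemma presented_group_mult:
  assumes "u \<in> words S" "v \<in> words S"
  shows "pres_rel S R `` {u} \<otimes>\<^bsub>presented_group S R\<^esub> pres_rel S R `` {v} = pres_rel S R `` {u @ v}"
proof -
  have "congruent2 (pres_rel S R) (pres_rel S R) (\<lambda>u v. pres_rel S R `` {u @ v})"
    by (rule congruent2I', rule equiv_class_eq[OF equiv_pres_rel])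
       (auto simp: pres_rel_def intro: pres_eq_append)
  from UN_equiv_class2[OF equiv_pres_rel equiv_pres_rel this assms]
  show ?thesis by (simp add: presented_group_def)
qed

lemma inverse_word:
  assumes "u \<in> words S"
  shows "pres_eq S R (map (\<lambda>(x, b). (x, \<not> b)) (rev u) @ u) []"
  using assms
proof (induction u rule: list.induct)
  case Nil
  then show ?case by (auto intro: pres_eq.refl)
next
  case (Cons a u)
  obtain x b where a: "a = (x, b)" by fastforce
  let ?w = "map (\<lambda>(x, b). (x, \<not> b)) (rev u)"
  have u: "u \<in> words S" and x: "x \<in> S"
    using Cons.prems by (simp_all add: a)
  have w: "?w \<in> words S" using u by auto
  have "pres_eq S R (?w @ [(x, \<not> b), (x, \<not> \<not> b)] @ u) (?w @ u)"
    by (rule pres_eq.cancel[OF w u x])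
  moreover have "pres_eq S R (?w @ u) []" using Cons.IH u by blast
  ultimately have "pres_eq S R (?w @ [(x, \<not> b), (x, \<not> \<not> b)] @ u) []" by (rule pres_eq.trans)
  then show ?case by (simp add: a)
qed

lemma group_presented_group: "group (presented_group S R)"
proof (rule groupI)
  let ?G = "presented_group S R"
  have car: "\<exists>u\<in>words S. A = pres_rel S R `` {u}" if "A \<in> carrier ?G" for A
    using that by (auto simp: presented_group_def quotient_def)
  have inc: "pres_rel S R `` {u} \<in> carrier ?G" if "u \<in> words S" for u
    using that by (auto simp: presented_group_def quotient_def)
  have one: "\<one>\<^bsub>?G\<^esub> = pres_rel S R `` {[]}" by (simp add: presented_group_def)
  show "\<one>\<^bsub>?G\<^esub> \<in> carrier ?G" unfolding one by (rule inc) simp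
  fix A B C assume A: "A \<in> carrier ?G"
  obtain u where u: "u \<in> words S" "A = pres_rel S R `` {u}" using car[OF A] by blast
  show "\<one>\<^bsub>?G\<^esub> \<otimes>\<^bsub>?G\<^esub> A = A" unfolding one u(2) by (subst presented_group_mult) (use u in auto)
  show "\<exists>B\<in>carrier ?G. B \<otimes>\<^bsub>?G\<^esub> A = \<one>\<^bsub>?G\<^esub>"
  proof
    let ?w = "map (\<lambda>(x, b). (x, \<not> b)) (rev u)"
    have w: "?w \<in> words S" using u(1) by auto
    show "pres_rel S R `` {?w} \<in> carrier ?G" by (rule inc[OF w])
    have "(?w @ u, []) \<in> pres_rel S R" using inverse_word[OF u(1)] by (simp add: pres_rel_def)
    then show "pres_rel S R `` {?w} \<otimes>\<^bsub>?G\<^esub> A = \<one>\<^bsub>?G\<^esub>"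
      unfolding u(2) presented_group_mult[OF w u(1)] one
      by (rule equiv_class_eq[OF equiv_pres_rel])
  qed
  assume B: "B \<in> carrier ?G"
  obtain v where v: "v \<in> words S" "B = pres_rel S R `` {v}" using car[OF B] by blast
  have uv: "u @ v \<in> words S" using u v by auto
  show "A \<otimes>\<^bsub>?G\<^esub> B \<in> carrier ?G"
    unfolding u(2) v(2) presented_group_mult[OF u(1) v(1)] by (rule inc[OF uv])
  assume C: "C \<in> carrier ?G"
  obtain w where w: "w \<in> words S" "C = pres_rel S R `` {w}" using car[OF C] by blast
  have vw: "v @ w \<in> words S" using w v by auto
  show "A \<otimes>\<^bsub>?G\<^esub> B \<otimes>\<^bsub>?G\<^esub> C = A \<otimes>\<^bsub>?G\<^esub> (B \<otimes>\<^bsub>?G\<^esub> C)"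
    unfolding u(2) v(2) w(2) presented_group_mult[OF u(1) v(1)] presented_group_mult[OF v(1) w(1)]
      presented_group_mult[OF uv w(1)] presented_group_mult[OF u(1) vw] by simp
qed

context
  fixes S :: "'a set" and R :: "('a gword \<times> 'a gword) set"
    and H :: "('b, 'c) monoid_scheme" and f :: "'a \<Rightarrow> 'b"
  assumes H: "group H"
    and f: "\<And>x. x \<in> S \<Longrightarrow> f x \<in> carrier H"
    and rels: "\<And>r s. (r, s) \<in> R \<Longrightarrow> r \<in> words S \<Longrightarrow> s \<in> words S \<Longrightarrow> eval_word H f r = eval_word H f s"
begin

interpretation group H by (rule H)

lemma eval_word_closed: "w \<in> words S \<Longrightarrow> eval_word H f w \<in> carrier H"
  by (induction w) (auto simp: f)

lemma eval_word_append:
  "u \<in> words S \<Longrightarrow> v \<in> words S \<Longrightarrow> eval_word H f (u @ v) = eval_word H f u \<otimes>\<^bsub>H\<^esub> eval_word H f v"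
proof (induction u)
  case (Cons a u)
  then show ?case using eval_word_closed[of u] eval_word_closed[of v]
    by (cases a) (simp add: f m_assoc)
qed (simp add: eval_word_closed)

lemma eval_word_cong: "pres_eq S R u v \<Longrightarrow> eval_word H f u = eval_word H f v"
proof (induction rule: pres_eq.induct)
  case (cancel u v x b)
  have "eval_word H f [(x, b), (x, \<not> b)] = \<one>\<^bsub>H\<^esub>" using cancel by (auto simp: f)
  moreover have "[(x, b), (x, \<not> b)] \<in> words S" using cancel by auto
  moreover from this have "[(x, b), (x, \<not> b)] @ v \<in> words S" using cancel by auto
  ultimately show ?case using cancel
    by (simp add: eval_word_append eval_word_closed del: eval_word.simps append.simps)
next
  case (rel u v r s)
  then show ?case by (simp add: eval_word_append rels)
qed auto

lemma pres_lift_class: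
  assumes "u \<in> words S"
  shows "pres_lift H f (pres_rel S R `` {u}) = eval_word H f u"
proof -
  have "eval_word H f ` (pres_rel S R `` {u}) = {eval_word H f u}"
    using eval_word_cong pres_eq.refl[OF assms] by (fastforce simp: pres_rel_def)
  then show ?thesis by (simp add: pres_lift_def)
qed

lemma pres_lift_gen: "x \<in> S \<Longrightarrow> pres_lift H f (pres_gen S R x) = f x"
  unfolding pres_gen_def by (subst pres_lift_class) (auto simp: f)

lemma pres_lift_hom: "pres_lift H f \<in> hom (presented_group S R) H"
proof (rule homI)
  let ?G = "presented_group S R"
  have car: "\<exists>u\<in>words S. A = pres_rel S R `` {u}" if "A \<in> carrier ?G" for A
    using that by (auto simp: presented_group_def quotient_def)
  fix A B assume A: "A \<in> carrier ?G"
  then obtain u where u: "u \<in> words S" "A = pres_rel S R `` {u}" using car by blast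
  show "pres_lift H f A \<in> carrier H"
    using u by (simp add: pres_lift_class eval_word_closed)
  assume "B \<in> carrier ?G"
  then obtain v where v: "v \<in> words S" "B = pres_rel S R `` {v}" using car by blast
  have "u @ v \<in> words S" using u v by auto
  then show "pres_lift H f (A \<otimes>\<^bsub>?G\<^esub> B) = pres_lift H f A \<otimes>\<^bsub>H\<^esub> pres_lift H f B"
    unfolding u(2) v(2) presented_group_mult[OF u(1) v(1)]
    using u v by (simp add: pres_lift_class eval_word_append)
qed

end

section \<open>The welded braid group and the braid group\<close>

datatype wb_gen = Alpha nat | Sigma nat

abbreviation alpha :: "nat \<Rightarrow> wb_gen gword" where "alpha i \<equiv> [(Alpha i, True)]"
abbreviation sigma :: "nat \<Rightarrow> wb_gen gword" where "sigma i \<equiv> [(Sigma i, True)]"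

definition wb_gens :: "nat \<Rightarrow> wb_gen set" where
  "wb_gens n = Alpha ` {1..n - 1} \<union> Sigma ` {1..n - 1}"

definition wb_rels :: "nat \<Rightarrow> (wb_gen gword \<times> wb_gen gword) set" where
  "wb_rels n =
     {(alpha i @ alpha i, []) | i. i \<in> {1..n - 1}}
   \<union> (\<Union>(i, j) \<in> {(i, j). i \<in> {1..n - 1} \<and> j \<in> {1..n - 1} \<and> \<bar>int i - int j\<bar> \<ge> 2}.
       {(alpha i @ alpha j, alpha j @ alpha i),
        (sigma i @ sigma j, sigma j @ sigma i),
        (alpha i @ sigma j, sigma j @ alpha i)})
   \<union> (\<Union>i \<in> {1..n - 2}.
       {(alpha i @ alpha (i + 1) @ alpha i, alpha (i + 1) @ alpha i @ alpha (i + 1)),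
        (sigma i @ sigma (i + 1) @ sigma i, sigma (i + 1) @ sigma i @ sigma (i + 1)),
        (alpha i @ alpha (i + 1) @ sigma i, sigma (i + 1) @ alpha i @ alpha (i + 1)),
        (sigma i @ sigma (i + 1) @ alpha i, alpha (i + 1) @ sigma i @ sigma (i + 1))})"

definition WB :: "nat \<Rightarrow> wb_gen gword set monoid" where
  "WB n = presented_group (wb_gens n) (wb_rels n)"

definition braid :: "nat \<Rightarrow> wb_gen gword set monoid" where
  "braid n = subgroup_generated (WB n)
     ((\<lambda>i. pres_gen (wb_gens n) (wb_rels n) (Sigma i)) ` {1..n - 1})"

section \<open>Complex matrix representations\<close>

definition GL :: "nat \<Rightarrow> complex mat monoid" where
  "GL d = units_of (ring_mat TYPE(complex) d ())"

definition representation :: "('a, 'b) monoid_scheme \<Rightarrow> nat \<Rightarrow> ('a \<Rightarrow> complex mat) \<Rightarrow> bool" where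
  "representation G d \<rho> \<longleftrightarrow> \<rho> \<in> hom G (GL d)"

definition irreducible_rep :: "('a, 'b) monoid_scheme \<Rightarrow> nat \<Rightarrow> ('a \<Rightarrow> complex mat) \<Rightarrow> bool" where
  "irreducible_rep G d \<rho> \<longleftrightarrow> representation G d \<rho> \<and> d > 0 \<and>
     (\<forall>W. VectorSpace.subspace class_ring W (module_vec TYPE(complex) d) \<longrightarrow>
          (\<forall>g\<in>carrier G. \<forall>w\<in>W. \<rho> g *\<^sub>v w \<in> W) \<longrightarrow>
          W = {0\<^sub>v d} \<or> W = carrier_vec d)"

definition equivalent_reps ::
    "('a, 'b) monoid_scheme \<Rightarrow> nat \<Rightarrow> ('a \<Rightarrow> complex mat) \<Rightarrow> ('a \<Rightarrow> complex mat) \<Rightarrow> bool" where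
  "equivalent_reps G d \<rho> \<rho>' \<longleftrightarrow> (\<exists>P\<in>carrier (GL d). \<forall>g\<in>carrier G. P * \<rho> g = \<rho>' g * P)"

text \<open>Tensor product of a one-dimensional representation \<open>\<chi>\<close> (with values in the nonzero complex
  numbers) and a matrix representation, under the identification of \<open>\<complex> \<otimes> \<complex>\<^sup>d\<close> with \<open>\<complex>\<^sup>d\<close>.\<close>

definition tensor1 :: "('a \<Rightarrow> complex) \<Rightarrow> ('a \<Rightarrow> complex mat) \<Rightarrow> 'a \<Rightarrow> complex mat" where
  "tensor1 \<chi> \<rho> g = \<chi> g \<cdot>\<^sub>m \<rho> g"

section \<open>The representations of the welded braid group\<close>

fun X_gen :: "complex \<Rightarrow> complex \<Rightarrow> wb_gen \<Rightarrow> complex" where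
  "X_gen y k (Sigma i) = y"
| "X_gen y k (Alpha i) = k"

definition X_rep :: "complex \<Rightarrow> complex \<Rightarrow> wb_gen gword set \<Rightarrow> complex" where
  "X_rep y k = pres_lift (units_of (class_ring :: complex ring)) (X_gen y k)"

text \<open>\<open>block_gen n A B C i\<close> puts the block \<open>A\<close>, \<open>B\<close> or \<open>C\<close> at position \<open>i\<close> of the
  \<open>(n - 1) \<times> (n - 1)\<close> identity, for \<open>i = 1\<close>, \<open>2 \<le> i \<le> n - 2\<close> and \<open>i = n - 1\<close> respectively.\<close>

definition block_gen ::
    "nat \<Rightarrow> complex list list \<Rightarrow> complex list list \<Rightarrow> complex list list \<Rightarrow> nat \<Rightarrow> complex mat" where
  "block_gen n A B C i =
    (if i = 1 then diag_block_mat [mat_of_rows_list 2 A, 1\<^sub>m (n - 3)]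
     else if i = n - 1 then diag_block_mat [1\<^sub>m (n - 3), mat_of_rows_list 2 C]
     else diag_block_mat [1\<^sub>m (i - 2), mat_of_rows_list 3 B, 1\<^sub>m (n - i - 2)])"

fun beta_tilde_gen :: "nat \<Rightarrow> complex \<Rightarrow> wb_gen \<Rightarrow> complex mat" where
  "beta_tilde_gen n z (Sigma i) = block_gen n
     [[-z, 1],
      [ 0, 1]]
     [[1,  0, 0],
      [z, -z, 1],
      [0,  0, 1]]
     [[1,  0],
      [z, -z]] i"
| "beta_tilde_gen n z (Alpha i) = block_gen n
     [[-1, 1],
      [ 0, 1]]
     [[1,  0, 0],
      [1, -1, 1],
      [0,  0, 1]]
     [[1,  0],
      [1, -1]] i"

fun beta_hat_gen :: "nat \<Rightarrow> complex \<Rightarrow> wb_gen \<Rightarrow> complex mat" where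
  "beta_hat_gen n z (Sigma i) = block_gen n
     [[-z, 0],
      [ 1, 1]]
     [[1,  z, 0],
      [0, -z, 0],
      [0,  1, 1]]
     [[1,  z],
      [0, -z]] i"
| "beta_hat_gen n z (Alpha i) = block_gen n
     [[   -1, 0],
      [1 / z, 1]]
     [[1,     z, 0],
      [0,    -1, 0],
      [0, 1 / z, 1]]
     [[1,  z],
      [0, -1]] i"

definition beta_tilde :: "nat \<Rightarrow> complex \<Rightarrow> wb_gen gword set \<Rightarrow> complex mat" where
  "beta_tilde n z = pres_lift (GL (n - 1)) (beta_tilde_gen n z)"

definition beta_hat :: "nat \<Rightarrow> complex \<Rightarrow> wb_gen gword set \<Rightarrow> complex mat" where
  "beta_hat n z = pres_lift (GL (n - 1)) (beta_hat_gen n z)"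

end

theory Submission
  imports Defs "Jordan_Normal_Form.Spectral_Radius" "HOL-Library.Function_Algebras"
begin

text \<open>
  The subgroup generated by the \<open>\<alpha>\<^sub>i\<close> is a quotient of the symmetric group, and that group
  has very few representations of dimension less than \<open>n\<close>.  This replaces any knowledge of
  representations of the braid group by elementary linear algebra.

  Let \<open>V\<close> have dimension \<open>n - 1\<close>.  Either all \<open>\<alpha>\<^sub>i\<close> act on \<open>V\<close> by the same operator, or, after
  multiplying them by a sign \<open>k\<close>, there are vectors \<open>y\<^sub>1, \<dots>, y\<^sub>n\<close> in \<open>V\<close>, not all equal, which
  the \<open>\<alpha>\<^sub>i\<close> permute like the points \<open>1, \<dots>, n\<close> (\<open>small_sym_action_permutes\<close>).  The reason is an
  induction along \<open>n, n - 2, \<dots>\<close>: the symmetric group on the points \<open>3, \<dots>, n\<close> acts on both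
  eigenspaces of \<open>\<alpha>\<^sub>1\<close>, and the smaller eigenspace is too small for anything but one-dimensional
  constituents; this rigidity produces the \<open>y\<^sub>j\<close>.  The first alternative is impossible here.  The
  relation \<open>\<alpha>\<^sub>i \<alpha>\<^sub>i\<^sub>+\<^sub>1 \<sigma>\<^sub>i = \<sigma>\<^sub>i\<^sub>+\<^sub>1 \<alpha>\<^sub>i \<alpha>\<^sub>i\<^sub>+\<^sub>1\<close> would make all \<open>\<sigma>\<^sub>i\<close> equal, so that an eigenvector of
  \<open>\<sigma>\<^sub>1\<close> would span an invariant line.  In the second alternative a linear relation between the
  \<open>y\<^sub>j\<close> has constant coefficients, hence \<open>V\<close> is spanned by the \<open>y\<^sub>j\<close> and their sum is zero.

  Since \<open>\<sigma>\<^sub>1\<close> commutes with \<open>\<alpha>\<^sub>3, \<dots>, \<alpha>\<^sub>n\<^sub>-\<^sub>1\<close>, and all \<open>\<sigma>\<^sub>i\<close> are conjugate under the \<open>\<alpha>\<^sub>j\<close>, seven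
  scalars describe the action of every \<open>\<sigma>\<^sub>i\<close> on the \<open>y\<^sub>j\<close>.  The commutation of \<open>\<sigma>\<^sub>1\<close> with \<open>\<sigma>\<^sub>3\<close>
  and one of the mixed relations leave two families (\<open>s_two_families\<close>).  In both of them \<open>\<sigma>\<^sub>i\<close> is
  a scalar \<open>y\<close> plus an operator of rank one.  In the basis \<open>y\<^sub>i - y\<^sub>i\<^sub>+\<^sub>1\<close> the first family is the
  representation \<open>beta_tilde\<close>, in the basis \<open>z\<^sup>i (y\<^sub>1 + \<dots> + y\<^sub>i)\<close> the second one is \<open>beta_hat\<close>, each
  twisted by \<open>(y, k)\<close>; the two families meet at \<open>z = 1\<close>.

  If \<open>1 + z + \<dots> + z\<^sup>n\<^sup>-\<^sup>1\<close> were zero, the vector of partial geometric sums would span an invariant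
  line for the first family, and it would be the normal vector of an invariant hyperplane for the
  second one, against irreducibility (\<open>geometric_sum_nonzero\<close>).

  The quadruple is unique because it can be read off from properties that do not depend on the
  basis.  The operators \<open>\<sigma>\<^sub>1 - y\<close> and \<open>\<sigma>\<^sub>3 - y\<close> annihilate each other and a common vector, which
  determines \<open>y\<close>; in the same way the \<open>\<alpha>\<^sub>i\<close> determine \<open>k\<close>, and \<open>(\<sigma>\<^sub>1 - y) (\<sigma>\<^sub>1 + y z) = 0\<close>
  determines \<open>z\<close> (\<open>twist_invariants_unique\<close>).  Finally \<open>(\<alpha>\<^sub>1 + k) (\<sigma>\<^sub>1 - y)\<close> vanishes in the first
  family, but not in the second if \<open>z \<noteq> 1\<close> (\<open>tilde_invariants\<close>, \<open>hat_invariants\<close>).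
\<close>


section \<open>Independent families\<close>

locale char_0_space = Vector_Spaces.vector_space scale
  for scale :: "'a::field_char_0 \<Rightarrow> 'v::ab_group_add \<Rightarrow> 'v" (infixr "*s" 75)
begin

definition indep_family :: "nat \<Rightarrow> (nat \<Rightarrow> 'v) \<Rightarrow> bool" where
  "indep_family k v \<longleftrightarrow> (\<forall>c. (\<Sum>i<k. c i *s v i) = 0 \<longrightarrow> (\<forall>i<k. c i = 0))"

lemma indep_familyD:
  "indep_family k v \<Longrightarrow> (\<Sum>i<k. c i *s v i) = 0 \<Longrightarrow> i < k \<Longrightarrow> c i = 0"
  unfolding indep_family_def by blast

lemma indep_family_inj:
  assumes "indep_family k v"
  shows "inj_on v {..<k}"
proof (rule inj_onI, rule ccontr)
  fix i j assume ij: "i \<in> {..<k}" "j \<in> {..<k}" "v i = v j" "i \<noteq> j"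
  define c :: "nat \<Rightarrow> 'a" where "c r = (if r = i then 1 else if r = j then - 1 else 0)" for r
  have "(\<Sum>r<k. c r *s v r) = (\<Sum>r\<in>{i, j}. c r *s v r)"
    by (rule sum.mono_neutral_right) (use ij in \<open>auto simp: c_def\<close>)
  also have "\<dots> = 0" using ij by (simp add: c_def)
  finally have "c i = 0" using assms ij(1) indep_familyD by blast
  then show False by (simp add: c_def)
qed

lemma indep_family_bound:
  assumes v: "indep_family k v" and T: "finite T" "\<And>i. i < k \<Longrightarrow> v i \<in> span T"
  shows "k \<le> card T"
proof -
  have inj: "inj_on v {..<k}" by (rule indep_family_inj[OF v])
  have "independent (v ` {..<k})"
    unfolding dependent_finite[OF finite_imageI[OF finite_lessThan]]
  proof safe
    fix c i assume i: "i < k" "c (v i) \<noteq> 0" and "(\<Sum>x\<in>v ` {..<k}. c x *s x) = 0"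
    then have "(\<Sum>i<k. c (v i) *s v i) = 0" by (simp add: sum.reindex[OF inj])
    then show False using indep_familyD[OF v, of "\<lambda>i. c (v i)" i] i by simp
  qed
  then have "card (v ` {..<k}) \<le> card T"
    using independent_span_bound[OF T(1)] T(2) by fastforce
  then show ?thesis by (simp add: card_image[OF inj])
qed

text \<open>Adjoining one more vector must produce a linear relation, and the
  coefficient of the new vector in it cannot vanish.\<close>

lemma maximal_family_spans:
  assumes v: "indep_family k v" and T: "finite T" "card T \<le> k" "\<And>i. i < k \<Longrightarrow> v i \<in> span T"
    and w: "w \<in> span T"
  shows "\<exists>c. w = (\<Sum>i<k. c i *s v i)"
proof -
  define u where "u i = (if i = k then w else v i)" for i
  have "\<not> indep_family (Suc k) u"
    using indep_family_bound[of "Suc k" u T] T w by (force simp: u_def less_Suc_eq)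
  then obtain c i where c: "(\<Sum>i<Suc k. c i *s u i) = 0" "i < Suc k" "c i \<noteq> 0"
    unfolding indep_family_def by blast
  have "(\<Sum>i<k. c i *s u i) = (\<Sum>i<k. c i *s v i)" by (rule sum.cong) (auto simp: u_def)
  then have rel: "(\<Sum>i<k. c i *s v i) + c k *s w = 0" using c(1) by (simp add: u_def)
  have "c k \<noteq> 0"
  proof
    assume "c k = 0"
    then show False using rel c indep_familyD[OF v, of c i] by (auto simp: less_Suc_eq)
  qed
  have "c k *s w = - (\<Sum>i<k. c i *s v i)" using rel by (simp add: add_eq_0_iff)
  then have "w = inverse (c k) *s (- (\<Sum>i<k. c i *s v i))"
    using \<open>c k \<noteq> 0\<close> by (metis scale_left_imp_eq scale_scale right_inverse scale_one)
  also have "\<dots> = (\<Sum>i<k. (- inverse (c k) * c i) *s v i)"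
    by (simp add: scale_sum_right sum_negf)
  finally show ?thesis by (rule exI[of _ "\<lambda>i. - inverse (c k) * c i"])
qed

lemma double_eq_0: "x + x = 0 \<Longrightarrow> x = 0" for x :: 'v
proof -
  assume "x + x = 0"
  then have "2 *s x = 0" using scale_left_distrib[of 1 1 x] by simp
  then show ?thesis by simp
qed

lemma neg_eq_self_iff: "- x = x \<longleftrightarrow> x = 0" for x :: 'v
proof
  assume "- x = x"
  then have "x + x = 0" by (metis add.left_inverse)
  then show "x = 0" by (rule double_eq_0)
qed simp

text \<open>Applying \<open>f\<close> to a linear relation changes the sign of one of its two parts, so both parts
  vanish separately.\<close>

lemma indep_family_eigenspaces:
  assumes f: "Modules.module_hom scale scale f"
    and u: "indep_family p u" "\<And>i. i < p \<Longrightarrow> f (u i) = u i"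
    and v: "indep_family q v" "\<And>i. i < q \<Longrightarrow> f (v i) = - v i"
  shows "indep_family (p + q) (\<lambda>i. if i < p then u i else v (i - p))"
  unfolding indep_family_def
proof (intro allI impI)
  fix c :: "nat \<Rightarrow> 'a" and i
  interpret f: Modules.module_hom scale scale f by (rule f)
  define U where "U = (\<Sum>i<p. c i *s u i)"
  define V where "V = (\<Sum>i<q. c (p + i) *s v i)"
  assume sum: "(\<Sum>i<p + q. c i *s (if i < p then u i else v (i - p))) = 0" and i: "i < p + q"
  have "{..<p + q} = {..<p} \<union> {p..<p + q}" by auto
  then have "(\<Sum>i<p + q. c i *s (if i < p then u i else v (i - p)))
    = (\<Sum>i<p. c i *s (if i < p then u i else v (i - p)))
      + (\<Sum>i=p..<p + q. c i *s (if i < p then u i else v (i - p)))"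
    by (metis (no_types, lifting) sum.union_disjoint finite_lessThan finite_atLeastLessThan
        ivl_disj_int_one(2))
  also have "(\<Sum>i<p. c i *s (if i < p then u i else v (i - p))) = U"
    unfolding U_def by (rule sum.cong) auto
  also have "(\<Sum>i=p..<p + q. c i *s (if i < p then u i else v (i - p)))
    = (\<Sum>i=p..<p + q. c i *s v (i - p))"
    by (rule sum.cong) auto
  also have "(\<Sum>i=p..<p + q. c i *s v (i - p)) = V"
    unfolding V_def by (rule sum.reindex_bij_witness[of _ "\<lambda>i. p + i" "\<lambda>i. i - p"]) auto
  finally have UV: "U + V = 0" unfolding sum by simp
  have "f U = U" "f V = - V"
    using u(2) v(2) by (simp_all add: U_def V_def f.sum f.scale sum_negf)
  then have "U - V = 0" using arg_cong[OF UV, of f] by (simp add: f.add)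
  then have "U = 0" "V = 0" using UV double_eq_0[of U] by auto
  then show "c i = 0"
    using indep_familyD[OF u(1), of c i] indep_familyD[OF v(1), of "\<lambda>i. c (p + i)" "i - p"] i
    by (cases "i < p") (auto simp: U_def V_def)
qed

end

section \<open>Representations of symmetric groups of small dimension\<close>

context char_0_space
begin

text \<open>The operators \<open>a 1, \<dots>, a (m - 1)\<close> satisfy on \<open>W\<close> the Coxeter relations of the adjacent
  transpositions of \<open>m\<close> points.  They are linear everywhere, while the relations are required only
  on \<open>W\<close>, so that one can pass to invariant subspaces without changing the operators.\<close>

definition sym_action :: "nat \<Rightarrow> (nat \<Rightarrow> 'v \<Rightarrow> 'v) \<Rightarrow> 'v set \<Rightarrow> bool" where
  "sym_action m a W \<longleftrightarrow> subspace W \<and>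
     (\<forall>i. 1 \<le> i \<longrightarrow> i < m \<longrightarrow> Modules.module_hom scale scale (a i)) \<and>
     (\<forall>i w. 1 \<le> i \<longrightarrow> i < m \<longrightarrow> w \<in> W \<longrightarrow> a i w \<in> W \<and> a i (a i w) = w) \<and>
     (\<forall>i j w. 1 \<le> i \<longrightarrow> i + 2 \<le> j \<longrightarrow> j < m \<longrightarrow> w \<in> W \<longrightarrow> a i (a j w) = a j (a i w)) \<and>
     (\<forall>i w. 1 \<le> i \<longrightarrow> Suc i < m \<longrightarrow> w \<in> W \<longrightarrow>
        a i (a (Suc i) (a i w)) = a (Suc i) (a i (a (Suc i) w)))"

lemma sym_actionI:
  assumes "subspace W"
    and "\<And>i. 1 \<le> i \<Longrightarrow> i < m \<Longrightarrow> Modules.module_hom scale scale (a i)"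
    and "\<And>i w. 1 \<le> i \<Longrightarrow> i < m \<Longrightarrow> w \<in> W \<Longrightarrow> a i w \<in> W"
    and "\<And>i w. 1 \<le> i \<Longrightarrow> i < m \<Longrightarrow> w \<in> W \<Longrightarrow> a i (a i w) = w"
    and "\<And>i j w. 1 \<le> i \<Longrightarrow> i + 2 \<le> j \<Longrightarrow> j < m \<Longrightarrow> w \<in> W \<Longrightarrow> a i (a j w) = a j (a i w)"
    and "\<And>i w. 1 \<le> i \<Longrightarrow> Suc i < m \<Longrightarrow> w \<in> W \<Longrightarrow>
      a i (a (Suc i) (a i w)) = a (Suc i) (a i (a (Suc i) w))"
  shows "sym_action m a W"
  using assms unfolding sym_action_def by blast

lemma sym_action_subspace: "sym_action m a W \<Longrightarrow> subspace W"
  unfolding sym_action_def by blast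

lemma sym_action_hom: "sym_action m a W \<Longrightarrow> 1 \<le> i \<Longrightarrow> i < m \<Longrightarrow> Modules.module_hom scale scale (a i)"
  unfolding sym_action_def by blast

lemma sym_action_closed: "sym_action m a W \<Longrightarrow> 1 \<le> i \<Longrightarrow> i < m \<Longrightarrow> w \<in> W \<Longrightarrow> a i w \<in> W"
  unfolding sym_action_def by blast

lemma sym_action_invol: "sym_action m a W \<Longrightarrow> 1 \<le> i \<Longrightarrow> i < m \<Longrightarrow> w \<in> W \<Longrightarrow> a i (a i w) = w"
  unfolding sym_action_def by blast

lemma sym_action_commute:
  "sym_action m a W \<Longrightarrow> 1 \<le> i \<Longrightarrow> i + 2 \<le> j \<Longrightarrow> j < m \<Longrightarrow> w \<in> W \<Longrightarrow> a i (a j w) = a j (a i w)"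
  unfolding sym_action_def by blast

lemma sym_action_braid:
  "sym_action m a W \<Longrightarrow> 1 \<le> i \<Longrightarrow> Suc i < m \<Longrightarrow> w \<in> W \<Longrightarrow>
    a i (a (Suc i) (a i w)) = a (Suc i) (a i (a (Suc i) w))"
  unfolding sym_action_def by blast

lemma sym_action_shift:
  assumes A: "sym_action m a W" and "k + r \<le> m"
  shows "sym_action k (\<lambda>i. a (i + r)) W"
proof (rule sym_actionI[OF sym_action_subspace[OF A]])
  show "Modules.module_hom scale scale (a (i + r))" if "1 \<le> i" "i < k" for i
    using that \<open>k + r \<le> m\<close> by (intro sym_action_hom[OF A]) auto
  show "a (i + r) w \<in> W" "a (i + r) (a (i + r) w) = w" if "1 \<le> i" "i < k" "w \<in> W" for i w
    using that \<open>k + r \<le> m\<close> by (auto intro!: sym_action_closed[OF A] sym_action_invol[OF A])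
  show "a (i + r) (a (j + r) w) = a (j + r) (a (i + r) w)"
    if "1 \<le> i" "i + 2 \<le> j" "j < k" "w \<in> W" for i j w
    using that \<open>k + r \<le> m\<close> by (intro sym_action_commute[OF A]) auto
  show "a (i + r) (a (Suc i + r) (a (i + r) w)) = a (Suc i + r) (a (i + r) (a (Suc i + r) w))"
    if "1 \<le> i" "Suc i < k" "w \<in> W" for i w
    unfolding add_Suc using that \<open>k + r \<le> m\<close> by (intro sym_action_braid[OF A]) auto
qed

text \<open>The generators from \<open>a 3\<close> on commute with \<open>a 1\<close>, hence act on its eigenspaces.\<close>

lemma sym_action_eigenspace:
  assumes A: "sym_action (m + 2) a W" and "1 \<le> m"
  shows "sym_action m (\<lambda>i. a (i + 2)) {w \<in> W. a 1 w = c *s w}"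
proof -
  interpret f: Modules.module_hom scale scale "a 1"
    using sym_action_hom[OF A] \<open>1 \<le> m\<close> by simp
  note [simp] = f.add[unfolded One_nat_def] f.scale[unfolded One_nat_def] f.zero[unfolded One_nat_def]
  have sub: "subspace {w \<in> W. a 1 w = c *s w}"
    using sym_action_subspace[OF A]
    by (auto simp: subspace_def scale_right_distrib mult.commute)
  have E: "a 1 (a (i + 2) w) = c *s a (i + 2) w"
    if "1 \<le> i" "i < m" "w \<in> W" "a 1 w = c *s w" for i w
  proof -
    interpret g: Modules.module_hom scale scale "a (i + 2)"
      using sym_action_hom[OF A] that by simp
    have "a 1 (a (i + 2) w) = a (i + 2) (a 1 w)"
      by (rule sym_action_commute[OF A]) (use that in auto)
    then show ?thesis unfolding that(4) g.scale .
  qed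
  have B: "sym_action m (\<lambda>i. a (i + 2)) W" by (rule sym_action_shift[OF A]) simp
  show ?thesis
  proof (rule sym_actionI[OF sub sym_action_hom[OF B]])
    show "a (i + 2) w \<in> {w \<in> W. a 1 w = c *s w}"
      if "1 \<le> i" "i < m" "w \<in> {w \<in> W. a 1 w = c *s w}" for i w
      using that E[of i w] sym_action_closed[OF B, of i w] by simp
  qed (use sym_action_invol[OF B] sym_action_commute[OF B] sym_action_braid[OF B] in blast)+
qed

text \<open>For \<open>k = -1\<close> this is the twist by the sign character.\<close>

lemma sym_action_scale:
  assumes A: "sym_action m a W" and k: "k * k = 1"
  shows "sym_action m (\<lambda>i w. k *s a i w) W"
proof -
  have sc: "a i (c *s w) = c *s a i w" if "1 \<le> i" "i < m" for i w c
  proof -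
    interpret g: Modules.module_hom scale scale "a i" using sym_action_hom[OF A] that by simp
    show ?thesis by (rule g.scale)
  qed
  have hom: "Modules.module_hom scale scale (\<lambda>w. k *s a i w)" if "1 \<le> i" "i < m" for i
  proof -
    interpret g: Modules.module_hom scale scale "a i" using sym_action_hom[OF A] that by simp
    show ?thesis by unfold_locales (simp_all add: g.add g.scale scale_right_distrib scale_left_commute)
  qed
  show ?thesis
  proof (rule sym_actionI[OF sym_action_subspace[OF A] hom])
    show "k *s a i w \<in> W" if "1 \<le> i" "i < m" "w \<in> W" for i w
      using that sym_action_closed[OF A] subspace_scale[OF sym_action_subspace[OF A]] by blast
    show "k *s a i (k *s a i w) = w" if "1 \<le> i" "i < m" "w \<in> W" for i w
      using that k sym_action_invol[OF A] by (simp add: sc)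
    show "k *s a i (k *s a j w) = k *s a j (k *s a i w)"
      if "1 \<le> i" "i + 2 \<le> j" "j < m" "w \<in> W" for i j w
      using that sym_action_commute[OF A, of i j w] by (simp add: sc)
    show "k *s a i (k *s a (Suc i) (k *s a i w)) = k *s a (Suc i) (k *s a i (k *s a (Suc i) w))"
      if "1 \<le> i" "Suc i < m" "w \<in> W" for i w
      using that sym_action_braid[OF A, of i w] by (simp add: sc)
  qed
qed

definition permuted :: "nat \<Rightarrow> (nat \<Rightarrow> 'v \<Rightarrow> 'v) \<Rightarrow> (nat \<Rightarrow> 'v) \<Rightarrow> bool" where
  "permuted m a y \<longleftrightarrow> (\<forall>i\<in>{1..<m}. a i (y i) = y (Suc i) \<and> a i (y (Suc i)) = y i \<and>
     (\<forall>j\<in>{1..m} - {i, Suc i}. a i (y j) = y j))"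

lemma permuted_transpose:
  assumes "permuted m a y" "1 \<le> i" "i < m" "j \<in> {1..m}"
  shows "a i (y j) = y (Transposition.transpose i (Suc i) j)"
  using assms by (auto simp: permuted_def Transposition.transpose_def)

lemma permuted_sum:
  assumes "permuted m a y" "1 \<le> i" "i < m"
  shows "(\<Sum>j=1..m. a i (y j)) = (\<Sum>j=1..m. y j)"
proof -
  have "(\<Sum>j=1..m. a i (y j)) = (\<Sum>j=1..m. y (Transposition.transpose i (Suc i) j))"
    using assms by (intro sum.cong) (auto simp: permuted_transpose)
  also have "\<dots> = (\<Sum>j=1..m. y j)"
    by (rule sum.reindex_bij_witness[of _ "Transposition.transpose i (Suc i)" "Transposition.transpose i (Suc i)"])
       (use assms in \<open>auto simp: Transposition.transpose_def split: if_splits\<close>)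
  finally show ?thesis .
qed

text \<open>A vector fixed by the stabiliser of the point 1 has an orbit indexed by the points.\<close>

lemma orbit_of_fixed_vector:
  assumes A: "sym_action m a W" and x: "x \<in> W" and fixed: "\<And>j. 2 \<le> j \<Longrightarrow> j < m \<Longrightarrow> a j x = x"
  obtains y where "y 1 = x" "\<And>i. i \<in> {1..m} \<Longrightarrow> y i \<in> W" "permuted m a y"
proof -
  define y where "y i = rec_nat x (\<lambda>t v. a (Suc t) v) (i - 1)" for i
  have y1: "y 1 = x" by (simp add: y_def)
  have y_Suc: "y (Suc i) = a i (y i)" if "1 \<le> i" for i
    using that by (cases i) (auto simp: y_def)
  have W: "1 \<le> i \<Longrightarrow> i \<le> m \<Longrightarrow> y i \<in> W" for i
  proof (induction i)
    case (Suc i)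
    then show ?case using y1 x y_Suc[of i] sym_action_closed[OF A, of i "y i"] by (cases "i = 0") auto
  qed simp
  have below: "1 \<le> j \<Longrightarrow> j < i \<Longrightarrow> i < m \<Longrightarrow> a i (y j) = y j" for i j
  proof (induction j)
    case (Suc j)
    show ?case
    proof (cases "j = 0")
      case True
      then show ?thesis using y1 fixed[of i] Suc.prems by simp
    next
      case False
      then have "a i (a j (y j)) = a j (a i (y j))"
        using sym_action_commute[OF A, of j i "y j"] W[of j] Suc.prems by simp
      then show ?thesis using Suc False by (simp add: y_Suc)
    qed
  qed simp
  have above: "1 \<le> i \<Longrightarrow> i + 2 \<le> j \<Longrightarrow> j \<le> m \<Longrightarrow> a i (y j) = y j" for i j
  proof (induction j)
    case (Suc j)
    show ?case
    proof (cases "i + 2 \<le> j")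
      case True
      then have "a i (a j (y j)) = a j (a i (y j))"
        using sym_action_commute[OF A, of i j "y j"] W[of j] Suc.prems by simp
      then show ?thesis using Suc True by (simp add: y_Suc)
    next
      case False
      then have j: "j = Suc i" using Suc.prems by simp
      have "a i (a (Suc i) (a i (y i))) = a (Suc i) (a i (a (Suc i) (y i)))"
        using sym_action_braid[OF A, of i "y i"] W[of i] Suc.prems j by simp
      then show ?thesis using below[of i "Suc i"] Suc.prems j by (simp add: y_Suc)
    qed
  qed simp
  have "permuted m a y"
    unfolding permuted_def
  proof (intro ballI conjI)
    fix i j assume i: "i \<in> {1..<m}"
    then show "a i (y i) = y (Suc i)" "a i (y (Suc i)) = y i"
      using W[of i] sym_action_invol[OF A, of i "y i"] by (auto simp: y_Suc)
    assume "j \<in> {1..m} - {i, Suc i}"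
    then show "a i (y j) = y j"
      using i below[of j i] above[of i j] by (cases "j < i") auto
  qed
  then show ?thesis using that y1 W by auto
qed

lemma permuted_adjacent_distinct:
  assumes A: "sym_action m a W" and y: "\<And>i. i \<in> {1..m} \<Longrightarrow> y i \<in> W" "permuted m a y" "y 1 \<noteq> y 2"
  shows "1 \<le> i \<Longrightarrow> i < m \<Longrightarrow> y i \<noteq> y (Suc i)"
proof (induction i)
  case (Suc i)
  show ?case
  proof (cases "i = 0")
    case True
    then show ?thesis using y(3) by (simp add: numeral_2_eq_2)
  next
    case False
    show ?thesis
    proof
      assume eq: "y (Suc i) = y (Suc (Suc i))"
      have "a i (y (Suc i)) = y i" "a i (y (Suc (Suc i))) = y (Suc (Suc i))"
        using y(2) False Suc.prems by (auto simp: permuted_def)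
      then have "y i = y (Suc i)" using eq by simp
      then show False using Suc False by simp
    qed
  qed
qed simp

text \<open>Applying \<open>a i\<close> to a linear combination changes only two of its coefficients.\<close>

lemma permuted_combination_diff:
  assumes A: "sym_action m a W" and y: "permuted m a y" and i: "1 \<le> i" "i < m"
  shows "(\<Sum>j=1..m. c j *s y j) - a i (\<Sum>j=1..m. c j *s y j)
    = (c i - c (Suc i)) *s (y i - y (Suc i))"
proof -
  interpret f: Modules.module_hom scale scale "a i" using sym_action_hom[OF A] i by simp
  have "(\<Sum>j=1..m. c j *s y j) - a i (\<Sum>j=1..m. c j *s y j) = (\<Sum>j=1..m. c j *s (y j - a i (y j)))"
    by (simp add: f.sum f.scale sum_subtractf scale_right_diff_distrib)
  also have "\<dots> = (\<Sum>j\<in>{i, Suc i}. c j *s (y j - a i (y j)))"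
    by (rule sum.mono_neutral_right) (use y i in \<open>auto simp: permuted_def\<close>)
  also have "\<dots> = c i *s (y i - y (Suc i)) + c (Suc i) *s (y (Suc i) - y i)"
    using y i by (simp add: permuted_def)
  also have "\<dots> = (c i - c (Suc i)) *s (y i - y (Suc i))"
    by (simp add: scale_left_diff_distrib scale_right_diff_distrib)
  finally show ?thesis .
qed

lemma constant_if_adjacent_eq:
  fixes c :: "nat \<Rightarrow> 'b"
  assumes "\<And>i. r \<le> i \<Longrightarrow> i < m \<Longrightarrow> c i = c (Suc i)"
  shows "r \<le> i \<Longrightarrow> i \<le> m \<Longrightarrow> c i = c r"
proof (induction i)
  case (Suc i)
  then show ?case using assms[of i] by (cases "Suc i = r") auto
qed auto

text \<open>Subtracting from a linear relation its image under \<open>a i\<close> compares two adjacent coefficients.  So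
  the sum is the only linear combination of the permuted vectors that may vanish, up to a factor.\<close>

lemma permuted_relation_constant:
  assumes A: "sym_action m a W" and y: "\<And>i. i \<in> {1..m} \<Longrightarrow> y i \<in> W" "permuted m a y" "y 1 \<noteq> y 2"
    and rel: "(\<Sum>j=1..m. c j *s y j) = 0" and i: "1 \<le> i" "i \<le> m"
  shows "c i = c 1"
proof (rule constant_if_adjacent_eq[OF _ i])
  fix i assume i: "1 \<le> i" "i < m"
  interpret f: Modules.module_hom scale scale "a i" using sym_action_hom[OF A] i by simp
  have "(c i - c (Suc i)) *s (y i - y (Suc i)) = 0"
    using permuted_combination_diff[OF A y(2) i, of c] rel by simp
  then show "c i = c (Suc i)"
    using permuted_adjacent_distinct[OF A y i] by simp
qed

lemma permuted_indep_family:
  assumes A: "sym_action m a W" and y: "\<And>i. i \<in> {1..m} \<Longrightarrow> y i \<in> W" "permuted m a y" "y 1 \<noteq> y 2"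
  shows "indep_family (m - 1) (\<lambda>i. y (Suc i))"
  unfolding indep_family_def
proof (intro allI impI)
  fix c i assume sum: "(\<Sum>i<m - 1. c i *s y (Suc i)) = 0" and i: "i < m - 1"
  define d where "d j = (if j < m then c (j - 1) else 0)" for j
  have "(\<Sum>j=1..m. d j *s y j) = (\<Sum>j=1..<m. d j *s y j)"
    by (rule sum.mono_neutral_right) (auto simp: d_def)
  also have "\<dots> = (\<Sum>i<m - 1. c i *s y (Suc i))"
    by (rule sum.reindex_bij_witness[of _ Suc "\<lambda>j. j - 1"]) (auto simp: d_def)
  finally have rel: "(\<Sum>j=1..m. d j *s y j) = 0" using sum by simp
  have "d (Suc i) = d 1" "d m = d 1"
    by (rule permuted_relation_constant[OF A y rel]; use i in simp)+
  moreover have "Suc i < m" using i by simp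
  ultimately show "c i = 0" by (simp add: d_def)
qed

text \<open>By complete reducibility this says that all constituents of the representation are
  one-dimensional.\<close>

definition generators_agree :: "nat \<Rightarrow> (nat \<Rightarrow> 'v \<Rightarrow> 'v) \<Rightarrow> 'v set \<Rightarrow> bool" where
  "generators_agree m a W \<longleftrightarrow> (\<forall>w\<in>W. \<forall>i\<in>{1..<m}. a i w = a 1 w)"

text \<open>If two adjacent generators commute, the braid relation makes them equal.  Equality then
  spreads, because each of the two commutes with the neighbours that the other one has not.\<close>

lemma commuting_neighbours_equal:
  assumes A: "sym_action m a W" and i: "1 \<le> i" "Suc i < m"
    and comm: "\<And>w. w \<in> W \<Longrightarrow> a i (a (Suc i) w) = a (Suc i) (a i w)" and w: "w \<in> W"
  shows "a i w = a (Suc i) w"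
proof -
  have cl: "a i w \<in> W" "a (Suc i) w \<in> W" using sym_action_closed[OF A] i w by auto
  have "a i w = a (Suc i) (a (Suc i) (a i w))" using sym_action_invol[OF A, of "Suc i"] i cl by simp
  also have "\<dots> = a (Suc i) (a i (a (Suc i) w))" using comm[OF w] by simp
  also have "\<dots> = a i (a (Suc i) (a i w))" using sym_action_braid[OF A i w] by simp
  also have "\<dots> = a i (a i (a (Suc i) w))" using comm[OF w] by simp
  also have "\<dots> = a (Suc i) w" using sym_action_invol[OF A, of i] i cl by simp
  finally show ?thesis .
qed

lemma generators_agree_if_neighbours_equal:
  assumes A: "sym_action m a W" and r: "1 \<le> r" "Suc r < m"
    and eq: "\<And>w. w \<in> W \<Longrightarrow> a r w = a (Suc r) w"
  shows "generators_agree m a W"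
proof -
  define P where "P i \<longleftrightarrow> (\<forall>w\<in>W. a i w = a (Suc i) w)" for i
  have up: "P (Suc i)" if "P i" "1 \<le> i" "Suc (Suc i) < m" for i
    unfolding P_def
  proof
    fix w assume w: "w \<in> W"
    show "a (Suc i) w = a (Suc (Suc i)) w"
    proof (rule commuting_neighbours_equal[OF A _ that(3) _ w])
      fix w assume "w \<in> W"
      then show "a (Suc i) (a (Suc (Suc i)) w) = a (Suc (Suc i)) (a (Suc i) w)"
        using that sym_action_commute[OF A, of i "Suc (Suc i)" w]
          sym_action_closed[OF A, of "Suc (Suc i)" w] by (simp add: P_def)
    qed (use that in simp)
  qed
  have down: "P i" if "P (Suc i)" "1 \<le> i" "Suc (Suc i) < m" for i
    unfolding P_def
  proof
    fix w assume w: "w \<in> W"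
    show "a i w = a (Suc i) w"
    proof (rule commuting_neighbours_equal[OF A that(2) _ _ w])
      fix w assume "w \<in> W"
      then show "a i (a (Suc i) w) = a (Suc i) (a i w)"
        using that sym_action_commute[OF A, of i "Suc (Suc i)" w]
          sym_action_closed[OF A, of i w] by (simp add: P_def)
    qed (use that in simp)
  qed
  have "P r" using eq by (simp add: P_def)
  have "P i" if "1 \<le> i" "Suc i < m" for i
  proof (cases "i \<le> r")
    case True
    then show ?thesis using that(1)
    proof (induction rule: inc_induct)
      case (step j)
      then show ?case using down[of j] r by simp
    qed (rule \<open>P r\<close>)
  next
    case False
    then have "r \<le> i" by simp
    then show ?thesis using that(2)
    proof (induction rule: dec_induct)
      case (step j)
      then show ?case using up[of j] r by simp
    qed (rule \<open>P r\<close>)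
  qed
  then have all: "\<And>i w. 1 \<le> i \<Longrightarrow> Suc i < m \<Longrightarrow> w \<in> W \<Longrightarrow> a i w = a (Suc i) w"
    unfolding P_def by blast
  show ?thesis
    unfolding generators_agree_def
  proof (intro ballI)
    fix w i assume w: "w \<in> W" and i: "i \<in> {1..<m}"
    show "a i w = a 1 w"
    proof (rule constant_if_adjacent_eq[of 1 "m - 1" "\<lambda>i. a i w" i])
      show "a j w = a (Suc j) w" if "1 \<le> j" "j < m - 1" for j
        by (rule all[OF that(1) _ w]) (use that in simp)
    qed (use i in auto)
  qed
qed

lemma generators_agree_if_first_third_equal:
  assumes A: "sym_action m a W" and m: "5 \<le> m" and eq: "\<And>w. w \<in> W \<Longrightarrow> a 1 w = a 3 w"
  shows "generators_agree m a W"
proof (rule generators_agree_if_neighbours_equal[OF A])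
  fix w assume w: "w \<in> W"
  show "a 3 w = a (Suc 3) w"
  proof (rule commuting_neighbours_equal[OF A _ _ _ w])
    fix w assume "w \<in> W"
    then show "a 3 (a (Suc 3) w) = a (Suc 3) (a 3 w)"
      using eq[of w] eq[of "a (Suc 3) w"] sym_action_commute[OF A, of 1 "Suc 3" w]
        sym_action_closed[OF A, of "Suc 3" w] m by simp
  qed (use m in simp_all)
qed (use m in simp_all)

text \<open>The product \<open>a 2 a 1 a 3 a 2\<close>, that is, the permutation exchanging (12) and (34), carries
  the joint eigenspaces of \<open>a 1\<close> and \<open>a 3\<close> for \<open>(-1, 1)\<close> and \<open>(1, -1)\<close> into each other.  If they
  vanish, then \<open>a 1\<close> and \<open>a 3\<close> coincide.\<close>

lemma mixed_eigenvector_exists: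
  assumes A: "sym_action m a W" and m: "5 \<le> m" and dis: "\<not> generators_agree m a W"
  shows "\<exists>v\<in>W. v \<noteq> 0 \<and> a 1 v = - v \<and> a 3 v = v"
proof (rule ccontr)
  assume none: "\<not> ?thesis"
  define f1 f2 f3 where f_def: "f1 = a 1" "f2 = a 2" "f3 = a 3"
  interpret f1: Modules.module_hom scale scale f1 unfolding f_def using sym_action_hom[OF A] m by simp
  interpret f2: Modules.module_hom scale scale f2 unfolding f_def using sym_action_hom[OF A] m by simp
  interpret f3: Modules.module_hom scale scale f3 unfolding f_def using sym_action_hom[OF A] m by simp
  have cl: "f1 w \<in> W" "f2 w \<in> W" "f3 w \<in> W" if "w \<in> W" for w
    unfolding f_def by (rule sym_action_closed[OF A]; use m that in simp)+
  have inv: "f1 (f1 w) = w" "f2 (f2 w) = w" "f3 (f3 w) = w" if "w \<in> W" for w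
    unfolding f_def by (rule sym_action_invol[OF A]; use m that in simp)+
  have comm: "f1 (f3 w) = f3 (f1 w)" if "w \<in> W" for w
    unfolding f_def by (rule sym_action_commute[OF A]; use m that in simp)
  have b12: "f1 (f2 (f1 w)) = f2 (f1 (f2 w))" if "w \<in> W" for w
    using sym_action_braid[OF A, of 1 w] m that by (simp add: f_def numeral_2_eq_2)
  have b23: "f2 (f3 (f2 w)) = f3 (f2 (f3 w))" if "w \<in> W" for w
    using sym_action_braid[OF A, of 2 w] m that by (simp add: f_def numeral_3_eq_3 numeral_2_eq_2)
  have sub: "subspace W" by (rule sym_action_subspace[OF A])
  define g where "g w = f2 (f1 (f3 (f2 w)))" for w
  have g1: "f1 (g w) = g (f3 w)" if w: "w \<in> W" for w
  proof -
    have "f1 (g w) = f2 (f1 (f2 (f3 (f2 w))))" unfolding g_def using w by (simp add: b12 cl)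
    also have "\<dots> = g (f3 w)" unfolding g_def using w by (simp add: b23 cl)
    finally show ?thesis .
  qed
  have g3: "f3 (g w) = g (f1 w)" if w: "w \<in> W" for w
  proof -
    have "f3 (g w) = f3 (f2 (f3 (f1 (f2 w))))" unfolding g_def using w by (simp add: comm cl)
    also have "\<dots> = f2 (f3 (f2 (f1 (f2 w))))" using w by (simp add: b23 cl)
    also have "\<dots> = f2 (f3 (f1 (f2 (f1 w))))" using w by (simp add: b12 cl)
    also have "\<dots> = g (f1 w)" unfolding g_def using w by (simp add: comm cl)
    finally show ?thesis .
  qed
  have mp: "v = 0" if "v \<in> W" "f1 v = - v" "f3 v = v" for v
    using none that unfolding f_def by blast
  have pm: "v = 0" if v: "v \<in> W" "f1 v = v" "f3 v = - v" for v
  proof -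
    have gneg: "g (- v) = - g v" by (simp add: g_def f1.neg f2.neg f3.neg)
    have "f1 (g v) = - g v" "f3 (g v) = g v"
      using g1[OF v(1)] g3[OF v(1)] v by (simp_all add: gneg)
    moreover have "g v \<in> W" unfolding g_def by (intro cl v)
    ultimately have "g v = 0" by (intro mp)
    have "v = f2 (f3 (f1 (f2 (g v))))" unfolding g_def using v(1) by (simp add: inv cl)
    then show "v = 0" using \<open>g v = 0\<close> by (simp add: f1.zero f2.zero f3.zero)
  qed
  have "f1 w = f3 w" if w: "w \<in> W" for w
  proof -
    define p where "p = w - f1 w + f3 w - f1 (f3 w)"
    define q where "q = w + f1 w - f3 w - f1 (f3 w)"
    have "p \<in> W" "q \<in> W"
      unfolding p_def q_def by (intro subspace_add[OF sub] subspace_diff[OF sub] cl w)+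
    have "f1 p = - p"
      unfolding p_def using w by (simp add: f1.add f1.diff inv cl)
    have "f3 p = p"
      unfolding p_def using w by (simp add: f3.add f3.diff comm inv cl)
    have "f1 q = q"
      unfolding q_def using w by (simp add: f1.add f1.diff inv cl)
    have "f3 q = - q"
      unfolding q_def using w by (simp add: f3.add f3.diff comm inv cl)
    have "p - q = 0"
      using mp[OF \<open>p \<in> W\<close> \<open>f1 p = - p\<close> \<open>f3 p = p\<close>] pm[OF \<open>q \<in> W\<close> \<open>f1 q = q\<close> \<open>f3 q = - q\<close>] by simp
    moreover have "p - q = (f3 w - f1 w) + (f3 w - f1 w)" by (simp add: p_def q_def)
    ultimately show ?thesis using double_eq_0[of "f3 w - f1 w"] by simp
  qed
  then show False using generators_agree_if_first_third_equal[OF A m] dis unfolding f_def by blast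
qed

text \<open>In the permutation module with basis \<open>x\<^sub>1, \<dots>, x\<^sub>m\<close> the vector \<open>v\<close> below plays the role of
  \<open>x\<^sub>1 - x\<^sub>2\<close>, and its images \<open>u\<^sub>j\<close> that of \<open>x\<^sub>1 - x\<^sub>j\<close>; their sum is then
  \<open>m x\<^sub>1 - (x\<^sub>1 + \<dots> + x\<^sub>m)\<close>, a vector fixed by the stabiliser of the point 1.  That differences
  of points add up correctly, \<open>(x\<^sub>1 - x\<^sub>2) + (x\<^sub>2 - x\<^sub>3) = x\<^sub>1 - x\<^sub>3\<close>, is where the agreement of
  the later generators on the \<open>-1\<close> eigenspace of \<open>a 1\<close> enters: the defect \<open>w\<close> is negated by \<open>a 1\<close>
  and \<open>a 2\<close> and fixed by \<open>a 3\<close>, which contradicts the braid relation of \<open>a 2\<close> and \<open>a 3\<close>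
  unless it vanishes.\<close>

lemma permuted_vectors_exist:
  assumes A: "sym_action m a W" and m: "5 \<le> m"
    and agree: "generators_agree (m - 2) (\<lambda>i. a (i + 2)) {w \<in> W. a 1 w = (- 1) *s w}"
    and dis: "\<not> generators_agree m a W"
  shows "\<exists>y. (\<forall>i\<in>{1..m}. y i \<in> W) \<and> permuted m a y \<and> y 1 \<noteq> y 2"
proof -
  obtain v where v: "v \<in> W" "v \<noteq> 0" "a 1 v = - v" "a 3 v = v"
    using mixed_eigenvector_exists[OF A m dis] by blast
  define f1 f2 f3 where f_def: "f1 = a 1" "f2 = a 2" "f3 = a 3"
  interpret f1: Modules.module_hom scale scale f1 unfolding f_def using sym_action_hom[OF A] m by simp
  interpret f2: Modules.module_hom scale scale f2 unfolding f_def using sym_action_hom[OF A] m by simp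
  interpret f3: Modules.module_hom scale scale f3 unfolding f_def using sym_action_hom[OF A] m by simp
  have cl: "f1 w \<in> W" "f2 w \<in> W" "f3 w \<in> W" if "w \<in> W" for w
    unfolding f_def by (rule sym_action_closed[OF A]; use m that in simp)+
  have inv: "f1 (f1 w) = w" "f2 (f2 w) = w" "f3 (f3 w) = w" if "w \<in> W" for w
    unfolding f_def by (rule sym_action_invol[OF A]; use m that in simp)+
  have b12: "f2 (f1 (f2 w)) = f1 (f2 (f1 w))" if "w \<in> W" for w
    using sym_action_braid[OF A, of 1 w] m that by (simp add: f_def numeral_2_eq_2)
  have b23: "f2 (f3 (f2 w)) = f3 (f2 (f3 w))" if "w \<in> W" for w
    using sym_action_braid[OF A, of 2 w] m that by (simp add: f_def numeral_3_eq_3 numeral_2_eq_2)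
  have sub: "subspace W" by (rule sym_action_subspace[OF A])
  have later: "a j w = a 3 w" if w: "w \<in> W" "a 1 w = - w" and j: "3 \<le> j" "j < m" for j w
  proof -
    have "j - 2 \<in> {1..<m - 2}" using j by auto
    then have "a (j - 2 + 2) w = a (1 + 2) w"
      using agree w unfolding generators_agree_def by (auto simp del: One_nat_def)
    moreover have "j - 2 + 2 = j" "1 + 2 = (3::nat)" using j by auto
    ultimately show ?thesis by (simp only:)
  qed
  have v_fixed: "a j v = v" if "3 \<le> j" "j < m" for j using later[OF v(1,3) that] v(4) by simp
  define w where "w = v + f1 (f2 v) - f2 v"
  have "w = 0"
  proof -
    have wW: "w \<in> W" unfolding w_def by (intro subspace_add[OF sub] subspace_diff[OF sub] cl v)
    have fv: "f1 v = - v" "f3 v = v" using v by (auto simp: f_def)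
    have w1: "f1 w = - w" unfolding w_def using v(1) fv by (simp add: f1.add f1.diff inv cl)
    have w2: "f2 w = - w"
      unfolding w_def using v(1) fv by (simp add: f2.add f2.diff b12 inv cl f1.neg f2.neg)
    have "a 4 w = w"
    proof -
      interpret f4: Modules.module_hom scale scale "a 4" using sym_action_hom[OF A] m by simp
      have c: "a 4 (f1 u) = f1 (a 4 u)" "a 4 (f2 u) = f2 (a 4 u)" if "u \<in> W" for u
        unfolding f_def by (rule sym_action_commute[OF A, symmetric]; use m that in simp)+
      show ?thesis
        unfolding w_def using v(1) v_fixed[of 4] m by (simp add: f4.add f4.diff c cl)
    qed
    then have w3: "f3 w = w" using later[OF wW, of 4] w1 m by (simp add: f_def)
    have "w = - w" using b23[OF wW] by (simp add: w2 w3 f2.neg f3.neg)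
    then show ?thesis using neg_eq_self_iff by metis
  qed
  have sh: "sym_action (m - 1) (\<lambda>i. a (i + 1)) W" by (rule sym_action_shift[OF A]) (use m in simp)
  obtain u where u: "u 1 = v" "\<And>i. i \<in> {1..m - 1} \<Longrightarrow> u i \<in> W" "permuted (m - 1) (\<lambda>i. a (i + 1)) u"
    by (rule orbit_of_fixed_vector[OF sh v(1)]) (use v_fixed in auto)
  have u_Suc: "u (Suc j) = a (Suc j) (u j)" if "1 \<le> j" "j < m - 1" for j
    using u(3) that by (simp add: permuted_def)
  have diff: "2 \<le> j \<Longrightarrow> j \<le> m - 1 \<Longrightarrow> u j - f1 (u j) = v" for j
  proof (induction j)
    case (Suc j)
    show ?case
    proof (cases "j = 1")
      case True
      then have "u (Suc j) = f2 v" using u_Suc[of 1] u(1) m by (simp add: f_def numeral_2_eq_2)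
      then show ?thesis using \<open>w = 0\<close> by (simp add: w_def algebra_simps)
    next
      case False
      interpret g: Modules.module_hom scale scale "a (Suc j)"
        by (rule sym_action_hom[OF A]) (use Suc.prems in auto)
      have jW: "u j \<in> W" using u(2)[of j] Suc.prems by simp
      have "u (Suc j) = a (Suc j) (u j)" using u_Suc[of j] Suc.prems False by simp
      moreover have "f1 (a (Suc j) (u j)) = a (Suc j) (f1 (u j))"
        unfolding f_def by (rule sym_action_commute[OF A]) (use Suc.prems False jW in auto)
      ultimately have "u (Suc j) - f1 (u (Suc j)) = a (Suc j) (u j - f1 (u j))"
        by (simp add: g.diff)
      then show ?thesis using Suc False v_fixed[of "Suc j"] by simp
    qed
  qed simp
  define Y where "Y = (\<Sum>j=1..m - 1. u j)"
  have "Y \<in> W" unfolding Y_def by (rule subspace_sum[OF sub]) (use u(2) in auto)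
  have Y_fixed: "a i Y = Y" if i: "2 \<le> i" "i < m" for i
  proof -
    interpret g: Modules.module_hom scale scale "a i"
      by (rule sym_action_hom[OF A]) (use i in auto)
    have "a i Y = (\<Sum>j=1..m - 1. a (i - 1 + 1) (u j))" using i by (simp add: Y_def g.sum)
    also have "\<dots> = Y" unfolding Y_def by (rule permuted_sum[OF u(3)]) (use i in auto)
    finally show ?thesis .
  qed
  obtain y where y: "y 1 = Y" "\<And>i. i \<in> {1..m} \<Longrightarrow> y i \<in> W" "permuted m a y"
    using orbit_of_fixed_vector[OF A \<open>Y \<in> W\<close> Y_fixed] by blast
  have "Y - f1 Y = (\<Sum>j=1..m - 1. u j - f1 (u j))" by (simp add: Y_def f1.sum sum_subtractf)
  also have "\<dots> = (u 1 - f1 (u 1)) + (\<Sum>j=2..m - 1. u j - f1 (u j))"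
    using m sum.atLeast_Suc_atMost[of 1 "m - 1" "\<lambda>j. u j - f1 (u j)"] by (simp add: numeral_2_eq_2)
  also have "(\<Sum>j=2..m - 1. u j - f1 (u j)) = (\<Sum>j=2..m - 1. v)"
    by (rule sum.cong) (auto intro: diff)
  also have "\<dots> = of_nat (m - 2) *s v" using m by (simp add: sum_constant_scale)
  also have "u 1 - f1 (u 1) = of_nat 2 *s v" using u(1) v(3) scale_left_distrib[of 1 1 v] by (simp add: f_def)
  finally have "Y - f1 Y = of_nat m *s v" using m by (simp flip: scale_left_distrib)
  then have "Y \<noteq> f1 Y" using v(2) m by auto
  moreover have "y 2 = f1 Y" using y(1,3) m by (force simp: permuted_def f_def numeral_2_eq_2)
  ultimately show ?thesis using y by metis
qed

lemma generators_agree_scale: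
  "generators_agree m (\<lambda>i w. k *s a i w) W \<longleftrightarrow> generators_agree m a W" if "k \<noteq> 0"
  using that by (auto simp: generators_agree_def)

lemma generators_agree_smaller:
  assumes A: "sym_action m a W" and "3 \<le> k" "k \<le> m" and "generators_agree k a W"
  shows "generators_agree m a W"
proof (rule generators_agree_if_neighbours_equal[OF A])
  fix w assume "w \<in> W"
  moreover have "Suc 1 \<in> {1..<k}" using assms(2) by simp
  ultimately have "a (Suc 1) w = a 1 w" using assms(4) unfolding generators_agree_def by blast
  then show "a 1 w = a (Suc 1) w" by (rule HOL.sym)
qed (use assms(2,3) in simp_all)

lemma permuted_vectors_exist_twisted:
  assumes A: "sym_action m a W" and m: "5 \<le> m" and k: "k * k = 1"
    and agree: "generators_agree (m - 2) (\<lambda>i. a (i + 2)) {w \<in> W. a 1 w = (- k) *s w}"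
    and dis: "\<not> generators_agree m a W"
  shows "\<exists>y. (\<forall>i\<in>{1..m}. y i \<in> W) \<and> permuted m (\<lambda>i w. k *s a i w) y \<and> y 1 \<noteq> y 2"
proof (rule permuted_vectors_exist[OF sym_action_scale[OF A k] m])
  have "k \<noteq> 0" using k by auto
  have "k *s u = (- 1) *s w \<longleftrightarrow> u = (- k) *s w" for u w
  proof
    assume "k *s u = (- 1) *s w"
    then have "k *s (k *s u) = k *s ((- 1) *s w)" by (rule arg_cong)
    then show "u = (- k) *s w" using k by simp
  next
    assume "u = (- k) *s w"
    then show "k *s u = (- 1) *s w" using k by simp
  qed
  then show "generators_agree (m - 2) (\<lambda>i w. k *s a (i + 2) w)
      {w \<in> W. k *s a 1 w = (- 1) *s w}"
    using agree by (simp only: generators_agree_scale[OF \<open>k \<noteq> 0\<close>, of "m - 2" "\<lambda>i. a (i + 2)"])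
  show "\<not> generators_agree m (\<lambda>i w. k *s a i w) W"
    using dis by (simp only: generators_agree_scale[OF \<open>k \<noteq> 0\<close>] not_False_eq_True)
qed

lemma indep_family_both_eigenspaces:
  assumes A: "sym_action (m + 2) a W" and m: "1 \<le> m"
    and u: "indep_family p u" "\<And>i. i < p \<Longrightarrow> u i \<in> {w \<in> W. a 1 w = (- (- 1)) *s w}"
    and v: "indep_family q v" "\<And>i. i < q \<Longrightarrow> v i \<in> {w \<in> W. a 1 w = (- 1) *s w}"
  shows "\<exists>x. indep_family (p + q) x \<and> (\<forall>i<p + q. x i \<in> W)"
proof (intro exI conjI)
  show "indep_family (p + q) (\<lambda>i. if i < p then u i else v (i - p))"
    by (rule indep_family_eigenspaces[OF sym_action_hom[OF A, of 1]]) (use m u v in auto)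
  show "\<forall>i<p + q. (if i < p then u i else v (i - p)) \<in> W" using u(2) v(2) by auto
qed

lemma indep_family_smaller:
  assumes "indep_family q v" "p \<le> q"
  shows "indep_family p v"
  unfolding indep_family_def
proof (intro allI impI)
  fix c i assume c: "(\<Sum>i<p. c i *s v i) = 0" and i: "i < p"
  have "(\<Sum>i<q. (if i < p then c i else 0) *s v i) = (\<Sum>i<p. (if i < p then c i else 0) *s v i)"
    by (rule sum.mono_neutral_right) (use assms(2) in auto)
  also have "\<dots> = 0" using c by simp
  finally show "c i = 0"
    using indep_familyD[OF assms(1), of "\<lambda>i. if i < p then c i else 0" i] i assms(2) by simp
qed

lemma sym_3_two_independent:
  assumes A: "sym_action 3 a W" and dis: "\<not> generators_agree 3 a W"
  shows "\<exists>v. indep_family 2 v \<and> (\<forall>i<2. v i \<in> W)"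
proof -
  obtain w where w: "w \<in> W" "a 1 w \<noteq> a (Suc 1) w"
    using generators_agree_if_neighbours_equal[OF A, of 1] dis by fastforce
  define f where "f = a 1"
  define g where "g = a (Suc 1)"
  interpret f: Modules.module_hom scale scale f unfolding f_def by (rule sym_action_hom[OF A]) simp_all
  interpret g: Modules.module_hom scale scale g unfolding g_def by (rule sym_action_hom[OF A]) simp_all
  have inv: "f (f w) = w" "g (g w) = w"
    unfolding f_def g_def by (rule sym_action_invol[OF A]; use w in simp)+
  have br: "f (g (f w)) = g (f (g w))"
    unfolding f_def g_def by (rule sym_action_braid[OF A]) (use w in simp_all)
  have cl: "f w \<in> W" "g w \<in> W"
    unfolding f_def g_def by (rule sym_action_closed[OF A]; use w in simp)+
  have fg: "f w \<noteq> g w" using w by (simp only: f_def g_def not_False_eq_True)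
  then have "w \<noteq> 0" by auto
  \<comment> \<open>If both images of \<open>w\<close> were multiples of \<open>w\<close>, the factors would be signs, and the braid
    relation would equate them.\<close>
  have "\<exists>u\<in>{f w, g w}. \<forall>c. u \<noteq> c *s w"
  proof (rule ccontr)
    assume "\<not> ?thesis"
    then obtain c d where cd: "f w = c *s w" "g w = d *s w" by auto
    have "(c * c) *s w = 1 *s w" "(d * d) *s w = 1 *s w"
      using inv unfolding cd f.scale g.scale scale_scale scale_one by blast+
    then have sq: "c * c = 1" "d * d = 1" using \<open>w \<noteq> 0\<close> by (auto simp del: scale_one)
    have "(c * (d * c)) *s w = (d * (c * d)) *s w"
      using br by (simp only: cd f.scale g.scale scale_scale mult.assoc)
    then have "(c * c) * d = (d * d) * c" using \<open>w \<noteq> 0\<close> by (simp add: mult_ac)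
    then have "d = c" unfolding sq by simp
    then show False using cd fg by simp
  qed
  then obtain u where u: "u \<in> W" "\<And>c. u \<noteq> c *s w" using cl by blast
  have "indep_family 2 (\<lambda>j. if j = 0 then w else u)"
    unfolding indep_family_def
  proof (intro allI impI)
    fix c :: "nat \<Rightarrow> 'a" and j
    assume "(\<Sum>j<2. c j *s (if j = 0 then w else u)) = 0" and j: "j < (2::nat)"
    then have rel: "c 0 *s w + c 1 *s u = 0" by (simp add: numeral_2_eq_2)
    have "c 1 = 0"
    proof (rule ccontr)
      assume c1: "c 1 \<noteq> 0"
      have "u = inverse (c 1) *s (c 1 *s u)" using c1 by simp
      also have "c 1 *s u = (- c 0) *s w" using rel by (simp add: add_eq_0_iff)
      also have "inverse (c 1) *s ((- c 0) *s w) = (inverse (c 1) * - c 0) *s w" by (rule scale_scale)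
      finally show False using u(2) by blast
    qed
    moreover from this have "c 0 = 0" using rel \<open>w \<noteq> 0\<close> by simp
    ultimately show "c j = 0" using j by (auto simp: less_2_cases_iff)
  qed
  then show ?thesis
    using u w by (intro exI[of _ "\<lambda>j. if j = 0 then w else u"]) auto
qed

text \<open>A symmetric group of odd degree \<open>m\<close> has no representation of dimension less than \<open>m - 1\<close>
  apart from sums of one-dimensional ones.  If the symmetric group on the last \<open>m - 2\<close> points acts
  through one-dimensional representations on one of the two eigenspaces of \<open>a 1\<close>, the space contains
  differences of permuted vectors; otherwise induction applies in both eigenspaces, and
  \<open>2 (m - 3) \<ge> m - 1\<close>.  The parity keeps the degree 4 out of the induction, where the
  two-dimensional representation of the symmetric group is an exception.\<close>

lemma odd_sym_action_many_independent:
  assumes "sym_action m a W" "odd m" "3 \<le> m" "\<not> generators_agree m a W"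
  shows "\<exists>v. indep_family (m - 1) v \<and> (\<forall>i<m - 1. v i \<in> W)"
  using assms
proof (induction m arbitrary: a W rule: less_induct)
  case (less m)
  note A = less.prems(1) and dis = less.prems(4)
  have sub: "subspace W" by (rule sym_action_subspace[OF A])
  show ?case
  proof (cases "m = 3")
    case True
    then show ?thesis using sym_3_two_independent A dis by simp
  next
    case False
    then have m: "5 \<le> m" using less.prems by presburger
    define E where "E c = {w \<in> W. a 1 w = c *s w}" for c
    have A': "sym_action (m - 2 + 2) a W" using A m by (subst le_add_diff_inverse2) auto
    have B: "sym_action (m - 2) (\<lambda>i. a (i + 2)) (E c)" for c
      unfolding E_def by (rule sym_action_eigenspace[OF A']) (use m in simp)
    show ?thesis
    proof (cases "\<exists>k\<in>{1, - 1}. generators_agree (m - 2) (\<lambda>i. a (i + 2)) (E (- k))")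
      case True
      then obtain k :: 'a where "k \<in> {1, - 1}"
        and k2: "generators_agree (m - 2) (\<lambda>i. a (i + 2)) (E (- k))" by blast
      then have k: "k * k = 1" by auto
      obtain y where y: "\<And>i. i \<in> {1..m} \<Longrightarrow> y i \<in> W" "permuted m (\<lambda>i w. k *s a i w) y" "y 1 \<noteq> y 2"
        using permuted_vectors_exist_twisted[OF A m k k2[unfolded E_def] dis] by blast
      show ?thesis
        using permuted_indep_family[OF sym_action_scale[OF A k] y] y(1) by auto
    next
      case False
      have le1: "1 \<le> m - 2" using m by simp
      have "m - 2 < m" "odd (m - 2)" "3 \<le> m - 2" using m less.prems(2) by auto
      note IH = less.IH[OF this(1) B this(2,3)]
      obtain u where u: "indep_family (m - 3) u" "\<And>i. i < m - 3 \<Longrightarrow> u i \<in> E (- (- 1))"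
        using IH[of "- (- 1)"] False by (auto simp: numeral_3_eq_3 numeral_2_eq_2)
      obtain v where v: "indep_family (m - 3) v" "\<And>i. i < m - 3 \<Longrightarrow> v i \<in> E (- 1)"
        using IH[of "- 1"] False by (auto simp: numeral_3_eq_3 numeral_2_eq_2)
      obtain x where x: "indep_family (m - 3 + (m - 3)) x" "\<forall>i<m - 3 + (m - 3). x i \<in> W"
        using indep_family_both_eigenspaces[OF A' _ u(1) u(2)[unfolded E_def] v(1) v(2)[unfolded E_def]]
          le1 by blast
      have "m - 1 \<le> m - 3 + (m - 3)" using m by simp
      then show ?thesis using indep_family_smaller[OF x(1)] x(2) by (meson less_le_trans)
    qed
  qed
qed

text \<open>The bound on the dimension is \<open>n - 1\<close>, so the two eigenspaces of \<open>a 1\<close> cannot both contain as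
  many independent vectors as \<open>odd_sym_action_many_independent\<close> would provide.  For \<open>n = 6\<close> the argument breaks
  down, and the exotic five-dimensional representations of the symmetric group of degree 6
  contradict the conclusion.\<close>

theorem small_sym_action_permutes:
  assumes A: "sym_action n a W" and n: "7 \<le> n" and T: "finite T" "card T < n" "W \<subseteq> span T"
    and dis: "\<not> generators_agree n a W"
  shows "\<exists>k\<in>{1, - 1}. \<exists>y. (\<forall>i\<in>{1..n}. y i \<in> W) \<and> permuted n (\<lambda>i w. k *s a i w) y \<and> y 1 \<noteq> y 2"
proof (cases "\<exists>k\<in>{1, - 1}. generators_agree (n - 2) (\<lambda>i. a (i + 2)) {w \<in> W. a 1 w = (- k) *s w}")
  case True
  then obtain k where k: "k \<in> {1, - 1}"
    "generators_agree (n - 2) (\<lambda>i. a (i + 2)) {w \<in> W. a 1 w = (- k) *s w}" by blast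
  have "k * k = 1" "5 \<le> n" using k(1) n by auto
  then show ?thesis using permuted_vectors_exist_twisted[OF A _ _ k(2) dis] k(1) by blast
next
  case False
  define E where "E c = {w \<in> W. a 1 w = c *s w}" for c
  \<comment> \<open>the largest odd degree available on the points \<open>3, \<dots>, n\<close>\<close>
  define r where "r = (if odd n then n - 2 else n - 3)"
  have r: "odd r" "3 \<le> r" "r \<le> n - 2" "n \<le> 2 * (r - 1)"
    using n unfolding r_def by presburger+
  have A': "sym_action (n - 2 + 2) a W" using A n by (subst le_add_diff_inverse2) auto
  have B: "sym_action (n - 2) (\<lambda>i. a (i + 2)) (E c)" for c
    unfolding E_def by (rule sym_action_eigenspace[OF A']) (use n in simp)
  have many: "\<exists>v. indep_family (r - 1) v \<and> (\<forall>i<r - 1. v i \<in> E (- k))" if "k \<in> {1, - 1}" for k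
  proof (rule odd_sym_action_many_independent[OF _ r(1,2)])
    show "sym_action r (\<lambda>i. a (i + 2)) (E (- k))"
      using sym_action_shift[OF B, of r 0] r(3) by simp
    show "\<not> generators_agree r (\<lambda>i. a (i + 2)) (E (- k))"
      using generators_agree_smaller[OF B r(2,3)] False that unfolding E_def by blast
  qed
  have le1: "1 \<le> n - 2" using n by simp
  obtain u where u: "indep_family (r - 1) u" "\<And>i. i < r - 1 \<Longrightarrow> u i \<in> E (- (- 1))"
    using many[of "- 1"] by blast
  obtain v where v: "indep_family (r - 1) v" "\<And>i. i < r - 1 \<Longrightarrow> v i \<in> E (- 1)"
    using many[of 1] by blast
  obtain x where x: "indep_family (r - 1 + (r - 1)) x" "\<forall>i<r - 1 + (r - 1). x i \<in> W"
    using indep_family_both_eigenspaces[OF A' _ u(1) u(2)[unfolded E_def] v(1) v(2)[unfolded E_def]]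
      le1 by blast
  have "r - 1 + (r - 1) \<le> card T" by (rule indep_family_bound[OF x(1) T(1)]) (use x(2) T(3) in blast)
  then show ?thesis using r(4) T(2) by simp
qed

end

section \<open>The braid generators in terms of permuted vectors\<close>

context char_0_space
begin

text \<open>In the basis \<open>q 1, \<dots>, q (n - 1)\<close> the operator \<open>f i\<close> is \<open>g\<close> times the identity matrix with its
  row \<open>i\<close>, respectively its column \<open>i\<close>, replaced by the entries \<open>l\<close>, \<open>m\<close>, \<open>u\<close> at the places
  \<open>i - 1\<close>, \<open>i\<close>, \<open>i + 1\<close>.\<close>

definition row_action :: "'a \<Rightarrow> 'a \<Rightarrow> 'a \<Rightarrow> 'a \<Rightarrow> nat \<Rightarrow> (nat \<Rightarrow> 'v \<Rightarrow> 'v) \<Rightarrow> (nat \<Rightarrow> 'v) \<Rightarrow> bool" where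
  "row_action g l m u n f q \<longleftrightarrow> (\<forall>i\<in>{1..<n}. \<forall>j\<in>{1..<n}. f i (q j) = g *s
     (q j + (if j = i then m - 1 else if Suc j = i then l else if j = Suc i then u else 0) *s q i))"

definition col_action :: "'a \<Rightarrow> 'a \<Rightarrow> 'a \<Rightarrow> 'a \<Rightarrow> nat \<Rightarrow> (nat \<Rightarrow> 'v \<Rightarrow> 'v) \<Rightarrow> (nat \<Rightarrow> 'v) \<Rightarrow> bool" where
  "col_action g l m u n f q \<longleftrightarrow> (\<forall>i\<in>{1..<n}. \<forall>j\<in>{1..<n}. f i (q j) = g *s
     (if j = i then l *s q (i - 1) + m *s q i + u *s q (Suc i) else q j))"

end

text \<open>A representation of the welded braid group on \<open>W\<close>, with \<open>a i\<close> and \<open>s i\<close> for the actions of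
  \<open>\<alpha>\<^sub>i\<close> and \<open>\<sigma>\<^sub>i\<close>.\<close>

locale welded_action = char_0_space scale
  for scale :: "'a::field_char_0 \<Rightarrow> 'v::ab_group_add \<Rightarrow> 'v" (infixr "*s" 75) +
  fixes n :: nat and a s :: "nat \<Rightarrow> 'v \<Rightarrow> 'v" and W :: "'v set"
  assumes n: "7 \<le> n"
    and A: "sym_action n a W"
    and s_hom: "\<And>i. 1 \<le> i \<Longrightarrow> i < n \<Longrightarrow> Modules.module_hom scale scale (s i)"
    and s_closed: "\<And>i w. 1 \<le> i \<Longrightarrow> i < n \<Longrightarrow> w \<in> W \<Longrightarrow> s i w \<in> W"
    and s_inj: "\<And>i w. 1 \<le> i \<Longrightarrow> i < n \<Longrightarrow> w \<in> W \<Longrightarrow> s i w = 0 \<Longrightarrow> w = 0"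
    and as_comm: "\<And>i j w. 1 \<le> i \<Longrightarrow> i < n \<Longrightarrow> 1 \<le> j \<Longrightarrow> j < n \<Longrightarrow> i + 2 \<le> j \<or> j + 2 \<le> i \<Longrightarrow>
      w \<in> W \<Longrightarrow> a i (s j w) = s j (a i w)"
    and ss_comm: "\<And>i j w. 1 \<le> i \<Longrightarrow> i + 2 \<le> j \<Longrightarrow> j < n \<Longrightarrow> w \<in> W \<Longrightarrow> s i (s j w) = s j (s i w)"
    and aas: "\<And>i w. 1 \<le> i \<Longrightarrow> Suc i < n \<Longrightarrow> w \<in> W \<Longrightarrow>
      a i (a (Suc i) (s i w)) = s (Suc i) (a i (a (Suc i) w))"
    and ssa: "\<And>i w. 1 \<le> i \<Longrightarrow> Suc i < n \<Longrightarrow> w \<in> W \<Longrightarrow>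
      s i (s (Suc i) (a i w)) = a (Suc i) (s i (s (Suc i) w))"

locale welded_module = welded_action scale n a s W
  for scale :: "'a::field_char_0 \<Rightarrow> 'v::ab_group_add \<Rightarrow> 'v" (infixr "*s" 75)
    and n :: nat and a s :: "nat \<Rightarrow> 'v \<Rightarrow> 'v" and W :: "'v set" +
  fixes y :: "nat \<Rightarrow> 'v"
  assumes y_W: "\<And>j. j \<in> {1..n} \<Longrightarrow> y j \<in> W"
    and y_permuted: "permuted n a y"
    and y_distinct: "y 1 \<noteq> y 2"
    and y_sum: "(\<Sum>j=1..n. y j) = 0"
    and y_span: "\<And>w. w \<in> W \<Longrightarrow> \<exists>c. w = (\<Sum>j=1..n. c j *s y j)"
begin

lemma y_adjacent_distinct: "1 \<le> i \<Longrightarrow> i < n \<Longrightarrow> y i \<noteq> y (Suc i)"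
  using permuted_adjacent_distinct[OF A y_W y_permuted y_distinct] .

lemma a_y:
  "1 \<le> i \<Longrightarrow> i < n \<Longrightarrow> a i (y i) = y (Suc i)"
  "1 \<le> i \<Longrightarrow> i < n \<Longrightarrow> a i (y (Suc i)) = y i"
  "1 \<le> i \<Longrightarrow> i < n \<Longrightarrow> 1 \<le> j \<Longrightarrow> j \<le> n \<Longrightarrow> j \<noteq> i \<Longrightarrow> j \<noteq> Suc i \<Longrightarrow> a i (y j) = y j"
  using y_permuted by (auto simp: permuted_def)

text \<open>A vector fixed by the symmetric group on the points after \<open>r\<close> has equal coefficients there,
  and the relation between the points makes these coefficients zero.\<close>

lemma fixed_combination:
  assumes w: "w \<in> W" and r: "r < n" and fixed: "\<And>i. r < i \<Longrightarrow> i < n \<Longrightarrow> a i w = w"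
  shows "\<exists>c. w = (\<Sum>j=1..r. c j *s y j)"
proof -
  obtain d where d: "w = (\<Sum>j=1..n. d j *s y j)" using y_span[OF w] by blast
  have eq: "d i = d (Suc i)" if i: "Suc r \<le> i" "i < n" for i
  proof -
    have "(d i - d (Suc i)) *s (y i - y (Suc i)) = 0"
      using permuted_combination_diff[OF A y_permuted, of i d] fixed[of i] i
      unfolding d[symmetric] by simp
    then show ?thesis using y_adjacent_distinct[of i] i by simp
  qed
  have const: "d j = d n" if "Suc r \<le> j" "j \<le> n" for j
    using constant_if_adjacent_eq[of "Suc r" n d j, OF eq] constant_if_adjacent_eq[of "Suc r" n d n, OF eq]
      that by simp
  have "w = (\<Sum>j=1..n. d j *s y j) - d n *s (\<Sum>j=1..n. y j)"
    unfolding y_sum d[symmetric] by simp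
  also have "\<dots> = (\<Sum>j=1..n. (d j - d n) *s y j)"
    by (simp add: scale_sum_right sum_subtractf scale_left_diff_distrib)
  also have "\<dots> = (\<Sum>j=1..r. (d j - d n) *s y j)"
  proof (rule sum.mono_neutral_right)
    show "\<forall>j\<in>{1..n} - {1..r}. (d j - d n) *s y j = 0"
    proof
      fix j assume "j \<in> {1..n} - {1..r}"
      then have "d j = d n" by (intro const) auto
      then show "(d j - d n) *s y j = 0" by simp
    qed
  qed (use r in auto)
  finally show ?thesis by (rule exI[of _ "\<lambda>j. d j - d n"])
qed

lemma y_relation_4:
  assumes "c1 *s y 1 + c2 *s y 2 + c3 *s y 3 + c4 *s y 4 = 0"
  shows "c1 = 0 \<and> c2 = 0 \<and> c3 = 0 \<and> c4 = 0"
proof -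
  define c where "c j = (if j = 1 then c1 else if j = 2 then c2 else if j = 3 then c3
    else if j = 4 then c4 else 0)" for j :: nat
  have "(\<Sum>j=1..n. c j *s y j) = (\<Sum>j\<in>{1, 2, 3, 4}. c j *s y j)"
    by (rule sum.mono_neutral_right) (use n in \<open>auto simp: c_def\<close>)
  also have "\<dots> = 0" using assms by (simp add: c_def add.assoc)
  finally have rel: "(\<Sum>j=1..n. c j *s y j) = 0" .
  have eq: "c j = c 1" if "1 \<le> j" "j \<le> n" for j
    by (rule permuted_relation_constant[OF A y_W y_permuted y_distinct rel that])
  have "c 1 = 0" using eq[of 5] n by (simp add: c_def)
  then show ?thesis using eq[of 2] eq[of 3] eq[of 4] n by (simp add: c_def)
qed

text \<open>The generator \<open>s 1\<close> commutes with the stabiliser of the points 1 and 2, so it maps \<open>y 1\<close> and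
  \<open>y 2\<close> to combinations of both, and its value at \<open>y 3\<close> determines the values at the later
  points.\<close>

lemma s_first:
  "\<exists>A B C D \<alpha> \<beta> \<gamma>. s 1 (y 1) = A *s y 1 + C *s y 2 \<and> s 1 (y 2) = B *s y 1 + D *s y 2 \<and>
    (\<forall>j. 3 \<le> j \<longrightarrow> j \<le> n \<longrightarrow> s 1 (y j) = \<alpha> *s y 1 + \<beta> *s y 2 + \<gamma> *s y j)"
proof -
  have c1: "a i (s 1 w) = s 1 (a i w)" if "3 \<le> i" "i < n" "w \<in> W" for i w
    by (rule as_comm) (use that n in auto)
  have s1W: "s 1 (y j) \<in> W" if "1 \<le> j" "j \<le> n" for j
    using s_closed[of 1] y_W that n by simp
  have two: "\<exists>c d. s 1 (y j) = c *s y 1 + d *s y 2" if "j = 1 \<or> j = 2" for j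
  proof -
    have "\<exists>c. s 1 (y j) = (\<Sum>j=1..2. c j *s y j)"
    proof (rule fixed_combination)
      fix i assume i: "2 < i" "i < n"
      show "a i (s 1 (y j)) = s 1 (y j)"
        using c1[of i "y j"] a_y(3)[of i j] y_W[of j] i that by auto
    qed (use s1W[of j] that n in auto)
    then show ?thesis by (auto simp: numeral_2_eq_2)
  qed
  obtain A C where AC: "s 1 (y 1) = A *s y 1 + C *s y 2" using two[of 1] by blast
  obtain B D where BD: "s 1 (y 2) = B *s y 1 + D *s y 2" using two[of 2] by blast
  have "\<exists>c. s 1 (y 3) = (\<Sum>j=1..3. c j *s y j)"
  proof (rule fixed_combination)
    fix i assume i: "3 < i" "i < n"
    show "a i (s 1 (y 3)) = s 1 (y 3)"
      using c1[of i "y 3"] a_y(3)[of i 3] y_W[of 3] i by auto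
  qed (use s1W[of 3] n in auto)
  then obtain c where "s 1 (y 3) = (\<Sum>j=1..3. c j *s y j)" ..
  then have c: "s 1 (y 3) = c 1 *s y 1 + c 2 *s y 2 + c 3 *s y 3"
    by (simp add: numeral_3_eq_3 numeral_2_eq_2)
  have "3 \<le> j \<Longrightarrow> j \<le> n \<Longrightarrow> s 1 (y j) = c 1 *s y 1 + c 2 *s y 2 + c 3 *s y j" for j
  proof (induction j rule: dec_induct)
    case (step j)
    interpret g: Modules.module_hom scale scale "a j" using sym_action_hom[OF A] step by simp
    have "s 1 (y (Suc j)) = a j (s 1 (y j))"
      using c1[of j "y j"] a_y(1)[of j] y_W[of j] step by simp
    also have "\<dots> = c 1 *s a j (y 1) + c 2 *s a j (y 2) + c 3 *s a j (y j)"
      using step by (simp add: g.add g.scale)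
    also have "a j (y 1) = y 1" by (rule a_y(3)) (use step in auto)
    also have "a j (y 2) = y 2" by (rule a_y(3)) (use step in auto)
    also have "a j (y j) = y (Suc j)" by (rule a_y(1)) (use step in auto)
    finally show ?case .
  qed (rule c)
  then show ?thesis using AC BD by blast
qed

text \<open>All \<open>s i\<close> are conjugate to \<open>s 1\<close> under the symmetric group, so the same seven scalars describe
  them.\<close>

lemma s_general:
  "\<exists>A B C D \<alpha> \<beta> \<gamma>. \<forall>i. 1 \<le> i \<longrightarrow> i < n \<longrightarrow> s i (y i) = A *s y i + C *s y (Suc i) \<and>
    s i (y (Suc i)) = B *s y i + D *s y (Suc i) \<and>
    (\<forall>j. 1 \<le> j \<longrightarrow> j \<le> n \<longrightarrow> j \<noteq> i \<longrightarrow> j \<noteq> Suc i \<longrightarrow>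
      s i (y j) = \<alpha> *s y i + \<beta> *s y (Suc i) + \<gamma> *s y j)"
proof -
  obtain A B C D \<alpha> \<beta> \<gamma> where s1: "s 1 (y 1) = A *s y 1 + C *s y 2" "s 1 (y 2) = B *s y 1 + D *s y 2"
    "\<And>j. 3 \<le> j \<Longrightarrow> j \<le> n \<Longrightarrow> s 1 (y j) = \<alpha> *s y 1 + \<beta> *s y 2 + \<gamma> *s y j"
    using s_first by blast
  define P where "P i \<longleftrightarrow> s i (y i) = A *s y i + C *s y (Suc i) \<and>
    s i (y (Suc i)) = B *s y i + D *s y (Suc i) \<and>
    (\<forall>j. 1 \<le> j \<longrightarrow> j \<le> n \<longrightarrow> j \<noteq> i \<longrightarrow> j \<noteq> Suc i \<longrightarrow>
      s i (y j) = \<alpha> *s y i + \<beta> *s y (Suc i) + \<gamma> *s y j)" for i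
  have "1 \<le> i \<Longrightarrow> i < n \<Longrightarrow> P i" for i
  proof (induction i rule: dec_induct)
    case base
    show ?case using s1 by (auto simp: P_def numeral_2_eq_2)
  next
    case (step i)
    have i: "1 \<le> i" "Suc i < n" and IH: "P i" using step by auto
    interpret f: Modules.module_hom scale scale "a i" using sym_action_hom[OF A] i by simp
    interpret g: Modules.module_hom scale scale "a (Suc i)" using sym_action_hom[OF A] i by simp
    note lin = f.add f.scale g.add g.scale
    have conj: "s (Suc i) (y j) = a i (a (Suc i) (s i (a (Suc i) (a i (y j)))))"
      if "1 \<le> j" "j \<le> n" for j
    proof -
      have W: "a i (y j) \<in> W" "a (Suc i) (a i (y j)) \<in> W" "y j \<in> W"
        using sym_action_closed[OF A] y_W that i by auto
      have "a (Suc i) (a (Suc i) (a i (y j))) = a i (y j)" "a i (a i (y j)) = y j"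
        using sym_action_invol[OF A] W i by auto
      then show ?thesis using aas[OF i W(2)] by simp
    qed
    have ay: "a i (y i) = y (Suc i)" "a i (y (Suc i)) = y i" "a i (y (Suc (Suc i))) = y (Suc (Suc i))"
      "a (Suc i) (y i) = y i" "a (Suc i) (y (Suc i)) = y (Suc (Suc i))"
      "a (Suc i) (y (Suc (Suc i))) = y (Suc i)"
      using i by (auto intro: a_y)
    have IH1: "s i (y i) = A *s y i + C *s y (Suc i)"
      "s i (y (Suc i)) = B *s y i + D *s y (Suc i)"
      "\<And>j. 1 \<le> j \<Longrightarrow> j \<le> n \<Longrightarrow> j \<noteq> i \<Longrightarrow> j \<noteq> Suc i \<Longrightarrow>
        s i (y j) = \<alpha> *s y i + \<beta> *s y (Suc i) + \<gamma> *s y j"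
      using IH unfolding P_def by blast+
    have IH2: "s i (y (Suc (Suc i))) = \<alpha> *s y i + \<beta> *s y (Suc i) + \<gamma> *s y (Suc (Suc i))"
      using IH1(3)[of "Suc (Suc i)"] i by simp
    show ?case
      unfolding P_def
    proof (intro conjI allI impI)
      show "s (Suc i) (y (Suc i)) = A *s y (Suc i) + C *s y (Suc (Suc i))"
        using conj[of "Suc i"] i by (simp add: ay IH1(1) lin)
      show "s (Suc i) (y (Suc (Suc i))) = B *s y (Suc i) + D *s y (Suc (Suc i))"
        using conj[of "Suc (Suc i)"] i by (simp add: ay IH1(2) lin)
      fix j assume j: "1 \<le> j" "j \<le> n" "j \<noteq> Suc i" "j \<noteq> Suc (Suc i)"
      show "s (Suc i) (y j) = \<alpha> *s y (Suc i) + \<beta> *s y (Suc (Suc i)) + \<gamma> *s y j"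
      proof (cases "j = i")
        case True
        then show ?thesis using conj[of i] i by (simp add: ay IH2 lin)
      next
        case False
        then have "a i (y j) = y j" "a (Suc i) (y j) = y j" using a_y(3) i j by auto
        then show ?thesis using conj[of j] i j False IH1(3)[of j] by (simp add: ay lin)
      qed
    qed
  qed
  then show ?thesis unfolding P_def by blast
qed

text \<open>The seven scalars are constrained by the relation between the points, by the commutation of
  \<open>s 1\<close> and \<open>s 3\<close>, and by the mixed relation of \<open>s 1\<close>, \<open>s 2\<close>, \<open>a 1\<close>, \<open>a 2\<close>.  In the first
  family that remains, \<open>s i - \<gamma>\<close> has the image spanned by \<open>y i - y (i + 1)\<close>; in the second,
  it kills \<open>y i + y (i + 1)\<close> and every \<open>y j\<close> with \<open>j \<noteq> i, i + 1\<close>.\<close>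

lemma s_two_families:
  obtains (reflection) \<gamma> z \<alpha> where "\<gamma> \<noteq> 0" "z \<noteq> 0"
    "\<And>i. 1 \<le> i \<Longrightarrow> i < n \<Longrightarrow> s i (y i) = (\<gamma> + \<alpha> - \<gamma> * z) *s y i + (\<gamma> * z - \<alpha>) *s y (Suc i)"
    "\<And>i. 1 \<le> i \<Longrightarrow> i < n \<Longrightarrow> s i (y (Suc i)) = (\<gamma> + \<alpha>) *s y i - \<alpha> *s y (Suc i)"
    "\<And>i j. 1 \<le> i \<Longrightarrow> i < n \<Longrightarrow> 1 \<le> j \<Longrightarrow> j \<le> n \<Longrightarrow> j \<noteq> i \<Longrightarrow> j \<noteq> Suc i \<Longrightarrow>
      s i (y j) = \<alpha> *s y i - \<alpha> *s y (Suc i) + \<gamma> *s y j"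
  | (coreflection) \<gamma> z where "\<gamma> \<noteq> 0" "z \<noteq> 0" "z \<noteq> 1"
    "\<And>i. 1 \<le> i \<Longrightarrow> i < n \<Longrightarrow> s i (y i) = (\<gamma> * z) *s y (Suc i)"
    "\<And>i. 1 \<le> i \<Longrightarrow> i < n \<Longrightarrow> s i (y (Suc i)) = \<gamma> *s y i + (\<gamma> - \<gamma> * z) *s y (Suc i)"
    "\<And>i j. 1 \<le> i \<Longrightarrow> i < n \<Longrightarrow> 1 \<le> j \<Longrightarrow> j \<le> n \<Longrightarrow> j \<noteq> i \<Longrightarrow> j \<noteq> Suc i \<Longrightarrow>
      s i (y j) = \<gamma> *s y j"
proof -
  obtain A B C D \<alpha> \<beta> \<gamma> where *:
    "\<And>i. 1 \<le> i \<Longrightarrow> i < n \<Longrightarrow> s i (y i) = A *s y i + C *s y (Suc i)"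
    "\<And>i. 1 \<le> i \<Longrightarrow> i < n \<Longrightarrow> s i (y (Suc i)) = B *s y i + D *s y (Suc i)"
    "\<And>i j. 1 \<le> i \<Longrightarrow> i < n \<Longrightarrow> 1 \<le> j \<Longrightarrow> j \<le> n \<Longrightarrow> j \<noteq> i \<Longrightarrow> j \<noteq> Suc i \<Longrightarrow>
      s i (y j) = \<alpha> *s y i + \<beta> *s y (Suc i) + \<gamma> *s y j"
    using s_general by blast
  define y1 y2 y3 y4 where y_def: "y1 = y 1" "y2 = y 2" "y3 = y 3" "y4 = y 4"
  define s1 s2 s3 a1 a2 where f_def: "s1 = s 1" "s2 = s 2" "s3 = s 3" "a1 = a 1" "a2 = a 2"
  interpret s1: Modules.module_hom scale scale s1 unfolding f_def using s_hom n by simp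
  interpret s2: Modules.module_hom scale scale s2 unfolding f_def using s_hom n by simp
  interpret s3: Modules.module_hom scale scale s3 unfolding f_def using s_hom n by simp
  interpret a2: Modules.module_hom scale scale a2 unfolding f_def using sym_action_hom[OF A] n by simp
  note lin = s1.add s1.scale s2.add s2.scale s3.add s3.scale a2.add a2.scale
  have [simp]: "y1 \<in> W" "y2 \<in> W" "y3 \<in> W" "y4 \<in> W" using y_W n by (auto simp: y_def)
  have S1: "s1 y1 = A *s y1 + C *s y2" "s1 y2 = B *s y1 + D *s y2"
    "s1 y3 = \<alpha> *s y1 + \<beta> *s y2 + \<gamma> *s y3" "s1 y4 = \<alpha> *s y1 + \<beta> *s y2 + \<gamma> *s y4"
    using *(1,2)[of 1] *(3)[of 1 3] *(3)[of 1 4] n by (simp_all add: f_def y_def numeral_2_eq_2)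
  have S2: "s2 y1 = \<alpha> *s y2 + \<beta> *s y3 + \<gamma> *s y1" "s2 y2 = A *s y2 + C *s y3"
    using *(1)[of 2] *(3)[of 2 1] n by (simp_all add: f_def y_def numeral_3_eq_3 numeral_2_eq_2)
  have S3: "s3 y1 = \<alpha> *s y3 + \<beta> *s y4 + \<gamma> *s y1" "s3 y2 = \<alpha> *s y3 + \<beta> *s y4 + \<gamma> *s y2"
    using *(3)[of 3 1] *(3)[of 3 2] n by (simp_all add: f_def y_def eval_nat_numeral)
  have a1: "a1 y1 = y2" using a_y(1)[of 1] n by (simp add: f_def y_def numeral_2_eq_2)
  have a2: "a2 y1 = y1" "a2 y2 = y3" "a2 y3 = y2"
    using a_y(3)[of 2 1] a_y(1,2)[of 2] n by (simp_all add: f_def y_def numeral_3_eq_3 numeral_2_eq_2)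
  have rel4: "c1 = 0 \<and> c2 = 0 \<and> c3 = 0 \<and> c4 = 0"
    if "c1 *s y1 + c2 *s y2 + c3 *s y3 + c4 *s y4 = 0" for c1 c2 c3 c4
    using y_relation_4 that unfolding y_def .
  note dist = scale_left_distrib scale_right_distrib scale_left_diff_distrib scale_right_diff_distrib
  \<comment> \<open>the sum of all \<open>y j\<close> is zero, hence so is the sum of all \<open>s 1 (y j)\<close>\<close>
  have tail: "(\<Sum>j=3..n. y j) = - (y1 + y2)"
  proof -
    have "(\<Sum>j=1..n. y j) = y1 + (y2 + (\<Sum>j=3..n. y j))"
      using n by (simp add: sum.atLeast_Suc_atMost y_def eval_nat_numeral)
    then show ?thesis using y_sum by (simp add: add.assoc[symmetric] add_eq_0_iff2)
  qed
  have "0 = s1 (\<Sum>j=1..n. y j)" using y_sum by (simp add: s1.zero)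
  also have "\<dots> = s1 y1 + (s1 y2 + (\<Sum>j=3..n. s1 (y j)))"
    using n by (simp add: sum.atLeast_Suc_atMost y_def eval_nat_numeral s1.add s1.sum)
  also have "(\<Sum>j=3..n. s1 (y j)) = (\<Sum>j=3..n. (\<alpha> *s y1 + \<beta> *s y2) + \<gamma> *s y j)"
    by (rule sum.cong) (use *(3)[of 1] n in \<open>auto simp: f_def y_def numeral_2_eq_2\<close>)
  also have "\<dots> = of_nat (n - 2) *s (\<alpha> *s y1 + \<beta> *s y2) + \<gamma> *s (\<Sum>j=3..n. y j)"
    by (simp add: sum.distrib sum_constant_scale scale_sum_right scale_right_distrib del: sum_constant)
  finally have "(A + B + of_nat (n - 2) * \<alpha> - \<gamma>) *s y1 + (C + D + of_nat (n - 2) * \<beta> - \<gamma>) *s y2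
      + 0 *s y3 + 0 *s y4 = 0"
    unfolding tail by (simp add: S1 dist algebra_simps)
  then have sum1: "A + B + of_nat (n - 2) * \<alpha> = \<gamma>" and sum2: "C + D + of_nat (n - 2) * \<beta> = \<gamma>"
    using rel4 by (metis eq_iff_diff_eq_0)+
  have comm: "s1 (s3 w) = s3 (s1 w)" if "w \<in> W" for w
    unfolding f_def by (rule ss_comm) (use that n in auto)
  have "s1 (s3 y1) - s3 (s1 y1) = 0" "s1 (s3 y2) - s3 (s1 y2) = 0" by (simp_all add: comm)
  then have "(\<alpha> * (\<alpha> + \<beta>)) *s y1 + (\<beta> * (\<alpha> + \<beta>)) *s y2
      + (\<alpha> * (\<gamma> - A - C)) *s y3 + (\<beta> * (\<gamma> - A - C)) *s y4 = 0"
    "(\<alpha> * (\<alpha> + \<beta>)) *s y1 + (\<beta> * (\<alpha> + \<beta>)) *s y2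
      + (\<alpha> * (\<gamma> - B - D)) *s y3 + (\<beta> * (\<gamma> - B - D)) *s y4 = 0"
    by (simp_all add: S1 S3 lin dist algebra_simps)
  note r1 = rel4[OF this(1)] and r2 = rel4[OF this(2)]
  have "\<alpha> = 0 \<or> \<gamma> - A - C = 0" "\<alpha> = 0 \<or> \<gamma> - B - D = 0" using r1 r2 by auto
  then have cases: "\<alpha> = 0 \<or> (A + C = \<gamma> \<and> B + D = \<gamma>)" by (auto simp: algebra_simps)
  have "(\<alpha> + \<beta>) * (\<alpha> + \<beta>) = 0" using r1 by (simp only: distrib_right add_0_left)
  then have "\<alpha> + \<beta> = 0" by simp
  then have \<beta>: "\<beta> = - \<alpha>" by (simp add: eq_neg_iff_add_eq_0 add.commute)
  have "s1 (s2 (a1 y1)) - a2 (s1 (s2 y1)) = 0"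
    using ssa[of 1 y1] n by (simp add: f_def numeral_2_eq_2)
  then have "(A * B + C * \<alpha> - \<alpha> * B - \<beta> * \<alpha> - \<gamma> * A) *s y1
      + (A * D + C * \<beta> - \<beta> * \<gamma>) *s y2
      + (C * \<gamma> - \<alpha> * D - \<beta> * \<beta> - \<gamma> * C) *s y3 + 0 *s y4 = 0"
    by (simp add: S1 S2 a1 a2 lin dist algebra_simps)
  note r3 = rel4[OF this]
  have "\<alpha> * D + \<beta> * \<beta> = - (C * \<gamma> - \<alpha> * D - \<beta> * \<beta> - \<gamma> * C)" by (simp add: mult.commute)
  then have mixed: "A * B + C * \<alpha> - \<alpha> * B - \<beta> * \<alpha> - \<gamma> * A = 0" "\<alpha> * D + \<beta> * \<beta> = 0"
    using r3 by simp_all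
  have s1_inj: "w = 0" if "w \<in> W" "s1 w = 0" for w
    by (rule s_inj[of 1]) (use n that in \<open>simp_all add: f_def\<close>)
  have "\<gamma> \<noteq> 0"
  proof
    assume "\<gamma> = 0"
    have "s1 (y3 - y4) = 0" by (simp add: S1 s1.diff \<open>\<gamma> = 0\<close>)
    moreover have "y3 - y4 \<in> W" by (intro subspace_diff[OF sym_action_subspace[OF A]]) simp_all
    ultimately have "y3 - y4 = 0" using s1_inj by blast
    then show False using y_adjacent_distinct[of 3] n by (simp add: y_def eval_nat_numeral)
  qed
  show thesis
  proof (cases "A + C = \<gamma> \<and> B + D = \<gamma>")
    case True
    have "B = \<gamma> + \<alpha>"
    proof (cases "\<alpha> = 0")
      case True
      then have "A * (B - \<gamma>) = 0" using mixed(1) by (simp add: algebra_simps)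
      then show ?thesis using sum1 True by auto
    next
      case False
      have "\<alpha> * (D + \<alpha>) = 0" using mixed(2) by (simp add: \<beta> algebra_simps)
      then have "D = - \<alpha>" using False by (simp add: eq_neg_iff_add_eq_0)
      then show ?thesis using True by (simp add: algebra_simps)
    qed
    then have D: "D = - \<alpha>" using True by (simp add: eq_neg_iff_add_eq_0 algebra_simps)
    define z where "z = (B - A) / \<gamma>"
    have z: "\<gamma> * z = \<gamma> + \<alpha> - A" using \<open>\<gamma> \<noteq> 0\<close> \<open>B = \<gamma> + \<alpha>\<close> by (simp add: z_def)
    have AC: "A = \<gamma> + \<alpha> - \<gamma> * z" "C = \<gamma> * z - \<alpha>" using z True by (auto simp: algebra_simps)
    have "z \<noteq> 0"
    proof
      assume "z = 0"
      then have "s1 (y1 - y2) = 0" using True \<open>B = \<gamma> + \<alpha>\<close> AC D by (simp add: s1.diff S1)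
      moreover have "y1 - y2 \<in> W" by (intro subspace_diff[OF sym_action_subspace[OF A]]) simp_all
      ultimately have "y1 - y2 = 0" using s1_inj by blast
      then show False using y_distinct by (simp add: y_def)
    qed
    with \<open>\<gamma> \<noteq> 0\<close> show ?thesis
    proof (rule reflection)
      fix i j assume i: "1 \<le> i" "i < n"
      show "s i (y i) = (\<gamma> + \<alpha> - \<gamma> * z) *s y i + (\<gamma> * z - \<alpha>) *s y (Suc i)"
        using *(1)[OF i] unfolding AC .
      show "s i (y (Suc i)) = (\<gamma> + \<alpha>) *s y i - \<alpha> *s y (Suc i)"
        using *(2)[OF i] by (simp add: D \<open>B = \<gamma> + \<alpha>\<close>)
      assume "1 \<le> j" "j \<le> n" "j \<noteq> i" "j \<noteq> Suc i"
      then show "s i (y j) = \<alpha> *s y i - \<alpha> *s y (Suc i) + \<gamma> *s y j"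
        using *(3)[OF i] by (simp add: \<beta>)
    qed
  next
    case False
    then have \<alpha>: "\<alpha> = 0" using cases by blast
    have AB: "B = \<gamma> - A" and D: "D = \<gamma> - C" using sum1 sum2 by (auto simp: \<alpha> \<beta> algebra_simps)
    have "A * A = 0" using mixed(1) by (simp add: \<alpha> AB algebra_simps)
    then have A0: "A = 0" by simp
    define z where "z = C / \<gamma>"
    have C: "C = \<gamma> * z" using \<open>\<gamma> \<noteq> 0\<close> by (simp add: z_def)
    have "z \<noteq> 1" using False by (auto simp: A0 AB D C)
    have "z \<noteq> 0"
    proof
      assume "z = 0"
      then have "y1 = 0" using s1_inj[of y1] by (simp add: S1 A0 C)
      moreover have "s1 (s1 y1) = 0" using \<open>y1 = 0\<close> by (simp add: s1.zero)
      ultimately have "a1 y1 = 0"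
        using sym_action_hom[OF A, of 1] n Modules.module_hom.zero[of scale scale a1] by (simp add: f_def)
      then show False using y_distinct a1 \<open>y1 = 0\<close> by (simp add: y_def)
    qed
    show ?thesis
    proof (rule coreflection[OF \<open>\<gamma> \<noteq> 0\<close> \<open>z \<noteq> 0\<close> \<open>z \<noteq> 1\<close>])
      fix i j assume i: "1 \<le> i" "i < n"
      show "s i (y i) = (\<gamma> * z) *s y (Suc i)" using *(1)[OF i] by (simp add: A0 C)
      show "s i (y (Suc i)) = \<gamma> *s y i + (\<gamma> - \<gamma> * z) *s y (Suc i)"
        using *(2)[OF i] by (simp add: A0 AB D C)
      assume "1 \<le> j" "j \<le> n" "j \<noteq> i" "j \<noteq> Suc i"
      then show "s i (y j) = \<gamma> *s y j" using *(3)[OF i] by (simp add: \<alpha> \<beta>)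
    qed
  qed
qed

text \<open>The differences of adjacent points, and the partial sums of the points: root vectors and
  fundamental weights of the reflection representation.\<close>

lemma difference_family_indep: "indep_family (n - 1) (\<lambda>i. y (Suc i) - y (Suc (Suc i)))"
  unfolding indep_family_def
proof (intro allI impI)
  fix c i assume sum: "(\<Sum>i<n - 1. c i *s (y (Suc i) - y (Suc (Suc i)))) = 0" and i: "i < n - 1"
  define d where "d j = (if j = n then - c (n - 2) else if j = 1 then c 0 else c (j - 1) - c (j - 2))" for j
  have tele: "(\<Sum>i<Suc k. c i *s (y (Suc i) - y (Suc (Suc i))))
      = (\<Sum>j=1..Suc k. d j *s y j) - c k *s y (Suc (Suc k))" if "k < n - 1" for k
    using that
  proof (induction k)
    case 0
    then show ?case using n by (simp add: d_def scale_right_diff_distrib)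
  next
    case (Suc k)
    have "Suc (Suc k) \<noteq> n" using Suc.prems by arith
    then have "d (Suc (Suc k)) = c (Suc k) - c k" by (simp add: d_def)
    then show ?case using Suc by (simp add: scale_right_diff_distrib scale_left_diff_distrib)
  qed
  obtain m where m: "n = Suc (Suc m)" by (rule that[of "n - 2"]) (use n in simp)
  have "(\<Sum>j=1..n. d j *s y j) = (\<Sum>j=1..Suc m. d j *s y j) - c m *s y n"
    by (simp add: m d_def)
  also have "\<dots> = 0" using tele[of m] sum by (simp add: m)
  finally have rel: "(\<Sum>j=1..n. d j *s y j) = 0" .
  have d: "d j = c 0" if "1 \<le> j" "j \<le> n" for j
    using permuted_relation_constant[OF A y_W y_permuted y_distinct rel that] n by (simp add: d_def)
  have c: "k < n - 1 \<Longrightarrow> c k = of_nat (Suc k) * c 0" for k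
  proof (induction k)
    case (Suc k)
    have "Suc (Suc k) \<noteq> n" "Suc (Suc k) \<le> n" using Suc.prems by arith+
    then have "c (Suc k) - c k = c 0" using d[of "Suc (Suc k)"] by (simp add: d_def)
    then show ?case using Suc by (simp add: algebra_simps)
  qed simp
  have "- c (n - 2) = c 0" using d[of n] n by (simp add: d_def)
  then have "of_nat n * c 0 = 0" using c[of "n - 2"] n by (simp add: algebra_simps of_nat_diff)
  then show "c i = 0" using c[OF i] n by simp
qed

lemma row_action_differences:
  assumes "\<And>i. 1 \<le> i \<Longrightarrow> i < n \<Longrightarrow> f i (y i) = (g + \<alpha> - g * z) *s y i + (g * z - \<alpha>) *s y (Suc i)"
    and "\<And>i. 1 \<le> i \<Longrightarrow> i < n \<Longrightarrow> f i (y (Suc i)) = (g + \<alpha>) *s y i - \<alpha> *s y (Suc i)"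
    and "\<And>i j. 1 \<le> i \<Longrightarrow> i < n \<Longrightarrow> 1 \<le> j \<Longrightarrow> j \<le> n \<Longrightarrow> j \<noteq> i \<Longrightarrow> j \<noteq> Suc i \<Longrightarrow>
      f i (y j) = \<alpha> *s y i - \<alpha> *s y (Suc i) + g *s y j"
    and hom: "\<And>i. 1 \<le> i \<Longrightarrow> i < n \<Longrightarrow> Modules.module_hom scale scale (f i)"
  shows "row_action g z (- z) 1 n f (\<lambda>i. y i - y (Suc i))"
  unfolding row_action_def
proof (intro ballI)
  fix i j assume i: "i \<in> {1..<n}" and j: "j \<in> {1..<n}"
  interpret f: Modules.module_hom scale scale "f i" using hom i by simp
  note dist = scale_left_distrib scale_right_distrib scale_left_diff_distrib scale_right_diff_distrib
  have i': "1 \<le> i" "i < n" using i by auto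
  note e = assms(1)[OF i'] assms(2)[OF i'] assms(3)[OF i']
  consider "j = i" | "Suc j = i" | "j = Suc i" | "j \<noteq> i" "Suc j \<noteq> i" "j \<noteq> Suc i" by blast
  then show "f i (y j - y (Suc j)) = g *s (y j - y (Suc j) + (if j = i then - z - 1
      else if Suc j = i then z else if j = Suc i then 1 else 0) *s (y i - y (Suc i)))"
  proof cases
    case 1
    show ?thesis unfolding 1 f.diff e(1,2) by (simp add: dist algebra_simps)
  next
    case 2
    then have "f i (y j) = \<alpha> *s y i - \<alpha> *s y (Suc i) + g *s y j" using j by (intro e(3)) auto
    with 2 show ?thesis by (simp add: f.diff e(1) dist, (simp add: algebra_simps)?)
  next
    case 3
    then have "f i (y (Suc j)) = \<alpha> *s y i - \<alpha> *s y (Suc i) + g *s y (Suc j)" using j by (intro e(3)) auto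
    with 3 show ?thesis by (simp add: f.diff e(2) dist, (simp add: algebra_simps)?)
  next
    case 4
    then have "f i (y j) = \<alpha> *s y i - \<alpha> *s y (Suc i) + g *s y j"
      "f i (y (Suc j)) = \<alpha> *s y i - \<alpha> *s y (Suc i) + g *s y (Suc j)" using j by (auto intro!: e(3))
    with 4 show ?thesis by (simp add: f.diff dist)
  qed
qed

definition partial_sum :: "nat \<Rightarrow> 'v" where
  "partial_sum i = (\<Sum>j=1..i. y j)"

lemma partial_sum_Suc: "partial_sum (Suc i) = partial_sum i + y (Suc i)"
  by (simp add: partial_sum_def)

lemma partial_sum_image:
  assumes hom: "Modules.module_hom scale scale f" and i: "1 \<le> i" "i < n"
    and f: "f (y i) = p *s y i + q *s y (Suc i)" "f (y (Suc i)) = (g - p) *s y i + (g - q) *s y (Suc i)"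
      "\<And>j. 1 \<le> j \<Longrightarrow> j \<le> n \<Longrightarrow> j \<noteq> i \<Longrightarrow> j \<noteq> Suc i \<Longrightarrow> f (y j) = g *s y j"
  shows "j \<le> n \<Longrightarrow> f (partial_sum j) = (if j = i then g *s partial_sum (i - 1) + p *s y i + q *s y (Suc i)
    else g *s partial_sum j)"
proof (induction j)
  case 0
  interpret f: Modules.module_hom scale scale f by (rule hom)
  show ?case using i by (simp add: partial_sum_def f.zero)
next
  case (Suc j)
  interpret f: Modules.module_hom scale scale f by (rule hom)
  note dist = scale_left_distrib scale_right_distrib scale_left_diff_distrib scale_right_diff_distrib
  have IH: "f (partial_sum j) = (if j = i then g *s partial_sum (i - 1) + p *s y i + q *s y (Suc i)
    else g *s partial_sum j)" using Suc by simp
  consider "Suc j = i" | "j = i" | "Suc j \<noteq> i" "j \<noteq> i" by blast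
  then show ?case
  proof cases
    case 1
    then show ?thesis using IH f(1) by (auto simp: partial_sum_Suc f.add)
  next
    case 2
    obtain k where k: "i = Suc k" using i by (cases i) auto
    have "f (partial_sum (Suc j)) = g *s partial_sum k + p *s y i + q *s y (Suc i)
        + ((g - p) *s y i + (g - q) *s y (Suc i))"
      using IH 2 f(2) k by (simp add: partial_sum_Suc[of "Suc k"] f.add)
    also have "\<dots> = g *s partial_sum (Suc j)"
      by (simp add: 2 k partial_sum_Suc dist)
    finally show ?thesis using 2 by simp
  next
    case 3
    then show ?thesis using IH f(3)[of "Suc j"] Suc.prems by (simp add: partial_sum_Suc f.add dist)
  qed
qed

lemma col_action_partial_sums:
  assumes z: "z \<noteq> 0" "x \<noteq> 0"
    and f: "\<And>i. 1 \<le> i \<Longrightarrow> i < n \<Longrightarrow> f i (y i) = (g * x) *s y (Suc i)"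
      "\<And>i. 1 \<le> i \<Longrightarrow> i < n \<Longrightarrow> f i (y (Suc i)) = g *s y i + (g - g * x) *s y (Suc i)"
      "\<And>i j. 1 \<le> i \<Longrightarrow> i < n \<Longrightarrow> 1 \<le> j \<Longrightarrow> j \<le> n \<Longrightarrow> j \<noteq> i \<Longrightarrow> j \<noteq> Suc i \<Longrightarrow> f i (y j) = g *s y j"
    and hom: "\<And>i. 1 \<le> i \<Longrightarrow> i < n \<Longrightarrow> Modules.module_hom scale scale (f i)"
  shows "col_action g z (- x) (x / z) n f (\<lambda>i. z ^ i *s partial_sum i)"
  unfolding col_action_def
proof (intro ballI)
  fix i j assume i: "i \<in> {1..<n}" and j: "j \<in> {1..<n}"
  interpret f: Modules.module_hom scale scale "f i" using hom i by simp
  have img: "f i (partial_sum j) = (if j = i then g *s partial_sum (i - 1) + 0 *s y i + (g * x) *s y (Suc i)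
    else g *s partial_sum j)"
    by (rule partial_sum_image[OF hom]) (use i j f in auto)
  show "f i (z ^ j *s partial_sum j) = g *s (if j = i
      then z *s z ^ (i - 1) *s partial_sum (i - 1) + - x *s z ^ i *s partial_sum i
        + (x / z) *s z ^ Suc i *s partial_sum (Suc i)
      else z ^ j *s partial_sum j)"
  proof (cases "j = i")
    case True
    obtain k where k: "i = Suc k" using i by (cases i) auto
    have "f i (z ^ j *s partial_sum j) = z ^ Suc k *s (g *s partial_sum k + (g * x) *s y (Suc (Suc k)))"
      unfolding f.scale using img True by (simp add: k)
    moreover have "(x / z) * z ^ Suc (Suc k) = x * z ^ Suc k" using z by simp
    ultimately show ?thesis
      using True
      by (simp add: k partial_sum_Suc scale_right_distrib scale_right_diff_distrib mult_ac)
  next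
    case False
    then show ?thesis using img by (simp add: f.scale mult_ac)
  qed
qed

text \<open>In a linear relation between vectors \<open>q j\<close> such that \<open>f i\<close> moves \<open>q i\<close> only, subtracting the
  image under \<open>f i\<close> isolates the coefficient of \<open>q i\<close>.\<close>

lemma separated_family_indep:
  assumes hom: "\<And>i. 1 \<le> i \<Longrightarrow> i < n \<Longrightarrow> Modules.module_hom scale scale (f i)"
    and moves: "\<And>i. 1 \<le> i \<Longrightarrow> i < n \<Longrightarrow> f i (q i) \<noteq> q i"
    and fixed: "\<And>i j. 1 \<le> i \<Longrightarrow> i < n \<Longrightarrow> 1 \<le> j \<Longrightarrow> j < n \<Longrightarrow> j \<noteq> i \<Longrightarrow> f i (q j) = q j"
  shows "indep_family (n - 1) (\<lambda>i. q (Suc i))"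
  unfolding indep_family_def
proof (intro allI impI)
  fix c i assume sum: "(\<Sum>i<n - 1. c i *s q (Suc i)) = 0" and i: "i < n - 1"
  interpret f: Modules.module_hom scale scale "f (Suc i)" using hom i by simp
  have "(\<Sum>j<n - 1. c j *s (f (Suc i) (q (Suc j)) - q (Suc j))) = 0"
    using arg_cong[OF sum, of "f (Suc i)"] sum
    by (simp add: f.sum f.scale f.zero scale_right_diff_distrib sum_subtractf)
  moreover have "(\<Sum>j<n - 1. c j *s (f (Suc i) (q (Suc j)) - q (Suc j)))
      = (\<Sum>j\<in>{i}. c j *s (f (Suc i) (q (Suc j)) - q (Suc j)))"
    by (rule sum.mono_neutral_right) (use i fixed in auto)
  ultimately show "c i = 0" using moves[of "Suc i"] i by simp
qed

theorem welded_classification: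
  "\<exists>g z q. g \<noteq> 0 \<and> z \<noteq> 0 \<and> (\<forall>i\<in>{1..<n}. q i \<in> W) \<and> indep_family (n - 1) (\<lambda>i. q (Suc i)) \<and>
    (row_action 1 1 (- 1) 1 n a q \<and> row_action g z (- z) 1 n s q \<or>
     z \<noteq> 1 \<and> q 0 = 0 \<and> q n = 0 \<and> col_action 1 z (- 1) (1 / z) n a q \<and> col_action g z (- z) 1 n s q)"
proof -
  have sub: "subspace W" by (rule sym_action_subspace[OF A])
  show ?thesis
  proof (rule s_two_families)
    fix g z \<alpha> assume gz: "g \<noteq> 0" "z \<noteq> 0"
      and s: "\<And>i. 1 \<le> i \<Longrightarrow> i < n \<Longrightarrow> s i (y i) = (g + \<alpha> - g * z) *s y i + (g * z - \<alpha>) *s y (Suc i)"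
        "\<And>i. 1 \<le> i \<Longrightarrow> i < n \<Longrightarrow> s i (y (Suc i)) = (g + \<alpha>) *s y i - \<alpha> *s y (Suc i)"
        "\<And>i j. 1 \<le> i \<Longrightarrow> i < n \<Longrightarrow> 1 \<le> j \<Longrightarrow> j \<le> n \<Longrightarrow> j \<noteq> i \<Longrightarrow> j \<noteq> Suc i \<Longrightarrow>
          s i (y j) = \<alpha> *s y i - \<alpha> *s y (Suc i) + g *s y j"
    have "row_action g z (- z) 1 n s (\<lambda>i. y i - y (Suc i))"
      by (rule row_action_differences[OF s s_hom])
    moreover have "row_action 1 1 (- 1) 1 n a (\<lambda>i. y i - y (Suc i))"
      by (rule row_action_differences[where \<alpha> = 0]) (use a_y sym_action_hom[OF A] in auto)
    moreover have "\<forall>i\<in>{1..<n}. y i - y (Suc i) \<in> W"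
      using subspace_diff[OF sub] y_W by auto
    ultimately show ?thesis
      using gz difference_family_indep
      by (intro exI[of _ g] exI[of _ z] exI[of _ "\<lambda>i. y i - y (Suc i)"]) blast
  next
    fix g z assume gz: "g \<noteq> 0" "z \<noteq> 0" "z \<noteq> 1"
      and s: "\<And>i. 1 \<le> i \<Longrightarrow> i < n \<Longrightarrow> s i (y i) = (g * z) *s y (Suc i)"
        "\<And>i. 1 \<le> i \<Longrightarrow> i < n \<Longrightarrow> s i (y (Suc i)) = g *s y i + (g - g * z) *s y (Suc i)"
        "\<And>i j. 1 \<le> i \<Longrightarrow> i < n \<Longrightarrow> 1 \<le> j \<Longrightarrow> j \<le> n \<Longrightarrow> j \<noteq> i \<Longrightarrow> j \<noteq> Suc i \<Longrightarrow> s i (y j) = g *s y j"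
    define q where "q i = z ^ i *s partial_sum i" for i
    have "col_action g z (- z) (z / z) n s q"
      unfolding q_def by (rule col_action_partial_sums[OF gz(2,2) s s_hom])
    moreover have ca: "col_action 1 z (- 1) (1 / z) n a q"
      unfolding q_def by (rule col_action_partial_sums) (use gz a_y sym_action_hom[OF A] in auto)
    moreover have "\<forall>i\<in>{1..<n}. q i \<in> W"
      unfolding q_def partial_sum_def using y_W
      by (auto intro!: subspace_scale[OF sub] subspace_sum[OF sub])
    moreover have "q 0 = 0" "q n = 0" using y_sum by (simp_all add: q_def partial_sum_def)
    moreover have "indep_family (n - 1) (\<lambda>i. q (Suc i))"
    proof (rule separated_family_indep[of a])
      fix i assume i: "1 \<le> i" "i < n"
      interpret f: Modules.module_hom scale scale "a i" using sym_action_hom[OF A] i by simp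
      have "a i (partial_sum i) = 1 *s partial_sum (i - 1) + 0 *s y i + 1 *s y (Suc i)"
        using partial_sum_image[of "a i" i 0 1 1 i] i a_y f.module_hom_axioms by simp
      moreover have "partial_sum i = partial_sum (i - 1) + y i"
        using partial_sum_Suc[of "i - 1"] i by simp
      ultimately have "a i (partial_sum i) \<noteq> partial_sum i"
        using y_adjacent_distinct[OF i] by simp
      then show "a i (q i) \<noteq> q i" using gz by (simp add: q_def f.scale)
    qed (use ca sym_action_hom[OF A] in \<open>auto simp: col_action_def\<close>)
    ultimately show ?thesis
      using gz by (intro exI[of _ g] exI[of _ z] exI[of _ q]) simp
  qed
qed

end

context char_0_space
begin

lemma permuted_sum_eq_0:
  assumes A: "sym_action m a W" and y: "\<And>i. i \<in> {1..m} \<Longrightarrow> y i \<in> W" "permuted m a y" "y 1 \<noteq> y 2"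
    and T: "finite T" "card T < m" "W \<subseteq> span T"
  shows "(\<Sum>j=1..m. y j) = 0"
proof -
  have "\<not> indep_family m (\<lambda>i. y (Suc i))"
  proof
    assume "indep_family m (\<lambda>i. y (Suc i))"
    moreover have "y (Suc i) \<in> span T" if "i < m" for i using y(1)[of "Suc i"] T(3) that by auto
    ultimately have "m \<le> card T" by (rule indep_family_bound[OF _ T(1)])
    then show False using T(2) by simp
  qed
  then obtain c i where c: "(\<Sum>i<m. c i *s y (Suc i)) = 0" "i < m" "c i \<noteq> 0"
    unfolding indep_family_def by blast
  have "(\<Sum>j=1..m. c (j - 1) *s y j) = (\<Sum>i<m. c i *s y (Suc i))"
    by (rule sum.reindex_bij_witness[of _ Suc "\<lambda>j. j - 1"]) auto
  then have rel: "(\<Sum>j=1..m. c (j - 1) *s y j) = 0" using c(1) by simp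
  have const: "c (j - 1) = c (1 - 1)" if "1 \<le> j" "j \<le> m" for j
    by (rule permuted_relation_constant[OF A y rel that])
  have "c 0 \<noteq> 0" using const[of "Suc i"] c(2,3) by simp
  have "c 0 *s (\<Sum>j=1..m. y j) = (\<Sum>j=1..m. c (j - 1) *s y j)"
    unfolding scale_sum_right
  proof (rule sum.cong)
    fix j assume "j \<in> {1..m}"
    then have "c (j - 1) = c 0" using const[of j] by simp
    then show "c 0 *s y j = c (j - 1) *s y j" by simp
  qed simp
  then show ?thesis using rel \<open>c 0 \<noteq> 0\<close> by simp
qed

lemma permuted_spans:
  assumes A: "sym_action m a W" and y: "\<And>i. i \<in> {1..m} \<Longrightarrow> y i \<in> W" "permuted m a y" "y 1 \<noteq> y 2"
    and T: "finite T" "card T < m" "W \<subseteq> span T" and w: "w \<in> W"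
  shows "\<exists>c. w = (\<Sum>j=1..m. c j *s y j)"
proof -
  have "\<exists>c. w = (\<Sum>i<m - 1. c i *s y (Suc i))"
  proof (rule maximal_family_spans[OF permuted_indep_family[OF A y] T(1)])
    show "y (Suc i) \<in> span T" if "i < m - 1" for i using y(1)[of "Suc i"] T(3) that by auto
  qed (use T w in auto)
  then obtain c where "w = (\<Sum>i<m - 1. c i *s y (Suc i))" ..
  also have "\<dots> = (\<Sum>j=1..<m. c (j - 1) *s y j)"
    by (rule sum.reindex_bij_witness[of _ "\<lambda>j. j - 1" Suc]) auto
  also have "\<dots> = (\<Sum>j=1..<m. (if j < m then c (j - 1) else 0) *s y j)"
    by (rule sum.cong) auto
  also have "\<dots> = (\<Sum>j=1..m. (if j < m then c (j - 1) else 0) *s y j)"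
    by (rule sum.mono_neutral_left) auto
  finally show ?thesis by (rule exI[of _ "\<lambda>j. if j < m then c (j - 1) else 0"])
qed

end

context welded_action
begin

text \<open>After the twist by the sign \<open>k\<close> the operators \<open>a i\<close> permute a family of vectors that spans
  \<open>W\<close>.\<close>

theorem small_welded_classification:
  assumes T: "finite T" "card T < n" "W \<subseteq> span T" and dis: "\<not> generators_agree n a W"
  shows "\<exists>k g z q. k \<in> {1, - 1} \<and> g \<noteq> 0 \<and> z \<noteq> 0 \<and> (\<forall>i\<in>{1..<n}. q i \<in> W) \<and>
    indep_family (n - 1) (\<lambda>i. q (Suc i)) \<and>
    (row_action k 1 (- 1) 1 n a q \<and> row_action g z (- z) 1 n s q \<or>
     z \<noteq> 1 \<and> q 0 = 0 \<and> q n = 0 \<and> col_action k z (- 1) (1 / z) n a q \<and> col_action g z (- z) 1 n s q)"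
proof -
  obtain k y where k: "k \<in> {1, - 1}"
    and y: "\<And>i. i \<in> {1..n} \<Longrightarrow> y i \<in> W" "permuted n (\<lambda>i w. k *s a i w) y" "y 1 \<noteq> y 2"
    using small_sym_action_permutes[OF A n T dis] by blast
  have kk: "k * k = 1" using k by auto
  have A': "sym_action n (\<lambda>i w. k *s a i w) W" by (rule sym_action_scale[OF A kk])
  have sk: "s i (c *s w) = c *s s i w" if "1 \<le> i" "i < n" for i w c
  proof -
    interpret f: Modules.module_hom scale scale "s i" by (rule s_hom[OF that])
    show ?thesis by (rule f.scale)
  qed
  have ak: "a i (c *s w) = c *s a i w" if "1 \<le> i" "i < n" for i w c
  proof -
    interpret f: Modules.module_hom scale scale "a i" by (rule sym_action_hom[OF A that])
    show ?thesis by (rule f.scale)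
  qed
  have c1: "k *s a i (s j w) = s j (k *s a i w)"
    if "1 \<le> i" "i < n" "1 \<le> j" "j < n" "i + 2 \<le> j \<or> j + 2 \<le> i" "w \<in> W" for i j w
    using as_comm[OF that] sk[OF that(3,4)] by simp
  have c2: "k *s a i (k *s a (Suc i) (s i w)) = s (Suc i) (k *s a i (k *s a (Suc i) w))"
    if "1 \<le> i" "Suc i < n" "w \<in> W" for i w
    using aas[OF that] that sk[of "Suc i"] ak[of i] by simp
  have c3: "s i (s (Suc i) (k *s a i w)) = k *s a (Suc i) (s i (s (Suc i) w))"
    if "1 \<le> i" "Suc i < n" "w \<in> W" for i w
    using ssa[OF that] that sk[of "Suc i"] sk[of i] by simp
  have c4: "(\<Sum>j=1..n. y j) = 0" by (rule permuted_sum_eq_0[OF A' y T])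
  have c5: "\<exists>c. w = (\<Sum>j=1..n. c j *s y j)" if "w \<in> W" for w by (rule permuted_spans[OF A' y T that])
  have "welded_action scale n (\<lambda>i w. k *s a i w) s W"
    by (rule welded_action.intro[OF char_0_space_axioms],
        rule welded_action_axioms.intro[OF n A' s_hom s_closed s_inj c1 ss_comm c2 c3])
  then interpret twist: welded_module scale n "\<lambda>i w. k *s a i w" s W y
    by (rule welded_module.intro, intro welded_module_axioms.intro[OF y c4 c5])
  have un: "k *s u = 1 *s v \<Longrightarrow> u = k *s v" for u v
  proof -
    assume "k *s u = 1 *s v"
    then have "k *s (k *s u) = k *s v" by simp
    then show ?thesis using kk by simp
  qed
  have "row_action k 1 (- 1) 1 n a q" if "row_action 1 1 (- 1) 1 n (\<lambda>i w. k *s a i w) q" for q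
    using that un unfolding row_action_def by blast
  moreover have "col_action k z (- 1) (1 / z) n a q"
    if "col_action 1 z (- 1) (1 / z) n (\<lambda>i w. k *s a i w) q" for z q
    using that un unfolding col_action_def by blast
  ultimately show ?thesis using twist.welded_classification k by blast
qed

end

section \<open>Homomorphisms from presented groups\<close>

lemma presented_group_class:
  "u \<in> words S \<Longrightarrow> pres_rel S R `` {u} \<in> carrier (presented_group S R)"
  by (auto simp: presented_group_def quotient_def)

lemma presented_group_carrier_cases:
  assumes "g \<in> carrier (presented_group S R)"
  obtains u where "u \<in> words S" "g = pres_rel S R `` {u}"
  using assms by (auto simp: presented_group_def quotient_def)

lemma presented_group_class_eq: "pres_eq S R u v \<Longrightarrow> pres_rel S R `` {u} = pres_rel S R `` {v}"
  by (rule equiv_class_eq[OF equiv_pres_rel]) (simp add: pres_rel_def)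

lemma pres_gen_closed: "x \<in> S \<Longrightarrow> pres_gen S R x \<in> carrier (presented_group S R)"
  unfolding pres_gen_def by (rule presented_group_class) simp

lemma class_inverse_letter:
  assumes x: "x \<in> S"
  shows "pres_rel S R `` {[(x, False)]} = inv\<^bsub>presented_group S R\<^esub> pres_gen S R x"
proof -
  interpret group "presented_group S R" by (rule group_presented_group)
  have "pres_rel S R `` {[(x, False)]} \<otimes>\<^bsub>presented_group S R\<^esub> pres_gen S R x
      = pres_rel S R `` {[(x, False), (x, True)]}"
    unfolding pres_gen_def using x by (subst presented_group_mult) auto
  also have "\<dots> = pres_rel S R `` {[]}"
    using pres_eq.cancel[of "[]" S "[]" x R False] x by (intro presented_group_class_eq) simp
  also have "\<dots> = \<one>\<^bsub>presented_group S R\<^esub>" by (simp add: presented_group_def)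
  finally show ?thesis
    using inv_equality pres_gen_closed[OF x] presented_group_class[of "[(x, False)]" S R] x by simp
qed

text \<open>A word is a product of generators and of their inverses, which gives this induction
  principle.\<close>

lemma presented_group_induct [consumes 1, case_names one gen inv mult]:
  assumes g: "g \<in> carrier (presented_group S R)"
    and one: "Q \<one>\<^bsub>presented_group S R\<^esub>"
    and gen: "\<And>x. x \<in> S \<Longrightarrow> Q (pres_gen S R x)"
    and inv: "\<And>x. x \<in> S \<Longrightarrow> Q (inv\<^bsub>presented_group S R\<^esub> pres_gen S R x)"
    and mult: "\<And>g h. g \<in> carrier (presented_group S R) \<Longrightarrow> h \<in> carrier (presented_group S R) \<Longrightarrow>
      Q g \<Longrightarrow> Q h \<Longrightarrow> Q (g \<otimes>\<^bsub>presented_group S R\<^esub> h)"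
  shows "Q g"
proof -
  have "u \<in> words S \<Longrightarrow> Q (pres_rel S R `` {u})" for u
  proof (induction u)
    case Nil
    then show ?case using one by (simp add: presented_group_def)
  next
    case (Cons a u)
    obtain x b where a: "a = (x, b)" by fastforce
    have x: "x \<in> S" and u: "u \<in> words S" using Cons.prems by (auto simp: a)
    have l: "[(x, b)] \<in> words S" using x by simp
    have "Q (pres_rel S R `` {[(x, b)]})"
      using gen[OF x] inv[OF x] by (cases b) (simp_all add: pres_gen_def class_inverse_letter[OF x])
    then have "Q (pres_rel S R `` {[(x, b)]} \<otimes>\<^bsub>presented_group S R\<^esub> pres_rel S R `` {u})"
      using Cons.IH[OF u] by (intro mult presented_group_class l u)
    then show ?case unfolding presented_group_mult[OF l u] by (simp add: a)
  qed
  then show ?thesis using g by (elim presented_group_carrier_cases) simp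
qed

lemma hom_eval_word:
  assumes H: "group H" and \<phi>: "\<phi> \<in> hom (presented_group S R) H" and u: "u \<in> words S"
  shows "\<phi> (pres_rel S R `` {u}) = eval_word H (\<lambda>x. \<phi> (pres_gen S R x)) u"
  using u
proof (induction u rule: list.induct)
  case Nil
  have "\<phi> \<one>\<^bsub>presented_group S R\<^esub> = \<one>\<^bsub>H\<^esub>" by (rule hom_one[OF \<phi> group_presented_group H])
  then show ?case by (simp add: presented_group_def)
next
  case (Cons a u)
  obtain x b where a: "a = (x, b)" by fastforce
  have x: "x \<in> S" and u: "u \<in> words S" using Cons.prems by (auto simp: a)
  have l: "[(x, b)] \<in> words S" using x by simp
  have inv: "\<phi> (inv\<^bsub>presented_group S R\<^esub> pres_gen S R x) = inv\<^bsub>H\<^esub> \<phi> (pres_gen S R x)"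
    using group_hom.hom_inv[of "presented_group S R" H \<phi>] H \<phi> group_presented_group pres_gen_closed[OF x]
    by (metis group_hom.intro group_hom_axioms.intro)
  have "pres_rel S R `` {a # u} = pres_rel S R `` {[(x, b)]} \<otimes>\<^bsub>presented_group S R\<^esub> pres_rel S R `` {u}"
    unfolding presented_group_mult[OF l u] by (simp add: a)
  then have "\<phi> (pres_rel S R `` {a # u}) = \<phi> (pres_rel S R `` {[(x, b)]}) \<otimes>\<^bsub>H\<^esub> \<phi> (pres_rel S R `` {u})"
    using hom_mult[OF \<phi> presented_group_class[OF l] presented_group_class[OF u]] by simp
  also have "\<phi> (pres_rel S R `` {[(x, b)]})
      = (if b then \<phi> (pres_gen S R x) else inv\<^bsub>H\<^esub> \<phi> (pres_gen S R x))"
    by (cases b) (simp_all add: pres_gen_def[symmetric] class_inverse_letter[OF x] inv)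
  finally show ?case using Cons.IH[OF u] by (simp add: a)
qed

lemma hom_respects_relations:
  assumes "group H" "\<phi> \<in> hom (presented_group S R) H" "(r, s) \<in> R" "r \<in> words S" "s \<in> words S"
  shows "eval_word H (\<lambda>x. \<phi> (pres_gen S R x)) r = eval_word H (\<lambda>x. \<phi> (pres_gen S R x)) s"
proof -
  have "pres_eq S R r s" using pres_eq.rel[of "[]" S "[]" r s R] assms by simp
  then have "pres_rel S R `` {r} = pres_rel S R `` {s}" by (rule presented_group_class_eq)
  then show ?thesis using hom_eval_word[OF assms(1,2)] assms(4,5) by metis
qed

lemma intertwiner_from_generators:
  assumes H: "group H" and \<phi>: "\<phi> \<in> hom (presented_group S R) H" and \<psi>: "\<psi> \<in> hom (presented_group S R) H"
    and p: "p \<in> carrier H"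
    and gen: "\<And>x. x \<in> S \<Longrightarrow> p \<otimes>\<^bsub>H\<^esub> \<phi> (pres_gen S R x) = \<psi> (pres_gen S R x) \<otimes>\<^bsub>H\<^esub> p"
    and g: "g \<in> carrier (presented_group S R)"
  shows "p \<otimes>\<^bsub>H\<^esub> \<phi> g = \<psi> g \<otimes>\<^bsub>H\<^esub> p"
proof -
  interpret H: group H by (rule H)
  interpret G: group "presented_group S R" by (rule group_presented_group)
  interpret \<phi>: group_hom "presented_group S R" H \<phi> by unfold_locales (rule \<phi>)
  interpret \<psi>: group_hom "presented_group S R" H \<psi> by unfold_locales (rule \<psi>)
  show ?thesis
    using g
  proof (induction rule: presented_group_induct)
    case one
    then show ?case using p by simp
  next
    case (gen x)
    then show ?case by (rule assms(5))
  next
    case (inv x)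
    let ?x = "pres_gen S R x"
    have x: "\<phi> ?x \<in> carrier H" "\<psi> ?x \<in> carrier H" "?x \<in> carrier (presented_group S R)"
      using pres_gen_closed[OF inv, of R] by auto
    have "inv\<^bsub>H\<^esub> \<psi> ?x \<otimes>\<^bsub>H\<^esub> p = inv\<^bsub>H\<^esub> \<psi> ?x \<otimes>\<^bsub>H\<^esub> (p \<otimes>\<^bsub>H\<^esub> \<phi> ?x) \<otimes>\<^bsub>H\<^esub> inv\<^bsub>H\<^esub> \<phi> ?x"
      using x p by (simp add: H.m_assoc)
    also have "\<dots> = inv\<^bsub>H\<^esub> \<psi> ?x \<otimes>\<^bsub>H\<^esub> (\<psi> ?x \<otimes>\<^bsub>H\<^esub> p) \<otimes>\<^bsub>H\<^esub> inv\<^bsub>H\<^esub> \<phi> ?x" by (simp add: assms(5)[OF inv])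
    also have "\<dots> = p \<otimes>\<^bsub>H\<^esub> inv\<^bsub>H\<^esub> \<phi> ?x"
      using x p by (simp add: H.m_assoc[symmetric])
    finally show ?case using x by simp
  next
    case (mult g h)
    have c: "\<phi> g \<in> carrier H" "\<phi> h \<in> carrier H" "\<psi> g \<in> carrier H" "\<psi> h \<in> carrier H"
      using mult(1,2) by auto
    have "p \<otimes>\<^bsub>H\<^esub> (\<phi> g \<otimes>\<^bsub>H\<^esub> \<phi> h) = p \<otimes>\<^bsub>H\<^esub> \<phi> g \<otimes>\<^bsub>H\<^esub> \<phi> h" using c p by (simp add: H.m_assoc)
    also have "\<dots> = \<psi> g \<otimes>\<^bsub>H\<^esub> (p \<otimes>\<^bsub>H\<^esub> \<phi> h)" using c p mult(3) by (simp add: H.m_assoc)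
    also have "\<dots> = \<psi> g \<otimes>\<^bsub>H\<^esub> \<psi> h \<otimes>\<^bsub>H\<^esub> p" using c p mult(4) by (simp add: H.m_assoc)
    finally show ?case using mult(1,2) by simp
  qed
qed

section \<open>Representations of the welded braid group on generators\<close>

abbreviation wb_gen_class :: "nat \<Rightarrow> wb_gen \<Rightarrow> wb_gen gword set" where
  "wb_gen_class n \<equiv> pres_gen (wb_gens n) (wb_rels n)"

text \<open>The triple products are bracketed as the evaluation of words produces them.\<close>

definition wb_relations :: "('b, 'c) monoid_scheme \<Rightarrow> nat \<Rightarrow> (wb_gen \<Rightarrow> 'b) \<Rightarrow> bool" where
  "wb_relations H n f \<longleftrightarrow>
    (\<forall>i. 1 \<le> i \<longrightarrow> i < n \<longrightarrow> f (Alpha i) \<otimes>\<^bsub>H\<^esub> f (Alpha i) = \<one>\<^bsub>H\<^esub>) \<and>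
    (\<forall>i j. 1 \<le> i \<longrightarrow> i < n \<longrightarrow> 1 \<le> j \<longrightarrow> j < n \<longrightarrow> i + 2 \<le> j \<or> j + 2 \<le> i \<longrightarrow>
      f (Alpha i) \<otimes>\<^bsub>H\<^esub> f (Alpha j) = f (Alpha j) \<otimes>\<^bsub>H\<^esub> f (Alpha i) \<and>
      f (Sigma i) \<otimes>\<^bsub>H\<^esub> f (Sigma j) = f (Sigma j) \<otimes>\<^bsub>H\<^esub> f (Sigma i) \<and>
      f (Alpha i) \<otimes>\<^bsub>H\<^esub> f (Sigma j) = f (Sigma j) \<otimes>\<^bsub>H\<^esub> f (Alpha i)) \<and>
    (\<forall>i. 1 \<le> i \<longrightarrow> Suc i < n \<longrightarrow>
      f (Alpha i) \<otimes>\<^bsub>H\<^esub> (f (Alpha (Suc i)) \<otimes>\<^bsub>H\<^esub> f (Alpha i))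
        = f (Alpha (Suc i)) \<otimes>\<^bsub>H\<^esub> (f (Alpha i) \<otimes>\<^bsub>H\<^esub> f (Alpha (Suc i))) \<and>
      f (Sigma i) \<otimes>\<^bsub>H\<^esub> (f (Sigma (Suc i)) \<otimes>\<^bsub>H\<^esub> f (Sigma i))
        = f (Sigma (Suc i)) \<otimes>\<^bsub>H\<^esub> (f (Sigma i) \<otimes>\<^bsub>H\<^esub> f (Sigma (Suc i))) \<and>
      f (Alpha i) \<otimes>\<^bsub>H\<^esub> (f (Alpha (Suc i)) \<otimes>\<^bsub>H\<^esub> f (Sigma i))
        = f (Sigma (Suc i)) \<otimes>\<^bsub>H\<^esub> (f (Alpha i) \<otimes>\<^bsub>H\<^esub> f (Alpha (Suc i))) \<and>
      f (Sigma i) \<otimes>\<^bsub>H\<^esub> (f (Sigma (Suc i)) \<otimes>\<^bsub>H\<^esub> f (Alpha i))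
        = f (Alpha (Suc i)) \<otimes>\<^bsub>H\<^esub> (f (Sigma i) \<otimes>\<^bsub>H\<^esub> f (Sigma (Suc i))))"

lemma wb_gens_iff [simp]:
  "Alpha i \<in> wb_gens n \<longleftrightarrow> 1 \<le> i \<and> i < n" "Sigma i \<in> wb_gens n \<longleftrightarrow> 1 \<le> i \<and> i < n"
  by (auto simp: wb_gens_def)

lemma wb_gens_cases:
  assumes "x \<in> wb_gens n"
  obtains i where "1 \<le> i" "i < n" "x = Alpha i" | i where "1 \<le> i" "i < n" "x = Sigma i"
proof -
  have "{1..n - 1} = {i. 1 \<le> i \<and> i < n}" by auto
  then show ?thesis using assms that unfolding wb_gens_def by blast
qed

lemma wb_relsI:
  "1 \<le> i \<Longrightarrow> i < n \<Longrightarrow> (alpha i @ alpha i, []) \<in> wb_rels n"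
  "1 \<le> i \<Longrightarrow> i < n \<Longrightarrow> 1 \<le> j \<Longrightarrow> j < n \<Longrightarrow> i + 2 \<le> j \<or> j + 2 \<le> i \<Longrightarrow>
    (alpha i @ alpha j, alpha j @ alpha i) \<in> wb_rels n"
  "1 \<le> i \<Longrightarrow> i < n \<Longrightarrow> 1 \<le> j \<Longrightarrow> j < n \<Longrightarrow> i + 2 \<le> j \<or> j + 2 \<le> i \<Longrightarrow>
    (sigma i @ sigma j, sigma j @ sigma i) \<in> wb_rels n"
  "1 \<le> i \<Longrightarrow> i < n \<Longrightarrow> 1 \<le> j \<Longrightarrow> j < n \<Longrightarrow> i + 2 \<le> j \<or> j + 2 \<le> i \<Longrightarrow>
    (alpha i @ sigma j, sigma j @ alpha i) \<in> wb_rels n"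
  "1 \<le> i \<Longrightarrow> Suc i < n \<Longrightarrow>
    (alpha i @ alpha (Suc i) @ alpha i, alpha (Suc i) @ alpha i @ alpha (Suc i)) \<in> wb_rels n"
  "1 \<le> i \<Longrightarrow> Suc i < n \<Longrightarrow>
    (sigma i @ sigma (Suc i) @ sigma i, sigma (Suc i) @ sigma i @ sigma (Suc i)) \<in> wb_rels n"
  "1 \<le> i \<Longrightarrow> Suc i < n \<Longrightarrow>
    (alpha i @ alpha (Suc i) @ sigma i, sigma (Suc i) @ alpha i @ alpha (Suc i)) \<in> wb_rels n"
  "1 \<le> i \<Longrightarrow> Suc i < n \<Longrightarrow>
    (sigma i @ sigma (Suc i) @ alpha i, alpha (Suc i) @ sigma i @ sigma (Suc i)) \<in> wb_rels n"
proof -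
  have far: "\<bar>int i - int j\<bar> \<ge> 2" if "i + 2 \<le> j \<or> j + 2 \<le> i" for i j using that by arith
  show "1 \<le> i \<Longrightarrow> i < n \<Longrightarrow> (alpha i @ alpha i, []) \<in> wb_rels n"
    by (auto simp: wb_rels_def)
  assume ij: "1 \<le> i" "i < n" "1 \<le> j" "j < n" "i + 2 \<le> j \<or> j + 2 \<le> i"
  then have "i \<in> {1..n - 1} \<and> j \<in> {1..n - 1} \<and> \<bar>int i - int j\<bar> \<ge> 2" using far by auto
  then show "(alpha i @ alpha j, alpha j @ alpha i) \<in> wb_rels n"
    "(sigma i @ sigma j, sigma j @ sigma i) \<in> wb_rels n"
    "(alpha i @ sigma j, sigma j @ alpha i) \<in> wb_rels n"
    unfolding wb_rels_def by blast+
next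
  assume "1 \<le> i" "Suc i < n"
  then have "i \<in> {1..n - 2}" by auto
  then show
    "(alpha i @ alpha (Suc i) @ alpha i, alpha (Suc i) @ alpha i @ alpha (Suc i)) \<in> wb_rels n"
    "(sigma i @ sigma (Suc i) @ sigma i, sigma (Suc i) @ sigma i @ sigma (Suc i)) \<in> wb_rels n"
    "(alpha i @ alpha (Suc i) @ sigma i, sigma (Suc i) @ alpha i @ alpha (Suc i)) \<in> wb_rels n"
    "(sigma i @ sigma (Suc i) @ alpha i, alpha (Suc i) @ sigma i @ sigma (Suc i)) \<in> wb_rels n"
    unfolding wb_rels_def Suc_eq_plus1 by blast+
qed

lemma wb_relations_of_hom:
  assumes H: "group H" and \<phi>: "\<phi> \<in> hom (WB n) H"
  shows "wb_relations H n (\<lambda>x. \<phi> (wb_gen_class n x))"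
proof -
  interpret H: group H by (rule H)
  note \<phi>' = \<phi>[unfolded WB_def]
  have c: "\<phi> (wb_gen_class n x) \<in> carrier H" if "x \<in> wb_gens n" for x
    using hom_in_carrier[OF \<phi>' pres_gen_closed[OF that]] .
  note R = hom_respects_relations[OF H \<phi>']
  show ?thesis
    unfolding wb_relations_def
  proof (intro conjI allI impI, goal_cases)
    case (1 i)
    then show ?case using R[OF wb_relsI(1)] by (simp add: c)
  next
    case (2 i j)
    then show ?case using R[OF wb_relsI(2)] by (simp add: c)
  next
    case (3 i j)
    then show ?case using R[OF wb_relsI(3)] by (simp add: c)
  next
    case (4 i j)
    then show ?case using R[OF wb_relsI(4)] by (simp add: c)
  next
    case (5 i)
    then show ?case using R[OF wb_relsI(5)] by (simp add: c)
  next
    case (6 i)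
    then show ?case using R[OF wb_relsI(6)] by (simp add: c)
  next
    case (7 i)
    then show ?case using R[OF wb_relsI(7)] by (simp add: c)
  next
    case (8 i)
    then show ?case using R[OF wb_relsI(8)] by (simp add: c)
  qed
qed

lemma wb_pres_lift:
  assumes H: "group H" and f: "\<And>x. x \<in> wb_gens n \<Longrightarrow> f x \<in> carrier H" and R: "wb_relations H n f"
  shows "pres_lift H f \<in> hom (WB n) H" "x \<in> wb_gens n \<Longrightarrow> pres_lift H f (wb_gen_class n x) = f x"
proof -
  interpret H: group H by (rule H)
  note a = R[unfolded wb_relations_def, THEN conjunct1, rule_format]
  note b = R[unfolded wb_relations_def, THEN conjunct2, THEN conjunct1, rule_format]
  note c = R[unfolded wb_relations_def, THEN conjunct2, THEN conjunct2, rule_format]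
  have rels: "eval_word H f r = eval_word H f s"
    if rs: "(r, s) \<in> wb_rels n" "r \<in> words (wb_gens n)" "s \<in> words (wb_gens n)" for r s
  proof -
    consider i where "1 \<le> i" "i < n" "r = alpha i @ alpha i" "s = []"
      | i j where "1 \<le> i" "i < n" "1 \<le> j" "j < n" "i + 2 \<le> j \<or> j + 2 \<le> i"
          "(r, s) \<in> {(alpha i @ alpha j, alpha j @ alpha i), (sigma i @ sigma j, sigma j @ sigma i),
            (alpha i @ sigma j, sigma j @ alpha i)}"
      | i where "1 \<le> i" "Suc i < n"
          "(r, s) \<in> {(alpha i @ alpha (Suc i) @ alpha i, alpha (Suc i) @ alpha i @ alpha (Suc i)),
            (sigma i @ sigma (Suc i) @ sigma i, sigma (Suc i) @ sigma i @ sigma (Suc i)),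
            (alpha i @ alpha (Suc i) @ sigma i, sigma (Suc i) @ alpha i @ alpha (Suc i)),
            (sigma i @ sigma (Suc i) @ alpha i, alpha (Suc i) @ sigma i @ sigma (Suc i))}"
      using rs(1) unfolding wb_rels_def
    proof (elim UnE)
      assume "(r, s) \<in> {(alpha i @ alpha i, []) | i. i \<in> {1..n - 1}}"
      then obtain i where "i \<in> {1..n - 1}" and rs: "r = alpha i @ alpha i" "s = []" by blast
      then have "1 \<le> i" "i < n" by auto
      then show ?thesis using that(1) rs by blast
    next
      assume "(r, s) \<in> (\<Union>(i, j) \<in> {(i, j). i \<in> {1..n - 1} \<and> j \<in> {1..n - 1} \<and> \<bar>int i - int j\<bar> \<ge> 2}.
       {(alpha i @ alpha j, alpha j @ alpha i), (sigma i @ sigma j, sigma j @ sigma i),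
        (alpha i @ sigma j, sigma j @ alpha i)})"
      then obtain i j where ij: "i \<in> {1..n - 1}" "j \<in> {1..n - 1}" "\<bar>int i - int j\<bar> \<ge> 2"
        and rs: "(r, s) \<in> {(alpha i @ alpha j, alpha j @ alpha i), (sigma i @ sigma j, sigma j @ sigma i),
        (alpha i @ sigma j, sigma j @ alpha i)}" by blast
      have "1 \<le> i" "i < n" "1 \<le> j" "j < n" "i + 2 \<le> j \<or> j + 2 \<le> i" using ij by auto
      then show ?thesis using that(2) rs by blast
    next
      assume "(r, s) \<in> (\<Union>i \<in> {1..n - 2}.
       {(alpha i @ alpha (i + 1) @ alpha i, alpha (i + 1) @ alpha i @ alpha (i + 1)),
        (sigma i @ sigma (i + 1) @ sigma i, sigma (i + 1) @ sigma i @ sigma (i + 1)),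
        (alpha i @ alpha (i + 1) @ sigma i, sigma (i + 1) @ alpha i @ alpha (i + 1)),
        (sigma i @ sigma (i + 1) @ alpha i, alpha (i + 1) @ sigma i @ sigma (i + 1))})"
      then obtain i where "i \<in> {1..n - 2}" and
        rs: "(r, s) \<in> {(alpha i @ alpha (Suc i) @ alpha i, alpha (Suc i) @ alpha i @ alpha (Suc i)),
            (sigma i @ sigma (Suc i) @ sigma i, sigma (Suc i) @ sigma i @ sigma (Suc i)),
            (alpha i @ alpha (Suc i) @ sigma i, sigma (Suc i) @ alpha i @ alpha (Suc i)),
            (sigma i @ sigma (Suc i) @ alpha i, alpha (Suc i) @ sigma i @ sigma (Suc i))}"
        unfolding Suc_eq_plus1 by blast
      then have "1 \<le> i" "Suc i < n" by auto
      then show ?thesis using that(3) rs by blast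
    qed
    then show ?thesis
    proof cases
      case 1
      then show ?thesis using a[of i] by (simp add: f)
    next
      case 2
      then show ?thesis using b[OF 2(1-5)] by (auto simp: f)
    next
      case 3
      then show ?thesis using c[OF 3(1,2)] by (auto simp: f)
    qed
  qed
  show "pres_lift H f \<in> hom (WB n) H"
    unfolding WB_def by (rule pres_lift_hom[OF H f rels])
  show "x \<in> wb_gens n \<Longrightarrow> pres_lift H f (wb_gen_class n x) = f x"
    by (rule pres_lift_gen[OF H f rels])
qed

lemma group_WB: "group (WB n)"
  unfolding WB_def by (rule group_presented_group)

lemma GL_simps: "\<one>\<^bsub>GL d\<^esub> = 1\<^sub>m d" "A \<otimes>\<^bsub>GL d\<^esub> B = A * B"
  by (simp_all add: GL_def units_of_def ring_mat_def)

lemma GL_iff: "A \<in> carrier (GL d) \<longleftrightarrow>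
    A \<in> carrier_mat d d \<and> (\<exists>B\<in>carrier_mat d d. B * A = 1\<^sub>m d \<and> A * B = 1\<^sub>m d)"
  by (auto simp: GL_def units_of_def ring_mat_def Units_def)

lemma group_GL: "group (GL d)"
proof -
  interpret ring "ring_mat TYPE(complex) d ()" by (rule ring_mat)
  show ?thesis unfolding GL_def by (rule units_group)
qed

lemma units_complex: "carrier (units_of (class_ring :: complex ring)) = {x. x \<noteq> 0}"
proof -
  have "\<exists>y. y * x = 1 \<and> x * y = 1" if "x \<noteq> 0" for x :: complex
    using that by (intro exI[of _ "inverse x"]) simp
  then show ?thesis by (auto simp: units_of_def Units_def)
qed

lemma group_units_complex: "group (units_of (class_ring :: complex ring))"
proof -
  have "ring (class_ring :: complex ring)" by (rule class_ring.ring_axioms)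
  then show ?thesis by (intro Group.monoid.units_group Ring.ring.axioms(2))
qed

lemma X_rep_hom:
  assumes "y \<noteq> 0" "k \<in> {- 1, 1}"
  shows "X_rep y k \<in> hom (WB n) (units_of class_ring)"
    "x \<in> wb_gens n \<Longrightarrow> X_rep y k (wb_gen_class n x) = X_gen y k x"
proof -
  have R: "wb_relations (units_of (class_ring :: complex ring)) n (X_gen y k)"
    using assms(2) by (auto simp: wb_relations_def units_of_def)
  have f: "X_gen y k x \<in> carrier (units_of class_ring)" for x
    using assms by (cases x) (auto simp: units_complex)
  show "X_rep y k \<in> hom (WB n) (units_of class_ring)"
    "x \<in> wb_gens n \<Longrightarrow> X_rep y k (wb_gen_class n x) = X_gen y k x"
    unfolding X_rep_def using wb_pres_lift[OF group_units_complex f R] by blast+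
qed

lemma smult_smult_times: "a \<cdot>\<^sub>m (b \<cdot>\<^sub>m A) = (a * b) \<cdot>\<^sub>m A" for A :: "complex mat"
  by (rule eq_matI) auto

lemma smult_one_mat: "1 \<cdot>\<^sub>m A = A" for A :: "complex mat"
  by (rule eq_matI) auto

lemma smult_GL:
  assumes "c \<noteq> 0" "A \<in> carrier (GL d)"
  shows "c \<cdot>\<^sub>m A \<in> carrier (GL d)"
proof -
  obtain B where A: "A \<in> carrier_mat d d" and B: "B \<in> carrier_mat d d" "B * A = 1\<^sub>m d" "A * B = 1\<^sub>m d"
    using assms(2) by (auto simp: GL_iff)
  have "(inverse c \<cdot>\<^sub>m B) * (c \<cdot>\<^sub>m A) = 1\<^sub>m d" "(c \<cdot>\<^sub>m A) * (inverse c \<cdot>\<^sub>m B) = 1\<^sub>m d"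
    using A B assms(1) by (simp_all add: mult_smult_distrib[of _ d d _ d] mult_smult_assoc_mat[of _ d d _ d]
        smult_smult_times smult_one_mat)
  then show ?thesis using A B(1) by (auto simp: GL_iff intro!: bexI[of _ "inverse c \<cdot>\<^sub>m B"])
qed

lemma tensor1_hom:
  assumes \<chi>: "\<chi> \<in> hom G (units_of class_ring)" and \<beta>: "\<beta> \<in> hom G (GL d)"
  shows "tensor1 \<chi> \<beta> \<in> hom G (GL d)"
proof (rule homI)
  fix g h assume g: "g \<in> carrier G"
  have c: "\<chi> g \<noteq> 0" "\<beta> g \<in> carrier (GL d)" if "g \<in> carrier G" for g
    using hom_in_carrier[OF \<chi> that] hom_in_carrier[OF \<beta> that] by (auto simp: units_complex)
  show "tensor1 \<chi> \<beta> g \<in> carrier (GL d)" using c[OF g] by (simp add: tensor1_def smult_GL)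
  assume h: "h \<in> carrier G"
  have m: "\<beta> g \<in> carrier_mat d d" "\<beta> h \<in> carrier_mat d d" using c g h by (auto simp: GL_iff)
  have "\<chi> (g \<otimes>\<^bsub>G\<^esub> h) = \<chi> g * \<chi> h" using hom_mult[OF \<chi> g h] by (simp add: units_of_def)
  moreover have "\<beta> (g \<otimes>\<^bsub>G\<^esub> h) = \<beta> g * \<beta> h" using hom_mult[OF \<beta> g h] by (simp add: GL_simps)
  ultimately show "tensor1 \<chi> \<beta> (g \<otimes>\<^bsub>G\<^esub> h) = tensor1 \<chi> \<beta> g \<otimes>\<^bsub>GL d\<^esub> tensor1 \<chi> \<beta> h"
    using m by (simp add: tensor1_def GL_simps mult_smult_distrib[of _ d d _ d] mult_smult_assoc_mat[of _ d d _ d]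
      smult_smult_times mult.commute)
qed

text \<open>Both representations are homomorphisms, so a matrix that intertwines the values at the generators
  intertwines all values.\<close>

lemma equivalent_reps_on_generators:
  assumes \<rho>: "representation (WB n) d \<rho>"
    and B: "\<And>x. x \<in> wb_gens n \<Longrightarrow> B x \<in> carrier (GL d)" "wb_relations (GL d) n B"
    and yk: "y \<noteq> 0" "k \<in> {- 1, 1}"
  shows "equivalent_reps (WB n) d \<rho> (tensor1 (X_rep y k) (pres_lift (GL d) B)) \<longleftrightarrow>
    (\<exists>P\<in>carrier (GL d). \<forall>x\<in>wb_gens n. P * \<rho> (wb_gen_class n x) = (X_gen y k x \<cdot>\<^sub>m B x) * P)"
proof -
  let ?T = "tensor1 (X_rep y k) (pres_lift (GL d) B)"
  have L: "pres_lift (GL d) B \<in> hom (WB n) (GL d)"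
    "x \<in> wb_gens n \<Longrightarrow> pres_lift (GL d) B (wb_gen_class n x) = B x" for x
    using wb_pres_lift[OF group_GL _ B(2)] B(1) by blast+
  have T: "?T \<in> hom (WB n) (GL d)" by (rule tensor1_hom[OF X_rep_hom(1)[OF yk] L(1)])
  have g: "?T (wb_gen_class n x) = X_gen y k x \<cdot>\<^sub>m B x" if "x \<in> wb_gens n" for x
    using L(2)[OF that] X_rep_hom(2)[OF yk that] by (simp add: tensor1_def)
  show ?thesis
  proof
    assume "equivalent_reps (WB n) d \<rho> ?T"
    then obtain P where P: "P \<in> carrier (GL d)" "\<And>g. g \<in> carrier (WB n) \<Longrightarrow> P * \<rho> g = ?T g * P"
      unfolding equivalent_reps_def by blast
    have "P * \<rho> (wb_gen_class n x) = (X_gen y k x \<cdot>\<^sub>m B x) * P" if x: "x \<in> wb_gens n" for x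
      using P(2)[of "wb_gen_class n x"] pres_gen_closed[OF x] g[OF x] by (simp add: WB_def)
    then show "\<exists>P\<in>carrier (GL d). \<forall>x\<in>wb_gens n. P * \<rho> (wb_gen_class n x) = (X_gen y k x \<cdot>\<^sub>m B x) * P"
      using P(1) by blast
  next
    assume "\<exists>P\<in>carrier (GL d). \<forall>x\<in>wb_gens n. P * \<rho> (wb_gen_class n x) = (X_gen y k x \<cdot>\<^sub>m B x) * P"
    then obtain P where P: "P \<in> carrier (GL d)"
      "\<And>x. x \<in> wb_gens n \<Longrightarrow> P * \<rho> (wb_gen_class n x) = (X_gen y k x \<cdot>\<^sub>m B x) * P" by blast
    have "P * \<rho> h = ?T h * P" if h: "h \<in> carrier (WB n)" for h
      using intertwiner_from_generators[OF group_GL, where \<phi> = \<rho> and \<psi> = ?T and p = P and g = h]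
        \<rho> T P h g by (simp add: representation_def WB_def GL_simps)
    then show "equivalent_reps (WB n) d \<rho> ?T" unfolding equivalent_reps_def using P(1) by blast
  qed
qed

section \<open>The model representations\<close>

text \<open>Vectors are read as functions on the natural numbers that vanish outside \<open>1, \<dots>, d\<close>.  The
  zeros at the places \<open>0\<close> and \<open>d + 1\<close> make the formulas for the first and the last generator
  instances of the one for the generators between them.\<close>

definition to_fun :: "nat \<Rightarrow> complex vec \<Rightarrow> nat \<Rightarrow> complex" where
  "to_fun d v j = (if 1 \<le> j \<and> j \<le> d then v $ (j - 1) else 0)"

definition of_fun :: "nat \<Rightarrow> (nat \<Rightarrow> complex) \<Rightarrow> complex vec" where
  "of_fun d c = vec d (\<lambda>j. c (Suc j))"

definition fun_space :: "nat \<Rightarrow> (nat \<Rightarrow> complex) set" where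
  "fun_space d = {c. \<forall>j. j = 0 \<or> d < j \<longrightarrow> c j = 0}"

lemma of_fun_carrier [simp]: "of_fun d c \<in> carrier_vec d"
  by (simp add: of_fun_def)

lemma to_fun_in_fun_space: "to_fun d v \<in> fun_space d"
  by (auto simp: to_fun_def fun_space_def)

lemma to_fun_of_fun: "c \<in> fun_space d \<Longrightarrow> to_fun d (of_fun d c) = c"
  by (rule ext) (auto simp: to_fun_def of_fun_def fun_space_def Suc_le_eq)

lemma of_fun_to_fun: "v \<in> carrier_vec d \<Longrightarrow> of_fun d (to_fun d v) = v"
  by (auto simp: to_fun_def of_fun_def)

lemma to_fun_inject:
  assumes "v \<in> carrier_vec d" "w \<in> carrier_vec d" "to_fun d v = to_fun d w"
  shows "v = w"
  using assms by (metis of_fun_to_fun)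

lemma mat_eqI_action:
  fixes A B :: "complex mat"
  assumes A: "A \<in> carrier_mat d d" and B: "B \<in> carrier_mat d d"
    and eq: "\<And>v. v \<in> carrier_vec d \<Longrightarrow> to_fun d (A *\<^sub>v v) = to_fun d (B *\<^sub>v v)"
  shows "A = B"
proof (rule eq_matI)
  fix i j assume "i < dim_row B" "j < dim_col B"
  then have ij: "i < d" "j < d" using B by auto
  have "A *\<^sub>v unit_vec d j = B *\<^sub>v unit_vec d j"
    by (rule to_fun_inject[OF _ _ eq]) (use A B in auto)
  then have "(A *\<^sub>v unit_vec d j) $ i = (B *\<^sub>v unit_vec d j) $ i" by simp
  then show "A $$ (i, j) = B $$ (i, j)" using A B ij by simp
qed (use A B in auto)

text \<open>The first model representation consists of the following matrices, the second of their
  transposes.\<close>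

definition row_mat :: "nat \<Rightarrow> nat \<Rightarrow> complex \<Rightarrow> complex \<Rightarrow> complex \<Rightarrow> complex mat" where
  "row_mat d i l m u = mat d d (\<lambda>(r, c). if Suc r = i
     then (if Suc c = i then m else if Suc (Suc c) = i then l else if c = i then u else 0)
     else if r = c then 1 else 0)"

definition row_op :: "nat \<Rightarrow> complex \<Rightarrow> complex \<Rightarrow> complex \<Rightarrow> (nat \<Rightarrow> complex) \<Rightarrow> nat \<Rightarrow> complex" where
  "row_op i l m u c = c(i := l * c (i - 1) + m * c i + u * c (Suc i))"

lemma row_mat_carrier [simp]: "row_mat d i l m u \<in> carrier_mat d d"
  by (simp add: row_mat_def)

lemma diag_block_mat_2:
  assumes "A \<in> carrier_mat a a" "B \<in> carrier_mat b b" "t = a + b"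
  shows "diag_block_mat [A, B] \<in> carrier_mat t t"
    and "r < t \<Longrightarrow> s < t \<Longrightarrow> diag_block_mat [A, B] $$ (r, s) =
      (if r < a then if s < a then A $$ (r, s) else 0 else if s < a then 0 else B $$ (r - a, s - a))"
  using assms by (auto simp: Let_def)

lemma diag_block_mat_3:
  assumes "A \<in> carrier_mat a a" "B \<in> carrier_mat b b" "C \<in> carrier_mat c c" "t = a + (b + c)"
  shows "diag_block_mat [A, B, C] \<in> carrier_mat t t"
    and "r < t \<Longrightarrow> s < t \<Longrightarrow> diag_block_mat [A, B, C] $$ (r, s) =
      (if r < a then if s < a then A $$ (r, s) else 0 else if s < a then 0
       else diag_block_mat [B, C] $$ (r - a, s - a))"
proof -
  note BC = diag_block_mat_2(1)[OF assms(2,3) HOL.refl]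
  have eq: "diag_block_mat [A, B, C] = four_block_mat A (0\<^sub>m a (b + c)) (0\<^sub>m (b + c) a) (diag_block_mat [B, C])"
    using assms(1-3) by (simp add: Let_def)
  show "diag_block_mat [A, B, C] \<in> carrier_mat t t"
    unfolding eq assms(4) using assms(1) BC by (rule four_block_carrier_mat)
  show "r < t \<Longrightarrow> s < t \<Longrightarrow> diag_block_mat [A, B, C] $$ (r, s) =
      (if r < a then if s < a then A $$ (r, s) else 0 else if s < a then 0
       else diag_block_mat [B, C] $$ (r - a, s - a))"
    unfolding eq using assms(1,4) BC by (subst index_mat_four_block) auto
qed

lemma mat_of_rows_list_2:
  "mat_of_rows_list 2 [[p, q], [s, t]] \<in> carrier_mat 2 2"
  "r < 2 \<Longrightarrow> c < 2 \<Longrightarrow> mat_of_rows_list 2 [[p, q], [s, t]] $$ (r, c)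
    = (if r = 0 then if c = 0 then p else q else if c = 0 then s else t)"
  by (auto simp: mat_of_rows_list_def nth_Cons')

lemma mat_of_rows_list_3:
  "mat_of_rows_list 3 [[p1, p2, p3], [q1, q2, q3], [s1, s2, s3]] \<in> carrier_mat 3 3"
  "r < 3 \<Longrightarrow> c < 3 \<Longrightarrow> mat_of_rows_list 3 [[p1, p2, p3], [q1, q2, q3], [s1, s2, s3]] $$ (r, c)
    = (if r = 0 then if c = 0 then p1 else if c = 1 then p2 else p3
       else if r = 1 then if c = 0 then q1 else if c = 1 then q2 else q3
       else if c = 0 then s1 else if c = 1 then s2 else s3)"
  by (auto simp: mat_of_rows_list_def nth_Cons')

text \<open>One block pattern contains the shapes of both model representations: the row form has
  \<open>l' = u = 0\<close>, the column form \<open>l = u' = 0\<close>.\<close>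

lemma block_gen_entry:
  assumes n: "4 \<le> n" and i: "1 \<le> i" "i < n" and r: "r < n - 1" "c < n - 1"
  shows "block_gen n [[m, u'], [u, 1]] [[1, l', 0], [l, m, u'], [0, u, 1]] [[1, l'], [l, m]] i $$ (r, c)
    = (if Suc r = i \<and> Suc c = i then m
       else if Suc r = i \<and> Suc (Suc c) = i then l
       else if Suc r = i \<and> c = i then u'
       else if Suc c = i \<and> Suc (Suc r) = i then l'
       else if Suc c = i \<and> r = i then u
       else if r = c then 1 else 0)" (is "?B $$ _ = _")
    and "block_gen n [[m, u'], [u, 1]] [[1, l', 0], [l, m, u'], [0, u, 1]] [[1, l'], [l, m]] i
      \<in> carrier_mat (n - 1) (n - 1)"
proof -
  consider "i = 1" | "i = n - 1" "i \<noteq> 1" | "i \<noteq> 1" "i \<noteq> n - 1" by blast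
  then have "?B \<in> carrier_mat (n - 1) (n - 1) \<and> ?B $$ (r, c)
    = (if Suc r = i \<and> Suc c = i then m
       else if Suc r = i \<and> Suc (Suc c) = i then l
       else if Suc r = i \<and> c = i then u'
       else if Suc c = i \<and> Suc (Suc r) = i then l'
       else if Suc c = i \<and> r = i then u
       else if r = c then 1 else 0)"
  proof cases
    case 1
    have B: "?B = diag_block_mat [mat_of_rows_list 2 [[m, u'], [u, 1]], 1\<^sub>m (n - 3)]"
      using 1 by (simp add: block_gen_def)
    have t: "n - 1 = 2 + (n - 3)" using n by simp
    have cs: "x = 0 \<or> x = 1 \<or> (\<exists>y. y < n - 3 \<and> x = y + 2)" if "x < n - 1" for x
    proof -
      have "x = (x - 2) + 2 \<and> x - 2 < n - 3" if "2 \<le> x" using that \<open>x < n - 1\<close> by arith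
      then show ?thesis by (cases "2 \<le> x") auto
    qed
    show ?thesis
      unfolding B diag_block_mat_2(2)[OF mat_of_rows_list_2(1) one_carrier_mat t r]
      using cs[OF r(1)] cs[OF r(2)] 1
      by (intro conjI diag_block_mat_2(1)[OF mat_of_rows_list_2(1) one_carrier_mat t])
         (elim disjE exE conjE; simp add: mat_of_rows_list_2(2))
  next
    case 2
    have B: "?B = diag_block_mat [1\<^sub>m (n - 3), mat_of_rows_list 2 [[1, l'], [l, m]]]"
      using 2 by (simp add: block_gen_def)
    obtain p where p: "n = p + 3" using n le_Suc_ex[of 3 n] by auto
    have t: "n - 1 = (n - 3) + 2" using n by simp
    have cs: "x < p \<or> x = p \<or> x = Suc p" if "x < n - 1" for x using that p by arith
    show ?thesis
      unfolding B diag_block_mat_2(2)[OF one_carrier_mat mat_of_rows_list_2(1) t r]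
      using cs[OF r(1)] cs[OF r(2)] 2(1)
      by (intro conjI diag_block_mat_2(1)[OF one_carrier_mat mat_of_rows_list_2(1) t])
         (elim disjE; simp add: p mat_of_rows_list_2(2))
  next
    case 3
    have B: "?B = diag_block_mat [1\<^sub>m (i - 2), mat_of_rows_list 3 [[1, l', 0], [l, m, u'], [0, u, 1]],
        1\<^sub>m (n - i - 2)]"
      using 3 by (simp add: block_gen_def)
    obtain p where p: "i = p + 2" using i(1) 3(1) le_Suc_ex[of 2 i] by auto
    have "p + 4 \<le> n" using i(2) 3(2) p by arith
    then obtain q where q: "n = p + 4 + q" using le_Suc_ex[of "p + 4" n] by auto
    have t: "n - 1 = (i - 2) + (3 + (n - i - 2))" using p q by simp
    have cs: "x < p \<or> x = p \<or> x = Suc p \<or> x = Suc (Suc p) \<or> (\<exists>y. y < q \<and> x = p + 3 + y)"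
      if "x < n - 1" for x
    proof -
      have "x = p + 3 + (x - (p + 3)) \<and> x - (p + 3) < q" if "p + 3 \<le> x"
        using that \<open>x < n - 1\<close> q by arith
      then show ?thesis by (cases "p + 3 \<le> x") auto
    qed
    show ?thesis
      unfolding B diag_block_mat_3(2)[OF one_carrier_mat mat_of_rows_list_3(1) one_carrier_mat t r]
      using cs[OF r(1)] cs[OF r(2)]
      by (intro conjI diag_block_mat_3(1)[OF one_carrier_mat mat_of_rows_list_3(1) one_carrier_mat t])
         (elim disjE exE conjE; simp add: p q mat_of_rows_list_3(2)
           diag_block_mat_2(2)[OF mat_of_rows_list_3(1) one_carrier_mat HOL.refl]
           del: diag_block_mat.simps)
  qed
  then show "?B $$ (r, c) = (if Suc r = i \<and> Suc c = i then m
       else if Suc r = i \<and> Suc (Suc c) = i then l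
       else if Suc r = i \<and> c = i then u'
       else if Suc c = i \<and> Suc (Suc r) = i then l'
       else if Suc c = i \<and> r = i then u
       else if r = c then 1 else 0)" "?B \<in> carrier_mat (n - 1) (n - 1)" by blast+
qed

lemma block_gen_eq_row_mat:
  assumes "4 \<le> n" "1 \<le> i" "i < n"
  shows "block_gen n [[m, u], [0, 1]] [[1, 0, 0], [l, m, u], [0, 0, 1]] [[1, 0], [l, m]] i
    = row_mat (n - 1) i l m u"
proof (rule eq_matI)
  fix r c assume "r < dim_row (row_mat (n - 1) i l m u)" "c < dim_col (row_mat (n - 1) i l m u)"
  then have "r < n - 1" "c < n - 1" by (simp_all add: row_mat_def)
  then show "block_gen n [[m, u], [0, 1]] [[1, 0, 0], [l, m, u], [0, 0, 1]] [[1, 0], [l, m]] i $$ (r, c)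
    = row_mat (n - 1) i l m u $$ (r, c)"
    using block_gen_entry(1)[OF assms, of r c m u 0 0 l] by (auto simp: row_mat_def)
qed (use block_gen_entry(2)[OF assms, of 0 0 m u 0 0 l] assms in \<open>auto simp: row_mat_def\<close>)

lemma block_gen_eq_transpose_row_mat:
  assumes "4 \<le> n" "1 \<le> i" "i < n"
  shows "block_gen n [[m, 0], [u, 1]] [[1, l, 0], [0, m, 0], [0, u, 1]] [[1, l], [0, m]] i
    = transpose_mat (row_mat (n - 1) i l m u)"
proof (rule eq_matI)
  fix r c assume "r < dim_row (transpose_mat (row_mat (n - 1) i l m u))"
    "c < dim_col (transpose_mat (row_mat (n - 1) i l m u))"
  then have "r < n - 1" "c < n - 1" by (simp_all add: row_mat_def)
  then show "block_gen n [[m, 0], [u, 1]] [[1, l, 0], [0, m, 0], [0, u, 1]] [[1, l], [0, m]] i $$ (r, c)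
    = transpose_mat (row_mat (n - 1) i l m u) $$ (r, c)"
    using block_gen_entry(1)[OF assms, of r c m 0 u l 0] by (auto simp: row_mat_def)
qed (use block_gen_entry(2)[OF assms, of 0 0 m 0 u l 0] assms in \<open>auto simp: row_mat_def\<close>)

lemma row_mat_mult_vec:
  assumes v: "v \<in> carrier_vec d" and i: "1 \<le> i" "i \<le> d"
  shows "to_fun d (row_mat d i l m u *\<^sub>v v) = row_op i l m u (to_fun d v)"
proof
  fix j
  show "to_fun d (row_mat d i l m u *\<^sub>v v) j = row_op i l m u (to_fun d v) j"
  proof (cases "1 \<le> j \<and> j \<le> d")
    case False
    then show ?thesis using i by (auto simp: to_fun_def row_op_def)
  next
    case True
    have mv: "(row_mat d i l m u *\<^sub>v v) $ (j - 1) = (\<Sum>c<d. row_mat d i l m u $$ (j - 1, c) * v $ c)"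
      using True v by (auto simp: row_mat_def scalar_prod_def atLeast0LessThan intro!: sum.cong)
    show ?thesis
    proof (cases "j = i")
      case False
      have "(\<Sum>c<d. row_mat d i l m u $$ (j - 1, c) * v $ c)
          = (\<Sum>c<d. if c = j - 1 then v $ c else 0)"
        using True False by (intro sum.cong) (auto simp: row_mat_def)
      moreover have "j - 1 < d" using True by arith
      ultimately show ?thesis using True False mv by (simp add: to_fun_def row_op_def)
    next
      case j: True
      obtain k where k: "i = Suc k" using i by (cases i) auto
      have "(\<Sum>c<d. row_mat d i l m u $$ (j - 1, c) * v $ c)
          = (\<Sum>c<d. (if c = k then m * v $ c else 0) + (if Suc c = k then l * v $ c else 0)
              + (if c = Suc k then u * v $ c else 0))"
        using True by (intro sum.cong) (auto simp: row_mat_def j k)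
      also have "\<dots> = m * v $ k + (\<Sum>c<d. if Suc c = k then l * v $ c else 0)
          + (if Suc k < d then u * v $ Suc k else 0)"
        using i k by (simp add: sum.distrib)
      also have "(\<Sum>c<d. if Suc c = k then l * v $ c else 0) = (if k = 0 then 0 else l * v $ (k - 1))"
        using i k by (cases k) simp_all
      finally show ?thesis using True mv j k by (auto simp: to_fun_def row_op_def)
    qed
  qed
qed

lemma row_mat_mult_mult_vec:
  assumes "v \<in> carrier_vec d" "A \<in> carrier_mat d d" "1 \<le> i" "i \<le> d"
  shows "to_fun d (row_mat d i l m u * A *\<^sub>v v) = row_op i l m u (to_fun d (A *\<^sub>v v))"
  using assms by (simp add: assoc_mult_mat_vec[of _ d d _ d] row_mat_mult_vec[of _ d])

lemma transpose_GL:
  assumes "A \<in> carrier (GL d)"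
  shows "transpose_mat A \<in> carrier (GL d)"
proof -
  obtain B where A: "A \<in> carrier_mat d d" and B: "B \<in> carrier_mat d d" "B * A = 1\<^sub>m d" "A * B = 1\<^sub>m d"
    using assms by (auto simp: GL_iff)
  have "transpose_mat A * transpose_mat B = 1\<^sub>m d" "transpose_mat B * transpose_mat A = 1\<^sub>m d"
    using A B by (simp_all flip: transpose_mult[of _ d d _ d])
  then show ?thesis using A B(1) by (auto simp: GL_iff intro!: bexI[of _ "transpose_mat B"])
qed

lemma row_mat_GL:
  assumes i: "1 \<le> i" "i \<le> d" and m: "m \<noteq> 0"
  shows "row_mat d i l m u \<in> carrier (GL d)"
proof -
  let ?B = "row_mat d i (- l / m) (1 / m) (- u / m)"
  obtain k where k: "i = Suc k" using i by (cases i) auto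
  have "row_op i (- l / m) (1 / m) (- u / m) (row_op i l m u c) = c"
    "row_op i l m u (row_op i (- l / m) (1 / m) (- u / m) c) = c" for c
    using m by (auto simp: row_op_def k fun_eq_iff field_simps)
  then have "?B * row_mat d i l m u = 1\<^sub>m d" "row_mat d i l m u * ?B = 1\<^sub>m d"
    using i by (auto intro!: mat_eqI_action[of _ d] mult_carrier_mat[of _ d d _ d]
        simp: row_mat_mult_mult_vec row_mat_mult_vec)
  then show ?thesis by (auto simp: GL_iff intro!: bexI[of _ ?B])
qed

lemma row_op_apply:
  "row_op i l m u c x = (if x = i then l * c (i - 1) + m * c i + u * c (Suc i) else c x)"
  by (simp add: row_op_def)

lemma row_op_commute:
  assumes "1 \<le> i" "1 \<le> j" "i + 2 \<le> j \<or> j + 2 \<le> i"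
  shows "row_op i l m u (row_op j l' m' u' c) = row_op j l' m' u' (row_op i l m u c)"
proof
  fix x
  have "i \<noteq> j" "i - 1 \<noteq> j" "Suc i \<noteq> j" "j - 1 \<noteq> i" "Suc j \<noteq> i" using assms by auto
  then show "row_op i l m u (row_op j l' m' u' c) x = row_op j l' m' u' (row_op i l m u c) x"
    by (cases "x = i"; cases "x = j") (simp_all add: row_op_apply)
qed

lemma row_op_neighbours_eqI:
  assumes "f (Suc k) = g (Suc k)" "f (Suc (Suc k)) = g (Suc (Suc k))"
    and "\<And>x. x \<noteq> Suc k \<Longrightarrow> x \<noteq> Suc (Suc k) \<Longrightarrow> f x = g x"
  shows "f = g"
  using assms by (metis ext)

lemma beta_tilde_gen_row_mat:
  assumes "4 \<le> n" "1 \<le> i" "i < n"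
  shows "beta_tilde_gen n z (Sigma i) = row_mat (n - 1) i z (- z) 1"
    and "beta_tilde_gen n z (Alpha i) = row_mat (n - 1) i 1 (- 1) 1"
  using block_gen_eq_row_mat[OF assms] by simp_all

lemma beta_hat_gen_row_mat:
  assumes "4 \<le> n" "1 \<le> i" "i < n"
  shows "beta_hat_gen n z (Sigma i) = transpose_mat (row_mat (n - 1) i z (- z) 1)"
    and "beta_hat_gen n z (Alpha i) = transpose_mat (row_mat (n - 1) i z (- 1) (1 / z))"
  using block_gen_eq_transpose_row_mat[OF assms] by simp_all

declare beta_tilde_gen.simps [simp del] beta_hat_gen.simps [simp del]

lemma beta_gen_GL:
  assumes "4 \<le> n" "z \<noteq> 0" "x \<in> wb_gens n"
  shows "beta_tilde_gen n z x \<in> carrier (GL (n - 1))"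
    and "beta_hat_gen n z x \<in> carrier (GL (n - 1))"
proof -
  obtain i where i: "1 \<le> i" "i < n" and x: "x = Alpha i \<or> x = Sigma i"
    using assms(3) by (elim wb_gens_cases) blast+
  have "1 \<le> i" "i \<le> n - 1" using i by auto
  note r = row_mat_GL[OF this]
  show "beta_tilde_gen n z x \<in> carrier (GL (n - 1))"
    using x r assms(2) by (auto simp: beta_tilde_gen_row_mat[OF assms(1) i])
  show "beta_hat_gen n z x \<in> carrier (GL (n - 1))"
    using x r assms(2) by (auto simp: beta_hat_gen_row_mat[OF assms(1) i] intro!: transpose_GL)
qed

lemma beta_tilde_relations:
  assumes n: "4 \<le> n" and d: "d = n - 1"
  shows "wb_relations (GL d) n (beta_tilde_gen n z)"
proof -
  have gens: "beta_tilde_gen n z (Sigma i) = row_mat d i z (- z) 1"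
    "beta_tilde_gen n z (Alpha i) = row_mat d i 1 (- 1) 1" if "1 \<le> i" "i < n" for i
    using beta_tilde_gen_row_mat[OF n that] by (simp_all add: d)
  have le: "i \<le> d \<longleftrightarrow> i < n" for i using n d by auto
  let ?S = "\<lambda>i. row_op i z (- z) 1" and ?A = "\<lambda>i. row_op i 1 (- 1) 1"
  have inv: "?A i (?A i c) = c" if "1 \<le> i" for i c
    using that by (intro ext) (auto simp: row_op_apply)
  have nb: "?A i (?A (Suc i) (?A i c)) = ?A (Suc i) (?A i (?A (Suc i) c))"
    "?S i (?S (Suc i) (?S i c)) = ?S (Suc i) (?S i (?S (Suc i) c))"
    "?A i (?A (Suc i) (?S i c)) = ?S (Suc i) (?A i (?A (Suc i) c))"
    "?S i (?S (Suc i) (?A i c)) = ?A (Suc i) (?S i (?S (Suc i) c))"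
    if i1: "1 \<le> i" for i c
  proof -
    obtain k where i: "i = Suc k" by (cases i) (use i1 in auto)
    show "?A i (?A (Suc i) (?A i c)) = ?A (Suc i) (?A i (?A (Suc i) c))"
      "?S i (?S (Suc i) (?S i c)) = ?S (Suc i) (?S i (?S (Suc i) c))"
      "?A i (?A (Suc i) (?S i c)) = ?S (Suc i) (?A i (?A (Suc i) c))"
      "?S i (?S (Suc i) (?A i c)) = ?A (Suc i) (?S i (?S (Suc i) c))"
      unfolding i by (rule row_op_neighbours_eqI[of _ k]; simp add: row_op_apply algebra_simps)+
  qed
  note [simp] = GL_simps gens le row_mat_mult_mult_vec row_mat_mult_vec
    mult_carrier_mat[of _ d d _ d]
  show ?thesis
    unfolding wb_relations_def
  proof (intro conjI allI impI, goal_cases)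
    case (1 i)
    then show ?case using n by - (simp, (rule mat_eqI_action[of _ d]; simp add: inv))
  next
    case (2 i j)
    note c = row_op_commute[OF 2(1,3,5)]
    show ?case using n 2(1-4) by - (simp, (rule mat_eqI_action[of _ d]; simp add: c))
  next
    case (3 i j)
    note c = row_op_commute[OF 3(1,3,5)]
    show ?case using n 3(1-4) by - (simp, (rule mat_eqI_action[of _ d]; simp add: c))
  next
    case (4 i j)
    note c = row_op_commute[OF 4(1,3,5)]
    show ?case using n 4(1-4) by - (simp, (rule mat_eqI_action[of _ d]; simp add: c))
  next
    case (5 i)
    then show ?case using n by - (simp, (rule mat_eqI_action[of _ d]; simp add: nb))
  next
    case (6 i)
    then show ?case using n by - (simp, (rule mat_eqI_action[of _ d]; simp add: nb))
  next
    case (7 i)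
    then show ?case using n by - (simp, (rule mat_eqI_action[of _ d]; simp add: nb))
  next
    case (8 i)
    then show ?case using n by - (simp, (rule mat_eqI_action[of _ d]; simp add: nb))
  qed
qed

text \<open>The matrices of the second family are transposes, so each relation has to be checked for the
  untransposed matrices with both of its sides read backwards.\<close>

lemma beta_hat_relations:
  assumes n: "4 \<le> n" and z: "z \<noteq> 0" and d: "d = n - 1"
  shows "wb_relations (GL d) n (beta_hat_gen n z)"
proof -
  have gens: "beta_hat_gen n z (Sigma i) = transpose_mat (row_mat d i z (- z) 1)"
    "beta_hat_gen n z (Alpha i) = transpose_mat (row_mat d i z (- 1) (1 / z))" if "1 \<le> i" "i < n" for i
    using beta_hat_gen_row_mat[OF n that] by (simp_all add: d)
  have le: "i \<le> d \<longleftrightarrow> i < n" for i using n d by auto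
  let ?S = "\<lambda>i. row_op i z (- z) 1" and ?A = "\<lambda>i. row_op i z (- 1) (1 / z)"
  have inv: "?A i (?A i c) = c" if "1 \<le> i" for i c
    using that by (intro ext) (auto simp: row_op_apply)
  have nb: "?A i (?A (Suc i) (?A i c)) = ?A (Suc i) (?A i (?A (Suc i) c))"
    "?S i (?S (Suc i) (?S i c)) = ?S (Suc i) (?S i (?S (Suc i) c))"
    "?S i (?A (Suc i) (?A i c)) = ?A (Suc i) (?A i (?S (Suc i) c))"
    "?A i (?S (Suc i) (?S i c)) = ?S (Suc i) (?S i (?A (Suc i) c))"
    if i1: "1 \<le> i" for i c
  proof -
    obtain k where i: "i = Suc k" by (cases i) (use i1 in auto)
    show "?A i (?A (Suc i) (?A i c)) = ?A (Suc i) (?A i (?A (Suc i) c))"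
      "?S i (?S (Suc i) (?S i c)) = ?S (Suc i) (?S i (?S (Suc i) c))"
      "?S i (?A (Suc i) (?A i c)) = ?A (Suc i) (?A i (?S (Suc i) c))"
      "?A i (?S (Suc i) (?S i c)) = ?S (Suc i) (?S i (?A (Suc i) c))"
      unfolding i by (rule row_op_neighbours_eqI[of _ k]; use z in \<open>simp add: row_op_apply algebra_simps\<close>)+
  qed
  have t2: "transpose_mat U * transpose_mat V = transpose_mat (V * U)"
    if "U \<in> carrier_mat d d" "V \<in> carrier_mat d d" for U V :: "complex mat"
    using that by (simp add: transpose_mult[of _ d d _ d])
  have t3: "transpose_mat U * (transpose_mat V * transpose_mat N) = transpose_mat (N * (V * U))"
    if "U \<in> carrier_mat d d" "V \<in> carrier_mat d d" "N \<in> carrier_mat d d" for U V N :: "complex mat"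
    using that by (simp add: transpose_mult[of _ d d _ d] assoc_mult_mat[of _ d d _ d _ d])
  note [simp] = GL_simps gens le row_mat_mult_mult_vec row_mat_mult_vec
    mult_carrier_mat[of _ d d _ d]
  show ?thesis
    unfolding wb_relations_def
  proof (intro conjI allI impI, goal_cases)
    case (1 i)
    let ?a = "row_mat d i z (- 1) (1 / z)"
    have "?a * ?a = 1\<^sub>m d" using 1 by (intro mat_eqI_action[of _ d]) (simp_all add: inv)
    then show ?case using n 1 by (simp add: t2)
  next
    case (2 i j)
    note c = row_op_commute[OF 2(1,3,5)]
    show ?case using n 2(1-4) by - (simp add: t2, (rule mat_eqI_action[of _ d]; simp add: c))
  next
    case (3 i j)
    note c = row_op_commute[OF 3(1,3,5)]
    show ?case using n 3(1-4) by - (simp add: t2, (rule mat_eqI_action[of _ d]; simp add: c))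
  next
    case (4 i j)
    note c = row_op_commute[OF 4(1,3,5)]
    show ?case using n 4(1-4) by - (simp add: t2, (rule mat_eqI_action[of _ d]; simp add: c))
  next
    case (5 i)
    then show ?case using n by - (simp add: t3, (rule mat_eqI_action[of _ d]; simp add: nb))
  next
    case (6 i)
    then show ?case using n by - (simp add: t3, (rule mat_eqI_action[of _ d]; simp add: nb))
  next
    case (7 i)
    then show ?case using n by - (simp add: t3, (rule mat_eqI_action[of _ d]; simp add: nb))
  next
    case (8 i)
    then show ?case using n by - (simp add: t3, (rule mat_eqI_action[of _ d]; simp add: nb))
  qed
qed

section \<open>Consequences of irreducibility\<close>

lemma mat_GL_cancel:
  assumes A: "A \<in> carrier (GL d)" and v: "v \<in> carrier_vec d" "w \<in> carrier_vec d"
    and eq: "A *\<^sub>v v = A *\<^sub>v w"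
  shows "v = w"
proof -
  obtain B where A': "A \<in> carrier_mat d d" and B: "B \<in> carrier_mat d d" "B * A = 1\<^sub>m d"
    using A by (auto simp: GL_iff)
  have "v = (B * A) *\<^sub>v v" using B v by simp
  also have "\<dots> = B *\<^sub>v (A *\<^sub>v v)" by (rule assoc_mult_mat_vec[OF B(1) A' v(1)])
  also have "\<dots> = (B * A) *\<^sub>v w" unfolding eq by (rule assoc_mult_mat_vec[OF B(1) A' v(2), symmetric])
  finally show ?thesis using B v by simp
qed

text \<open>The equivalence in the last assumption makes \<open>W\<close> invariant under the inverses of the
  generators as well.\<close>

lemma braid_irreducible_subspace:
  assumes \<rho>: "representation (WB n) d \<rho>" and irr: "irreducible_rep (braid n) d \<rho>"
    and W: "W \<subseteq> carrier_vec d" "0\<^sub>v d \<in> W" "\<And>v w. v \<in> W \<Longrightarrow> w \<in> W \<Longrightarrow> v + w \<in> W"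
      "\<And>c v. v \<in> W \<Longrightarrow> c \<cdot>\<^sub>v v \<in> W"
    and inv: "\<And>i w. 1 \<le> i \<Longrightarrow> i < n \<Longrightarrow> w \<in> carrier_vec d \<Longrightarrow>
      \<rho> (wb_gen_class n (Sigma i)) *\<^sub>v w \<in> W \<longleftrightarrow> w \<in> W"
  shows "W = {0\<^sub>v d} \<or> W = carrier_vec d"
proof -
  have hom: "\<rho> \<in> hom (WB n) (GL d)" using \<rho> by (simp add: representation_def)
  interpret WB: group "WB n" by (rule group_WB)
  interpret GL: group "GL d" by (rule group_GL)
  interpret \<rho>: group_hom "WB n" "GL d" \<rho> by unfold_locales (rule hom)
  have M: "\<rho> g \<in> carrier_mat d d" if "g \<in> carrier (WB n)" for g
    using \<rho>.hom_closed[OF that] by (simp add: GL_iff)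
  have "VectorSpace.subspace class_ring W (module_vec TYPE(complex) d)"
    unfolding VectorSpace.subspace_def
  proof
    show "vectorspace class_ring (module_vec TYPE(complex) d)" by (rule vec_vs)
    show "submodule class_ring W (module_vec TYPE(complex) d)"
      by (rule submodule.intro[OF vec_module]) (use W in \<open>auto simp: module_vec_simps\<close>)
  qed
  moreover have "\<rho> g *\<^sub>v w \<in> W" if g: "g \<in> carrier (braid n)" and w: "w \<in> W" for g w
  proof -
    let ?S = "carrier (WB n) \<inter> (\<lambda>i. wb_gen_class n (Sigma i)) ` {1..n - 1}"
    have "g \<in> generate (WB n) ?S" using g by (simp add: braid_def carrier_subgroup_generated)
    then have "g \<in> carrier (WB n) \<and> (\<forall>w\<in>carrier_vec d. \<rho> g *\<^sub>v w \<in> W \<longleftrightarrow> w \<in> W)"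
    proof (induction rule: generate.induct)
      case one
      then show ?case by (simp add: GL_simps)
    next
      case (incl h)
      then show ?case using inv by auto
    next
      case (inv h)
      then have h: "h \<in> carrier (WB n)" by simp
      have *: "\<rho> h *\<^sub>v w \<in> W \<longleftrightarrow> w \<in> W" if "w \<in> carrier_vec d" for w
        using inv that assms(7) by auto
      have "\<rho> h \<otimes>\<^bsub>GL d\<^esub> \<rho> (inv\<^bsub>WB n\<^esub> h) = \<one>\<^bsub>GL d\<^esub>"
        using h by (simp flip: \<rho>.hom_mult)
      then have one: "\<rho> h * \<rho> (inv\<^bsub>WB n\<^esub> h) = 1\<^sub>m d" by (simp only: GL_simps)
      have "\<rho> (inv\<^bsub>WB n\<^esub> h) *\<^sub>v w \<in> W \<longleftrightarrow> w \<in> W" if w: "w \<in> carrier_vec d" for w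
      proof -
        have "\<rho> h *\<^sub>v (\<rho> (inv\<^bsub>WB n\<^esub> h) *\<^sub>v w) = w"
          using M[OF h] M[of "inv\<^bsub>WB n\<^esub> h"] h w one by (simp flip: assoc_mult_mat_vec[of _ d d _ d])
        moreover have "\<rho> (inv\<^bsub>WB n\<^esub> h) *\<^sub>v w \<in> carrier_vec d"
          using M[of "inv\<^bsub>WB n\<^esub> h"] h w by simp
        ultimately show ?thesis using * by metis
      qed
      then show ?case using h by simp
    next
      case (eng g h)
      have "\<rho> (g \<otimes>\<^bsub>WB n\<^esub> h) *\<^sub>v w = \<rho> g *\<^sub>v (\<rho> h *\<^sub>v w)" if "w \<in> carrier_vec d" for w
        using eng that M by (simp add: GL_simps assoc_mult_mat_vec[of _ d d _ d])
      moreover have "\<rho> h *\<^sub>v w \<in> carrier_vec d" if "w \<in> carrier_vec d" for w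
        by (intro mult_mat_vec_carrier[of _ d d] M) (use eng that in auto)
      ultimately show ?case using eng by simp
    qed
    then show ?thesis using w W(1) by blast
  qed
  ultimately show ?thesis using irr unfolding irreducible_rep_def by blast
qed

text \<open>A common eigenvector spans an invariant line, and the kernel of a common eigenvector of the
  dual action is an invariant hyperplane.  Neither is trivial, since the dimension is at least 2.\<close>

lemma braid_no_common_eigenvector:
  assumes \<rho>: "representation (WB n) d \<rho>" and irr: "irreducible_rep (braid n) d \<rho>" and d: "2 \<le> d"
    and v: "v \<in> carrier_vec d" "v \<noteq> 0\<^sub>v d" and c: "c \<noteq> 0"
    and eig: "\<And>i. 1 \<le> i \<Longrightarrow> i < n \<Longrightarrow> \<rho> (wb_gen_class n (Sigma i)) *\<^sub>v v = c \<cdot>\<^sub>v v"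
  shows False
proof -
  define W where "W = range (\<lambda>a. a \<cdot>\<^sub>v v)"
  have M: "\<rho> (wb_gen_class n (Sigma i)) \<in> carrier (GL d)" if "1 \<le> i" "i < n" for i
    using hom_in_carrier[of \<rho> "WB n" "GL d"] pres_gen_closed[of "Sigma i" "wb_gens n" "wb_rels n"] \<rho> that
    by (simp add: representation_def WB_def)
  have "W = {0\<^sub>v d} \<or> W = carrier_vec d"
  proof (rule braid_irreducible_subspace[OF \<rho> irr])
    show "W \<subseteq> carrier_vec d" using v by (auto simp: W_def)
    show "0\<^sub>v d \<in> W" using v(1) unfolding W_def by (intro range_eqI[of _ _ 0]) auto
    show "x + w \<in> W" if "x \<in> W" "w \<in> W" for x w
      using that v(1) unfolding W_def by (auto simp flip: add_smult_distrib_vec)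
    show "a \<cdot>\<^sub>v w \<in> W" if "w \<in> W" for a w
      using that v(1) unfolding W_def by (auto simp: smult_smult_assoc)
    fix i and w :: "complex vec" assume i: "1 \<le> i" "i < n" and w: "w \<in> carrier_vec d"
    let ?M = "\<rho> (wb_gen_class n (Sigma i))"
    have Mc: "?M \<in> carrier_mat d d" using M[OF i] by (simp add: GL_iff)
    have Mv: "?M *\<^sub>v (a \<cdot>\<^sub>v v) = (a * c) \<cdot>\<^sub>v v" for a
      using mult_mat_vec[OF Mc v(1)] eig[OF i] by (simp add: smult_smult_assoc)
    show "?M *\<^sub>v w \<in> W \<longleftrightarrow> w \<in> W"
    proof
      assume "?M *\<^sub>v w \<in> W"
      then obtain a where a: "?M *\<^sub>v w = a \<cdot>\<^sub>v v" by (auto simp: W_def)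
      have "?M *\<^sub>v w = ?M *\<^sub>v ((a / c) \<cdot>\<^sub>v v)" using c by (simp add: a Mv)
      then have "w = (a / c) \<cdot>\<^sub>v v" by (rule mat_GL_cancel[OF M[OF i] w, rotated]) (use v in simp)
      then show "w \<in> W" by (simp add: W_def)
    qed (auto simp: W_def Mv)
  qed
  moreover have "v \<in> W" unfolding W_def by (rule range_eqI[of _ _ 1]) simp
  ultimately have "unit_vec d 0 \<in> W" "unit_vec d 1 \<in> W" using v(2) by auto
  then obtain a b where ab: "unit_vec d 0 = a \<cdot>\<^sub>v v" "unit_vec d 1 = b \<cdot>\<^sub>v v" by (auto simp: W_def)
  have "a * v $ 0 = 1" "a * v $ 1 = 0" using arg_cong[OF ab(1), of "\<lambda>x. x $ 0"] arg_cong[OF ab(1), of "\<lambda>x. x $ 1"] d v(1)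
    by auto
  moreover have "b * v $ 1 = 1" using arg_cong[OF ab(2), of "\<lambda>x. x $ 1"] d v(1) by auto
  ultimately show False by auto
qed

lemma braid_no_common_eigenform:
  assumes \<rho>: "representation (WB n) d \<rho>" and irr: "irreducible_rep (braid n) d \<rho>" and d: "2 \<le> d"
    and u: "u \<in> carrier_vec d" "u \<noteq> 0\<^sub>v d" and c: "c \<noteq> 0"
    and eig: "\<And>i w. 1 \<le> i \<Longrightarrow> i < n \<Longrightarrow> w \<in> carrier_vec d \<Longrightarrow>
      u \<bullet> (\<rho> (wb_gen_class n (Sigma i)) *\<^sub>v w) = c * (u \<bullet> w)"
  shows False
proof -
  define W where "W = {w \<in> carrier_vec d. u \<bullet> w = 0}"
  have M: "\<rho> (wb_gen_class n (Sigma i)) \<in> carrier_mat d d" if "1 \<le> i" "i < n" for i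
    using hom_in_carrier[of \<rho> "WB n" "GL d"] pres_gen_closed[of "Sigma i" "wb_gens n" "wb_rels n"] \<rho> that
    by (simp add: representation_def WB_def GL_iff)
  have "W = {0\<^sub>v d} \<or> W = carrier_vec d"
    by (rule braid_irreducible_subspace[OF \<rho> irr])
       (use u(1) M eig c in \<open>auto simp: W_def scalar_prod_add_distrib[of _ d] intro: mult_mat_vec_carrier[of _ d d]\<close>)
  then show False
  proof
    assume W0: "W = {0\<^sub>v d}"
    define w where "w = (u $ 1) \<cdot>\<^sub>v unit_vec d 0 + (- u $ 0) \<cdot>\<^sub>v unit_vec d 1"
    have "w \<in> W" using u(1) d by (simp add: W_def w_def scalar_prod_add_distrib[of _ d])
    then have "w $ 1 = 0" using W0 d by simp
    then have "u $ 0 = 0" using d by (simp add: w_def)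
    then have "unit_vec d 0 \<in> W" using u(1) d by (simp add: W_def)
    then have "unit_vec d 0 $ 0 = (0 :: complex)" using W0 d by simp
    then show False using d by simp
  next
    assume W1: "W = carrier_vec d"
    have "u = 0\<^sub>v d"
    proof (rule eq_vecI)
      fix j assume "j < dim_vec (0\<^sub>v d :: complex vec)"
      then have "j < d" "unit_vec d j \<in> W" using W1 by auto
      then show "u $ j = 0\<^sub>v d $ j" using u(1) by (simp add: W_def)
    qed (use u in simp)
    then show False using u(2) by simp
  qed
qed

section \<open>Recovering the parameters\<close>

lemma to_fun_add:
  "v \<in> carrier_vec d \<Longrightarrow> w \<in> carrier_vec d \<Longrightarrow> to_fun d (v + w) j = to_fun d v j + to_fun d w j"
  by (auto simp: to_fun_def)

lemma to_fun_smult: "v \<in> carrier_vec d \<Longrightarrow> to_fun d (c \<cdot>\<^sub>v v) j = c * to_fun d v j"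
  by (auto simp: to_fun_def)

lemma smult_mat_vec: "(c \<cdot>\<^sub>m A) *\<^sub>v v = c \<cdot>\<^sub>v (A *\<^sub>v v)"
  if "A \<in> carrier_mat d d" "v \<in> carrier_vec d" for A :: "complex mat"
  using that by (intro eq_vecI) auto

definition col_op :: "nat \<Rightarrow> nat \<Rightarrow> complex \<Rightarrow> complex \<Rightarrow> complex \<Rightarrow> (nat \<Rightarrow> complex) \<Rightarrow> nat \<Rightarrow> complex" where
  "col_op d i l m u c j = (if j = 0 \<or> d < j then 0 else if j = i then m * c i
     else c j + (if Suc j = i then l * c i else if j = Suc i then u * c i else 0))"

lemma transpose_row_mat_mult_vec:
  assumes v: "v \<in> carrier_vec d" and i: "1 \<le> i" "i \<le> d"
  shows "to_fun d (transpose_mat (row_mat d i l m u) *\<^sub>v v) = col_op d i l m u (to_fun d v)"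
proof
  fix j
  show "to_fun d (transpose_mat (row_mat d i l m u) *\<^sub>v v) j = col_op d i l m u (to_fun d v) j"
  proof (cases "1 \<le> j \<and> j \<le> d")
    case False
    then show ?thesis by (auto simp: to_fun_def col_op_def)
  next
    case True
    define e where "e = (if j = i then m else if Suc j = i then l else if j = Suc i then u else 0)"
    obtain p where p: "i = Suc p" "p < d" using i by (cases i) auto
    obtain t where t: "j = Suc t" "t < d" using True by (cases j) auto
    have mv: "(transpose_mat (row_mat d i l m u) *\<^sub>v v) $ (j - 1)
        = (\<Sum>c<d. row_mat d i l m u $$ (c, j - 1) * v $ c)"
      using True v by (auto simp: row_mat_def scalar_prod_def atLeast0LessThan intro!: sum.cong)
    also have "\<dots> = (\<Sum>c<d. (if c = p then e * v $ c else 0)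
        + (if c = t then if j = i then 0 else v $ c else 0))"
      using p(2) t(2) by (intro sum.cong) (auto simp: row_mat_def e_def p(1) t(1))
    also have "\<dots> = e * v $ p + (if j = i then 0 else v $ t)"
      using p t by (simp add: sum.distrib)
    finally show ?thesis using True i by (auto simp: to_fun_def col_op_def e_def p t)
  qed
qed

text \<open>Identities that survive a change of basis and determine the twist \<open>(y, k)\<close> and the parameter
  \<open>z\<close>: up to the factor \<open>y\<close> each generator \<open>\<sigma>\<close> is the identity plus an operator of rank one with
  \<open>(\<sigma> - y) (\<sigma> + y z) = 0\<close>, and the rank one parts of distant generators annihilate each other.\<close>

definition twist_invariants ::
    "nat \<Rightarrow> (wb_gen \<Rightarrow> complex mat) \<Rightarrow> complex \<Rightarrow> complex \<Rightarrow> complex \<Rightarrow> bool" where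
  "twist_invariants d M y k z \<longleftrightarrow>
    (\<forall>w\<in>carrier_vec d. M (Sigma 1) *\<^sub>v (M (Sigma 3) *\<^sub>v w) + (y * y) \<cdot>\<^sub>v w
      = y \<cdot>\<^sub>v (M (Sigma 1) *\<^sub>v w) + y \<cdot>\<^sub>v (M (Sigma 3) *\<^sub>v w)) \<and>
    (\<forall>w\<in>carrier_vec d. M (Alpha 1) *\<^sub>v (M (Alpha 3) *\<^sub>v w) + (k * k) \<cdot>\<^sub>v w
      = k \<cdot>\<^sub>v (M (Alpha 1) *\<^sub>v w) + k \<cdot>\<^sub>v (M (Alpha 3) *\<^sub>v w)) \<and>
    (\<exists>v\<in>carrier_vec d. v \<noteq> 0\<^sub>v d \<and> M (Sigma 1) *\<^sub>v v = y \<cdot>\<^sub>v v \<and> M (Sigma 3) *\<^sub>v v = y \<cdot>\<^sub>v v \<and>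
      M (Alpha 1) *\<^sub>v v = k \<cdot>\<^sub>v v \<and> M (Alpha 3) *\<^sub>v v = k \<cdot>\<^sub>v v) \<and>
    (\<forall>w\<in>carrier_vec d. M (Sigma 1) *\<^sub>v (M (Sigma 1) *\<^sub>v w)
      = (y * (1 - z)) \<cdot>\<^sub>v (M (Sigma 1) *\<^sub>v w) + (y * y * z) \<cdot>\<^sub>v w) \<and>
    (\<exists>w\<in>carrier_vec d. M (Sigma 1) *\<^sub>v w \<noteq> y \<cdot>\<^sub>v w)"

text \<open>In the first family the rank one parts of \<open>\<alpha>\<^sub>1\<close> and \<open>\<sigma>\<^sub>1\<close> have the same image, on which \<open>\<alpha>\<^sub>1\<close>
  acts as \<open>-k\<close>.\<close>

definition same_image :: "nat \<Rightarrow> (wb_gen \<Rightarrow> complex mat) \<Rightarrow> complex \<Rightarrow> complex \<Rightarrow> bool" where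
  "same_image d M y k \<longleftrightarrow> (\<forall>w\<in>carrier_vec d.
    M (Alpha 1) *\<^sub>v (M (Sigma 1) *\<^sub>v w) + k \<cdot>\<^sub>v (M (Sigma 1) *\<^sub>v w)
      = y \<cdot>\<^sub>v (M (Alpha 1) *\<^sub>v w) + (k * y) \<cdot>\<^sub>v w)"

lemma smult_vec_cancel:
  fixes v :: "complex vec"
  assumes "v \<in> carrier_vec d" "v \<noteq> 0\<^sub>v d" "a \<cdot>\<^sub>v v = b \<cdot>\<^sub>v v"
  shows "a = b"
proof -
  obtain j where j: "j < d" "v $ j \<noteq> 0"
  proof (rule ccontr)
    assume "\<not> thesis"
    then have "v = 0\<^sub>v d" using that assms(1) by (intro eq_vecI) auto
    then show False using assms(2) by simp
  qed
  have "a * v $ j = b * v $ j" using arg_cong[OF assms(3), of "\<lambda>x. x $ j"] j assms(1) by simp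
  then show ?thesis using j by simp
qed

lemma twist_invariants_unique:
  assumes 1: "twist_invariants d M y k z" and 2: "twist_invariants d M y' k' z'" and y: "y \<noteq> 0"
    and M: "\<And>x. x \<in> {Sigma 1, Sigma 3, Alpha 1, Alpha 3} \<Longrightarrow> M x \<in> carrier_mat d d"
  shows "y = y' \<and> k = k' \<and> z = z'"
proof -
  have eig: "a = b" if v: "v \<in> carrier_vec d" "v \<noteq> 0\<^sub>v d"
    and eq: "A *\<^sub>v (B *\<^sub>v v) + (a * a) \<cdot>\<^sub>v v = a \<cdot>\<^sub>v (A *\<^sub>v v) + a \<cdot>\<^sub>v (B *\<^sub>v v)"
    and AB: "A *\<^sub>v v = b \<cdot>\<^sub>v v" "B *\<^sub>v v = b \<cdot>\<^sub>v v" "A \<in> carrier_mat d d" for A B :: "complex mat" and a b v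
  proof -
    have "A *\<^sub>v (b \<cdot>\<^sub>v v) = b \<cdot>\<^sub>v (b \<cdot>\<^sub>v v)" using mult_mat_vec[OF AB(3) v(1), of b] AB(1) by simp
    then have "(b * b) \<cdot>\<^sub>v v + (a * a) \<cdot>\<^sub>v v = (a * b) \<cdot>\<^sub>v v + (a * b) \<cdot>\<^sub>v v"
      using eq unfolding AB(1,2) by (simp only: smult_smult_assoc)
    then have "(b * b + a * a) \<cdot>\<^sub>v v = (a * b + a * b) \<cdot>\<^sub>v v"
      unfolding add_smult_distrib_vec .
    then have "b * b + a * a = a * b + a * b" by (rule smult_vec_cancel[OF v])
    then have "(a - b) * (a - b) = 0" by (simp add: algebra_simps)
    then show ?thesis by simp
  qed
  obtain v where v: "v \<in> carrier_vec d" "v \<noteq> 0\<^sub>v d" "M (Sigma 1) *\<^sub>v v = y' \<cdot>\<^sub>v v"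
    "M (Sigma 3) *\<^sub>v v = y' \<cdot>\<^sub>v v" "M (Alpha 1) *\<^sub>v v = k' \<cdot>\<^sub>v v" "M (Alpha 3) *\<^sub>v v = k' \<cdot>\<^sub>v v"
    using 2 unfolding twist_invariants_def by blast
  have yy: "y = y'"
    by (rule eig[OF v(1,2) _ v(3,4)]) (use 1 v(1) M in \<open>auto simp: twist_invariants_def\<close>)
  have kk: "k = k'"
    by (rule eig[OF v(1,2) _ v(5,6)]) (use 1 v(1) M in \<open>auto simp: twist_invariants_def\<close>)
  obtain w where w: "w \<in> carrier_vec d" "M (Sigma 1) *\<^sub>v w \<noteq> y \<cdot>\<^sub>v w"
    using 1 unfolding twist_invariants_def by blast
  have Mw: "M (Sigma 1) *\<^sub>v w \<in> carrier_vec d"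
    by (rule mult_mat_vec_carrier[OF M w(1)]) simp
  obtain j where j: "j < d" "(M (Sigma 1) *\<^sub>v w) $ j \<noteq> y * w $ j"
  proof (rule ccontr)
    assume "\<not> thesis"
    then have "M (Sigma 1) *\<^sub>v w = y \<cdot>\<^sub>v w" using that w(1) M[of "Sigma 1"] by (intro eq_vecI) auto
    then show False using w(2) by simp
  qed
  have "(y * (1 - z)) \<cdot>\<^sub>v (M (Sigma 1) *\<^sub>v w) + (y * y * z) \<cdot>\<^sub>v w
      = (y * (1 - z')) \<cdot>\<^sub>v (M (Sigma 1) *\<^sub>v w) + (y * y * z') \<cdot>\<^sub>v w"
    using 1 2 w(1) unfolding twist_invariants_def yy by metis
  from arg_cong[OF this, of "\<lambda>x. x $ j"]
  have "y * (1 - z) * (M (Sigma 1) *\<^sub>v w) $ j + y * y * z * w $ j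
      = y * (1 - z') * (M (Sigma 1) *\<^sub>v w) $ j + y * y * z' * w $ j"
    using j(1) w(1) M[of "Sigma 1"] by auto
  then have "y * (z - z') * (y * w $ j - (M (Sigma 1) *\<^sub>v w) $ j) = 0" by (simp add: algebra_simps)
  then show ?thesis using yy kk y j(2) by simp
qed

lemma invariants_transport:
  assumes P: "P \<in> carrier (GL d)"
    and M: "\<And>x. x \<in> {Sigma 1, Sigma 3, Alpha 1, Alpha 3} \<Longrightarrow>
      M x \<in> carrier_mat d d \<and> N x \<in> carrier_mat d d \<and> P * M x = N x * P"
  shows "twist_invariants d N y k z \<Longrightarrow> twist_invariants d M y k z"
    and "same_image d M y k \<longleftrightarrow> same_image d N y k"
proof -
  obtain Q where Pc: "P \<in> carrier_mat d d" and Q: "Q \<in> carrier_mat d d" "P * Q = 1\<^sub>m d"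
    using P by (auto simp: GL_iff)
  have PQ: "P *\<^sub>v (Q *\<^sub>v v) = v" if "v \<in> carrier_vec d" for v
    using assoc_mult_mat_vec[OF Pc Q(1) that] Q(2) that by simp
  have Qc: "Q *\<^sub>v v \<in> carrier_vec d" if "v \<in> carrier_vec d" for v
    using mult_mat_vec_carrier[OF Q(1) that] .
  have Pv: "P *\<^sub>v v \<in> carrier_vec d" if "v \<in> carrier_vec d" for v
    using mult_mat_vec_carrier[OF Pc that] .
  have Mc: "M x *\<^sub>v v \<in> carrier_vec d" if "x \<in> {Sigma 1, Sigma 3, Alpha 1, Alpha 3}" "v \<in> carrier_vec d" for x v
    using mult_mat_vec_carrier[of "M x" d d v] M[OF that(1)] that(2) by blast
  have PM: "P *\<^sub>v (M x *\<^sub>v v) = N x *\<^sub>v (P *\<^sub>v v)"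
    if "x \<in> {Sigma 1, Sigma 3, Alpha 1, Alpha 3}" "v \<in> carrier_vec d" for x v
    using assoc_mult_mat_vec[OF Pc _ that(2), of "M x"] assoc_mult_mat_vec[OF _ Pc that(2), of "N x" d]
      M[OF that(1)] by simp
  have Padd: "P *\<^sub>v (v + w) = P *\<^sub>v v + P *\<^sub>v w" if "v \<in> carrier_vec d" "w \<in> carrier_vec d" for v w
    using mult_add_distrib_mat_vec[OF Pc that] .
  have Psm: "P *\<^sub>v (c \<cdot>\<^sub>v v) = c \<cdot>\<^sub>v (P *\<^sub>v v)" if "v \<in> carrier_vec d" for c v
    using mult_mat_vec[OF Pc that] .
  have eq: "v = w \<longleftrightarrow> P *\<^sub>v v = P *\<^sub>v w" if "v \<in> carrier_vec d" "w \<in> carrier_vec d" for v w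
    using mat_GL_cancel[OF P that] by blast
  have all: "(\<forall>w\<in>carrier_vec d. R (P *\<^sub>v w)) \<longleftrightarrow> (\<forall>w\<in>carrier_vec d. R w)" for R
    using PQ Pv Qc by metis
  have ex: "(\<exists>w\<in>carrier_vec d. R (P *\<^sub>v w)) \<longleftrightarrow> (\<exists>w\<in>carrier_vec d. R w)" for R
    using PQ Pv Qc by metis
  have P0: "P *\<^sub>v 0\<^sub>v d = 0\<^sub>v d" using Pc by (intro eq_vecI) auto
  have c0: "0\<^sub>v d \<in> carrier_vec d" by simp
  note push = eq Padd Psm PM Mc P0
  show "twist_invariants d M y k z" if N: "twist_invariants d N y k z"
  proof -
    have "twist_invariants d M y k z \<longleftrightarrow>
     (\<forall>w\<in>carrier_vec d. N (Sigma 1) *\<^sub>v (N (Sigma 3) *\<^sub>v (P *\<^sub>v w)) + (y * y) \<cdot>\<^sub>v (P *\<^sub>v w)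
      = y \<cdot>\<^sub>v (N (Sigma 1) *\<^sub>v (P *\<^sub>v w)) + y \<cdot>\<^sub>v (N (Sigma 3) *\<^sub>v (P *\<^sub>v w))) \<and>
    (\<forall>w\<in>carrier_vec d. N (Alpha 1) *\<^sub>v (N (Alpha 3) *\<^sub>v (P *\<^sub>v w)) + (k * k) \<cdot>\<^sub>v (P *\<^sub>v w)
      = k \<cdot>\<^sub>v (N (Alpha 1) *\<^sub>v (P *\<^sub>v w)) + k \<cdot>\<^sub>v (N (Alpha 3) *\<^sub>v (P *\<^sub>v w))) \<and>
    (\<exists>v\<in>carrier_vec d. (P *\<^sub>v v) \<noteq> 0\<^sub>v d \<and> N (Sigma 1) *\<^sub>v (P *\<^sub>v v) = y \<cdot>\<^sub>v (P *\<^sub>v v) \<and>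
      N (Sigma 3) *\<^sub>v (P *\<^sub>v v) = y \<cdot>\<^sub>v (P *\<^sub>v v) \<and>
      N (Alpha 1) *\<^sub>v (P *\<^sub>v v) = k \<cdot>\<^sub>v (P *\<^sub>v v) \<and> N (Alpha 3) *\<^sub>v (P *\<^sub>v v) = k \<cdot>\<^sub>v (P *\<^sub>v v)) \<and>
    (\<forall>w\<in>carrier_vec d. N (Sigma 1) *\<^sub>v (N (Sigma 1) *\<^sub>v (P *\<^sub>v w))
      = (y * (1 - z)) \<cdot>\<^sub>v (N (Sigma 1) *\<^sub>v (P *\<^sub>v w)) + (y * y * z) \<cdot>\<^sub>v (P *\<^sub>v w)) \<and>
    (\<exists>w\<in>carrier_vec d. N (Sigma 1) *\<^sub>v (P *\<^sub>v w) \<noteq> y \<cdot>\<^sub>v (P *\<^sub>v w))"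
      unfolding twist_invariants_def
      by (intro arg_cong2[where f = "(\<and>)"] ball_cong bex_cong HOL.refl arg_cong[where f = Not])
         (simp_all add: push)
    also have "\<dots> \<longleftrightarrow> twist_invariants d N y k z"
      unfolding twist_invariants_def
      by (intro arg_cong2[where f = "(\<and>)"] all ex)
    finally show ?thesis using N by blast
  qed
  have "same_image d M y k \<longleftrightarrow> (\<forall>w\<in>carrier_vec d.
    N (Alpha 1) *\<^sub>v (N (Sigma 1) *\<^sub>v (P *\<^sub>v w)) + k \<cdot>\<^sub>v (N (Sigma 1) *\<^sub>v (P *\<^sub>v w))
      = y \<cdot>\<^sub>v (N (Alpha 1) *\<^sub>v (P *\<^sub>v w)) + (k * y) \<cdot>\<^sub>v (P *\<^sub>v w))"
    unfolding same_image_def by (intro ball_cong HOL.refl) (simp add: push)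
  also have "\<dots> \<longleftrightarrow> same_image d N y k" unfolding same_image_def by (rule all)
  finally show "same_image d M y k \<longleftrightarrow> same_image d N y k" .
qed

lemma tilde_invariants:
  fixes y k z :: complex
  assumes d: "6 \<le> d" "n = Suc d" and yk: "y \<noteq> 0"
  defines "N \<equiv> \<lambda>x. X_gen y k x \<cdot>\<^sub>m beta_tilde_gen n z x"
  shows "twist_invariants d N y k z" "same_image d N y k"
proof -
  have gens: "beta_tilde_gen n z (Sigma i) = row_mat d i z (- z) 1"
    "beta_tilde_gen n z (Alpha i) = row_mat d i 1 (- 1) 1" if "1 \<le> i" "i \<le> d" for i
    using beta_tilde_gen_row_mat[of n i z] that d by simp_all
  have N: "N (Sigma i) \<in> carrier_mat d d" "N (Alpha i) \<in> carrier_mat d d" if "1 \<le> i" "i \<le> d" for i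
    using gens[OF that] by (simp_all add: N_def)
  have Nv: "N (Sigma i) *\<^sub>v w \<in> carrier_vec d" "N (Alpha i) *\<^sub>v w \<in> carrier_vec d"
    if "1 \<le> i" "i \<le> d" "w \<in> carrier_vec d" for i w
    using mult_mat_vec_carrier[OF N(1)[OF that(1,2)] that(3)] mult_mat_vec_carrier[OF N(2)[OF that(1,2)] that(3)]
    by auto
  have act: "to_fun d (N (Sigma i) *\<^sub>v w) j = y * row_op i z (- z) 1 (to_fun d w) j"
    "to_fun d (N (Alpha i) *\<^sub>v w) j = k * row_op i 1 (- 1) 1 (to_fun d w) j"
    if "1 \<le> i" "i \<le> d" "w \<in> carrier_vec d" for i w j
    using gens[OF that(1,2)] row_mat_mult_vec[OF that(3,1,2)] that(3)
    by (simp_all add: N_def smult_mat_vec[of _ d] to_fun_smult mult_mat_vec_carrier[of _ d d])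
  have 3: "3 \<le> d" "Suc 0 \<le> d" using d by auto
  note simps = act Nv to_fun_add to_fun_smult row_op_apply 3
  define v where "v = of_fun d (\<lambda>j. if j = 6 then 1 else 0)"
  have v: "v \<in> carrier_vec d" "to_fun d v = (\<lambda>j. if j = 6 then 1 else 0)"
    using d unfolding v_def by (auto intro!: to_fun_of_fun simp: fun_space_def)
  have "v \<noteq> 0\<^sub>v d"
  proof
    assume "v = 0\<^sub>v d"
    then show False using fun_cong[OF v(2), of 6] d by (simp add: to_fun_def)
  qed
  define u where "u = of_fun d (\<lambda>j. if j = 2 then 1 else 0)"
  have u: "u \<in> carrier_vec d" "to_fun d u = (\<lambda>j. if j = 2 then 1 else 0)"
    using d unfolding u_def by (auto intro!: to_fun_of_fun simp: fun_space_def)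
  have "N (Sigma 1) *\<^sub>v u \<noteq> y \<cdot>\<^sub>v u"
  proof
    assume "N (Sigma 1) *\<^sub>v u = y \<cdot>\<^sub>v u"
    then have "to_fun d (N (Sigma 1) *\<^sub>v u) 1 = to_fun d (y \<cdot>\<^sub>v u) 1" by simp
    then show False using yk u by (simp add: act 3 to_fun_smult row_op_apply numeral_2_eq_2)
  qed
  moreover have "N (Sigma 1) *\<^sub>v v = y \<cdot>\<^sub>v v" "N (Sigma 3) *\<^sub>v v = y \<cdot>\<^sub>v v"
    "N (Alpha 1) *\<^sub>v v = k \<cdot>\<^sub>v v" "N (Alpha 3) *\<^sub>v v = k \<cdot>\<^sub>v v"
    using v(1) 3 by (auto intro!: to_fun_inject[of _ d] ext simp: simps v(2))
  moreover have "N (Sigma 1) *\<^sub>v (N (Sigma 3) *\<^sub>v w) + (y * y) \<cdot>\<^sub>v w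
      = y \<cdot>\<^sub>v (N (Sigma 1) *\<^sub>v w) + y \<cdot>\<^sub>v (N (Sigma 3) *\<^sub>v w)"
    "N (Alpha 1) *\<^sub>v (N (Alpha 3) *\<^sub>v w) + (k * k) \<cdot>\<^sub>v w
      = k \<cdot>\<^sub>v (N (Alpha 1) *\<^sub>v w) + k \<cdot>\<^sub>v (N (Alpha 3) *\<^sub>v w)"
    "N (Sigma 1) *\<^sub>v (N (Sigma 1) *\<^sub>v w) = (y * (1 - z)) \<cdot>\<^sub>v (N (Sigma 1) *\<^sub>v w) + (y * y * z) \<cdot>\<^sub>v w"
    if w: "w \<in> carrier_vec d" for w
    using w by (auto intro!: to_fun_inject[of _ d] ext simp: simps algebra_simps)
  ultimately show "twist_invariants d N y k z"
    unfolding twist_invariants_def using v(1) \<open>v \<noteq> 0\<^sub>v d\<close> u(1) by blast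
  show "same_image d N y k"
    unfolding same_image_def by (auto intro!: to_fun_inject[of _ d] ext simp: simps algebra_simps)
qed

lemma hat_invariants:
  fixes y k z :: complex
  assumes d: "6 \<le> d" "n = Suc d" and yk: "y \<noteq> 0" "k \<noteq> 0" and z: "z \<noteq> 0"
  defines "N \<equiv> \<lambda>x. X_gen y k x \<cdot>\<^sub>m beta_hat_gen n z x"
  shows "twist_invariants d N y k z" "z \<noteq> 1 \<Longrightarrow> \<not> same_image d N y k"
proof -
  have gens: "beta_hat_gen n z (Sigma i) = transpose_mat (row_mat d i z (- z) 1)"
    "beta_hat_gen n z (Alpha i) = transpose_mat (row_mat d i z (- 1) (1 / z))" if "1 \<le> i" "i \<le> d" for i
    using beta_hat_gen_row_mat[of n i z] that d by simp_all
  have N: "N (Sigma i) \<in> carrier_mat d d" "N (Alpha i) \<in> carrier_mat d d" if "1 \<le> i" "i \<le> d" for i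
    using gens[OF that] by (simp_all add: N_def)
  have Nv: "N (Sigma i) *\<^sub>v w \<in> carrier_vec d" "N (Alpha i) *\<^sub>v w \<in> carrier_vec d"
    if "1 \<le> i" "i \<le> d" "w \<in> carrier_vec d" for i w
    using mult_mat_vec_carrier[OF N(1)[OF that(1,2)] that(3)] mult_mat_vec_carrier[OF N(2)[OF that(1,2)] that(3)]
    by auto
  have act: "to_fun d (N (Sigma i) *\<^sub>v w) j = y * col_op d i z (- z) 1 (to_fun d w) j"
    "to_fun d (N (Alpha i) *\<^sub>v w) j = k * col_op d i z (- 1) (1 / z) (to_fun d w) j"
    if "1 \<le> i" "i \<le> d" "w \<in> carrier_vec d" for i w j
    using gens[OF that(1,2)] transpose_row_mat_mult_vec[OF that(3,1,2)] that(3)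
    by (simp_all add: N_def smult_mat_vec[of _ d] to_fun_smult mult_mat_vec_carrier[of _ d d])
  have 3: "3 \<le> d" "Suc 0 \<le> d" using d by auto
  have out: "to_fun d w j = 0" if "j = 0 \<or> d < j" for w j using that by (auto simp: to_fun_def)
  note simps = act Nv to_fun_add to_fun_smult col_op_def 3 out
  define v where "v = of_fun d (\<lambda>j. if j = 6 then 1 else 0)"
  have v: "v \<in> carrier_vec d" "to_fun d v = (\<lambda>j. if j = 6 then 1 else 0)"
    using d unfolding v_def by (auto intro!: to_fun_of_fun simp: fun_space_def)
  have "v \<noteq> 0\<^sub>v d"
  proof
    assume "v = 0\<^sub>v d"
    then show False using fun_cong[OF v(2), of 6] d by (simp add: to_fun_def)
  qed
  define u where "u = of_fun d (\<lambda>j. if j = 1 then 1 else 0)"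
  have u: "u \<in> carrier_vec d" "to_fun d u = (\<lambda>j. if j = 1 then 1 else 0)"
    using d unfolding u_def by (auto intro!: to_fun_of_fun simp: fun_space_def)
  have "N (Sigma 1) *\<^sub>v u \<noteq> y \<cdot>\<^sub>v u"
  proof
    assume "N (Sigma 1) *\<^sub>v u = y \<cdot>\<^sub>v u"
    then have "to_fun d (N (Sigma 1) *\<^sub>v u) 2 = to_fun d (y \<cdot>\<^sub>v u) 2" by simp
    then show False using yk u d by (simp add: act 3 to_fun_smult col_op_def)
  qed
  moreover have "N (Sigma 1) *\<^sub>v v = y \<cdot>\<^sub>v v" "N (Sigma 3) *\<^sub>v v = y \<cdot>\<^sub>v v"
    "N (Alpha 1) *\<^sub>v v = k \<cdot>\<^sub>v v" "N (Alpha 3) *\<^sub>v v = k \<cdot>\<^sub>v v"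
    using v(1) 3 d by (auto intro!: to_fun_inject[of _ d] ext simp: simps v(2))
  moreover have "N (Sigma 1) *\<^sub>v (N (Sigma 3) *\<^sub>v w) + (y * y) \<cdot>\<^sub>v w
      = y \<cdot>\<^sub>v (N (Sigma 1) *\<^sub>v w) + y \<cdot>\<^sub>v (N (Sigma 3) *\<^sub>v w)"
    "N (Alpha 1) *\<^sub>v (N (Alpha 3) *\<^sub>v w) + (k * k) \<cdot>\<^sub>v w
      = k \<cdot>\<^sub>v (N (Alpha 1) *\<^sub>v w) + k \<cdot>\<^sub>v (N (Alpha 3) *\<^sub>v w)"
    "N (Sigma 1) *\<^sub>v (N (Sigma 1) *\<^sub>v w) = (y * (1 - z)) \<cdot>\<^sub>v (N (Sigma 1) *\<^sub>v w) + (y * y * z) \<cdot>\<^sub>v w"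
    if w: "w \<in> carrier_vec d" for w
    using w by (auto intro!: to_fun_inject[of _ d] ext simp: simps algebra_simps)
  ultimately show "twist_invariants d N y k z"
    unfolding twist_invariants_def using v(1) \<open>v \<noteq> 0\<^sub>v d\<close> u(1) by blast
  show "\<not> same_image d N y k" if "z \<noteq> 1"
  proof
    assume "same_image d N y k"
    then have "N (Alpha 1) *\<^sub>v (N (Sigma 1) *\<^sub>v u) + k \<cdot>\<^sub>v (N (Sigma 1) *\<^sub>v u)
      = y \<cdot>\<^sub>v (N (Alpha 1) *\<^sub>v u) + (k * y) \<cdot>\<^sub>v u" using u(1) unfolding same_image_def by blast
    then have "to_fun d (N (Alpha 1) *\<^sub>v (N (Sigma 1) *\<^sub>v u) + k \<cdot>\<^sub>v (N (Sigma 1) *\<^sub>v u)) 2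
      = to_fun d (y \<cdot>\<^sub>v (N (Alpha 1) *\<^sub>v u) + (k * y) \<cdot>\<^sub>v u) 2" by simp
    then have "k * y = y * (k * (1 / z))"
      using u z d by (simp add: act Nv to_fun_add to_fun_smult col_op_def 3)
    then show False using yk z that by (simp add: field_simps)
  qed
qed

section \<open>From matrices to operators and back\<close>

interpretation complex_funs: char_0_space "\<lambda>(c :: complex) (f :: nat \<Rightarrow> complex) i. c * f i"
  by unfold_locales (auto simp: fun_eq_iff algebra_simps)

definition act :: "nat \<Rightarrow> complex mat \<Rightarrow> (nat \<Rightarrow> complex) \<Rightarrow> nat \<Rightarrow> complex" where
  "act d M c = to_fun d (M *\<^sub>v of_fun d c)"

lemma act_hom:
  assumes M: "M \<in> carrier_mat d d"
  shows "Modules.module_hom (\<lambda>c f i. c * f i) (\<lambda>c f i. c * f i) (act d M)"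
proof unfold_locales
  fix b1 b2 :: "nat \<Rightarrow> complex" and r :: complex
  have "of_fun d (b1 + b2) = of_fun d b1 + of_fun d b2" by (auto simp: of_fun_def)
  then show "act d M (b1 + b2) = act d M b1 + act d M b2"
    using M by (auto simp: act_def mult_add_distrib_mat_vec[of _ d d] to_fun_add fun_eq_iff
      mult_mat_vec_carrier[of _ d d])
  have "of_fun d (\<lambda>i. r * b1 i) = r \<cdot>\<^sub>v of_fun d b1" by (auto simp: of_fun_def)
  then show "act d M (\<lambda>i. r * b1 i) = (\<lambda>i. r * act d M b1 i)"
    using M by (auto simp: act_def mult_mat_vec[of _ d d] to_fun_smult fun_eq_iff
      mult_mat_vec_carrier[of _ d d])
qed

lemma act_in_fun_space: "act d M c \<in> fun_space d"
  unfolding act_def by (rule to_fun_in_fun_space)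

lemma act_mult:
  assumes "A \<in> carrier_mat d d" "B \<in> carrier_mat d d"
  shows "act d (A * B) c = act d A (act d B c)"
proof -
  have "B *\<^sub>v of_fun d c \<in> carrier_vec d" using assms by (intro mult_mat_vec_carrier) auto
  then show ?thesis
    using assms by (simp add: act_def of_fun_to_fun assoc_mult_mat_vec[of _ d d _ d])
qed

lemma act_one: "c \<in> fun_space d \<Longrightarrow> act d (1\<^sub>m d) c = c"
  by (simp add: act_def to_fun_of_fun)

lemma act_eq_0:
  assumes A: "A \<in> carrier (GL d)" and c: "c \<in> fun_space d" "act d A c = 0"
  shows "c = 0"
proof -
  have A': "A \<in> carrier_mat d d" using A by (simp add: GL_iff)
  have A0: "A *\<^sub>v 0\<^sub>v d = 0\<^sub>v d" using A' by (intro eq_vecI) auto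
  have "to_fun d (0\<^sub>v d) = 0" by (auto simp: to_fun_def fun_eq_iff)
  then have "to_fun d (A *\<^sub>v of_fun d c) = to_fun d (A *\<^sub>v 0\<^sub>v d)"
    using c(2) by (simp add: act_def A0)
  then have "A *\<^sub>v of_fun d c = A *\<^sub>v 0\<^sub>v d"
    by (rule to_fun_inject[OF mult_mat_vec_carrier[OF A' of_fun_carrier] mult_mat_vec_carrier[OF A' zero_carrier_vec]])
  then have "of_fun d c = 0\<^sub>v d" by (rule mat_GL_cancel[OF A of_fun_carrier zero_carrier_vec])
  then have "to_fun d (of_fun d c) = 0" by (auto simp: to_fun_def fun_eq_iff)
  then show ?thesis using to_fun_of_fun[OF c(1)] by simp
qed

lemma fun_space_subspace: "complex_funs.subspace (fun_space d)"
  by (auto simp: complex_funs.subspace_def fun_space_def)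

definition delta_funs :: "nat \<Rightarrow> (nat \<Rightarrow> complex) set" where
  "delta_funs d = (\<lambda>j i. if i = j then 1 else 0) ` {1..d}"

lemma card_delta_funs: "finite (delta_funs d)" "card (delta_funs d) \<le> d"
  using card_image_le[of "{1..d}" "\<lambda>j i. if i = j then 1 else (0 :: complex)"]
  by (auto simp: delta_funs_def)

lemma sum_fun_apply: "(\<Sum>x\<in>A. f x) i = (\<Sum>x\<in>A. f x i)" for f :: "'b \<Rightarrow> nat \<Rightarrow> complex"
  by (induction A rule: infinite_finite_induct) auto

lemma fun_space_span: "fun_space d \<subseteq> complex_funs.span (delta_funs d)"
proof
  fix c assume c: "c \<in> fun_space d"
  have "c = (\<Sum>j\<in>{1..d}. (\<lambda>i. c j * (if i = j then 1 else 0)))"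
  proof
    fix i
    have "(\<Sum>j\<in>{1..d}. c j * (if i = j then 1 else 0)) = (\<Sum>j\<in>{1..d}. if i = j then c j else 0)"
      by (rule sum.cong) auto
    also have "\<dots> = (if i \<in> {1..d} then c i else 0)" by (rule sum.delta') simp
    also have "\<dots> = c i" using c by (auto simp: fun_space_def not_le Suc_le_eq)
    finally show "c i = (\<Sum>j\<in>{1..d}. (\<lambda>i. c j * (if i = j then 1 else 0))) i"
      by (simp add: sum_fun_apply)
  qed
  also have "\<dots> \<in> complex_funs.span (delta_funs d)"
    by (intro complex_funs.span_sum complex_funs.span_scale complex_funs.span_base)
       (auto simp: delta_funs_def)
  finally show "c \<in> complex_funs.span (delta_funs d)" .
qed

lemma independent_columns_GL:
  assumes q: "complex_funs.indep_family d (\<lambda>i. q (Suc i))" and qW: "\<And>j. 1 \<le> j \<Longrightarrow> j \<le> d \<Longrightarrow> q j \<in> fun_space d"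
  shows "mat d d (\<lambda>(r, c). q (Suc c) (Suc r)) \<in> carrier (GL d)"
proof -
  let ?Q = "mat d d (\<lambda>(r, c). q (Suc c) (Suc r))"
  have Q: "?Q \<in> carrier_mat d d" by simp
  have "det ?Q \<noteq> 0"
  proof
    assume "det ?Q = 0"
    then obtain v where v: "v \<in> carrier_vec d" "v \<noteq> 0\<^sub>v d" "?Q *\<^sub>v v = 0\<^sub>v d"
      using det_0_iff_vec_prod_zero[OF Q] by blast
    have "(\<Sum>c<d. (\<lambda>i. v $ c * q (Suc c) i)) = 0"
    proof
      fix i
      show "(\<Sum>c<d. (\<lambda>i. v $ c * q (Suc c) i)) i = 0 i"
      proof (cases "1 \<le> i \<and> i \<le> d")
        case True
        then obtain r where r: "i = Suc r" "r < d" by (cases i) auto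
        have "(?Q *\<^sub>v v) $ r = (\<Sum>c<d. q (Suc c) (Suc r) * v $ c)"
          using r(2) v(1) by (auto simp: scalar_prod_def atLeast0LessThan intro!: sum.cong)
        then have "(\<Sum>c<d. q (Suc c) (Suc r) * v $ c) = 0" using v(3) r(2) by simp
        then show ?thesis by (simp add: sum_fun_apply r(1) mult.commute)
      next
        case False
        then have "i = 0 \<or> d < i" by auto
        then have "q (Suc c) i = 0" if "c < d" for c
          using qW[of "Suc c"] that unfolding fun_space_def by force
        then show ?thesis by (simp add: sum_fun_apply)
      qed
    qed
    then have "v $ c = 0" if "c < d" for c
      using complex_funs.indep_familyD[OF q, of "\<lambda>c. v $ c" c] that by simp
    then have "v = 0\<^sub>v d" using v(1) by (intro eq_vecI) auto
    then show False using v(2) by simp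
  qed
  then have "?Q \<in> Units (ring_mat TYPE(complex) d ())" by (rule det_non_zero_imp_unit[OF Q])
  then show ?thesis by (simp add: GL_def units_of_carrier)
qed

lemma mat_mult_columns:
  assumes M: "M \<in> carrier_mat d d" and rc: "r < d" "c < d"
  shows "(M * mat d d (\<lambda>(r, c). q (Suc c) (Suc r))) $$ (r, c) = act d M (q (Suc c)) (Suc r)"
proof -
  let ?Q = "mat d d (\<lambda>(r, c). q (Suc c) (Suc r))"
  have "col ?Q c = of_fun d (q (Suc c))" using rc by (auto simp: of_fun_def)
  then show ?thesis using M rc by (simp add: act_def to_fun_def)
qed

lemma columns_mult_row_mat:
  assumes i: "1 \<le> i" "i \<le> d" and rc: "r < d" "c < d"
  shows "(mat d d (\<lambda>(r, c). q (Suc c) (Suc r)) * row_mat d i l m u) $$ (r, c)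
    = q (Suc c) (Suc r) + (if Suc c = i then m - 1 else if Suc (Suc c) = i then l
        else if Suc c = Suc i then u else 0) * q i (Suc r)"
proof -
  obtain p where p: "i = Suc p" "p < d" using i by (cases i) auto
  define e where "e = (if Suc c = i then m - 1 else if Suc (Suc c) = i then l
        else if Suc c = Suc i then u else 0)"
  have "(mat d d (\<lambda>(r, c). q (Suc c) (Suc r)) * row_mat d i l m u) $$ (r, c)
      = (\<Sum>t<d. q (Suc t) (Suc r) * row_mat d i l m u $$ (t, c))"
    using rc by (auto simp: row_mat_def scalar_prod_def atLeast0LessThan intro!: sum.cong)
  also have "\<dots> = (\<Sum>t<d. (if t = c then q (Suc t) (Suc r) else 0) + (if t = p then e * q i (Suc r) else 0))"
    using rc p by (intro sum.cong) (auto simp: row_mat_def e_def algebra_simps)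
  also have "\<dots> = q (Suc c) (Suc r) + e * q i (Suc r)" using rc p by (simp add: sum.distrib)
  finally show ?thesis by (simp add: e_def)
qed

lemma columns_mult_transpose_row_mat:
  assumes i: "1 \<le> i" "i \<le> d" and rc: "r < d" "c < d" and q: "q 0 = 0" "q (Suc d) = 0"
  shows "(mat d d (\<lambda>(r, c). q (Suc c) (Suc r)) * transpose_mat (row_mat d i l m u)) $$ (r, c)
    = (if Suc c = i then l * q (i - 1) (Suc r) + m * q i (Suc r) + u * q (Suc i) (Suc r)
       else q (Suc c) (Suc r))"
proof -
  define v where "v = vec d (\<lambda>t. q (Suc t) (Suc r))"
  have v: "v \<in> carrier_vec d" by (simp add: v_def)
  have tv: "to_fun d v j = q j (Suc r)" if "j \<le> Suc d" for j
    using that q by (cases j) (auto simp: to_fun_def v_def le_Suc_eq)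
  have "(mat d d (\<lambda>(r, c). q (Suc c) (Suc r)) * transpose_mat (row_mat d i l m u)) $$ (r, c)
      = to_fun d (row_mat d i l m u *\<^sub>v v) (Suc c)"
    using rc by (auto simp: row_mat_def scalar_prod_def to_fun_def v_def intro!: sum.cong)
  also have "\<dots> = row_op i l m u (to_fun d v) (Suc c)" by (simp add: row_mat_mult_vec[OF v i])
  finally show ?thesis using rc i by (simp add: row_op_apply tv)
qed

section \<open>Classification\<close>

text \<open>The sequence of geometric sums \<open>1 + z + \<dots> + z\<^sup>j\<^sup>-\<^sup>1\<close> is fixed by all row operations of the
  generators \<open>\<sigma>\<close>.  Cut off at the length \<open>d\<close> it remains fixed if the next sum is zero, because the
  last row operation refers to that entry.\<close>

lemma geometric_vector_fixed:
  assumes sum: "(\<Sum>i<Suc d. z ^ i) = 0" and d: "1 \<le> d"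
  shows "\<exists>v\<in>carrier_vec d. v \<noteq> 0\<^sub>v d \<and> (\<forall>i. 1 \<le> i \<longrightarrow> i \<le> d \<longrightarrow> row_mat d i z (- z) 1 *\<^sub>v v = v)"
proof -
  define c where "c j = (if j \<le> d then \<Sum>i<j. z ^ i else 0)" for j
  have c: "c \<in> fun_space d" by (auto simp: c_def fun_space_def)
  have v: "of_fun d c \<in> carrier_vec d" by simp
  have "of_fun d c \<noteq> 0\<^sub>v d"
  proof
    assume "of_fun d c = 0\<^sub>v d"
    then have "of_fun d c $ 0 = 0\<^sub>v d $ 0" by simp
    then show False using d by (simp add: of_fun_def c_def)
  qed
  moreover have "row_mat d i z (- z) 1 *\<^sub>v of_fun d c = of_fun d c" if i: "1 \<le> i" "i \<le> d" for i
  proof -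
    obtain k where k: "i = Suc k" using i by (cases i) auto
    have c': "c j = (\<Sum>i<j. z ^ i)" if "j \<le> Suc d" for j
      using that sum by (auto simp: c_def le_Suc_eq)
    have "row_op i z (- z) 1 c = c"
    proof
      fix j
      have "c k = (\<Sum>i<k. z ^ i)" "c (Suc k) = (\<Sum>i<k. z ^ i) + z ^ k"
        "c (Suc (Suc k)) = (\<Sum>i<k. z ^ i) + z ^ k + z * z ^ k"
        using c'[of k] c'[of "Suc k"] c'[of "Suc (Suc k)"] i(2) k by simp_all
      moreover have "z * (\<Sum>i<k. z ^ i) + 1 = (\<Sum>i<k. z ^ i) + z ^ k"
        by (induction k) (simp_all add: algebra_simps)
      ultimately show "row_op i z (- z) 1 c j = c j"
        by (simp add: row_op_apply k algebra_simps)
    qed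
    then show "row_mat d i z (- z) 1 *\<^sub>v of_fun d c = of_fun d c"
      by (intro to_fun_inject[OF mult_mat_vec_carrier[OF row_mat_carrier v] v])
         (simp add: row_mat_mult_vec[OF v i] to_fun_of_fun[OF c])
  qed
  ultimately show ?thesis using v by blast
qed

text \<open>The fixed vector is a common eigenvector for the first model.  The second model consists of
  transposes, so there the vector gives a linear form that is multiplied by \<open>y\<close> under every \<open>\<sigma>\<close>.\<close>

lemma geometric_sum_nonzero:
  assumes \<rho>: "representation (WB n) d \<rho>" and irr: "irreducible_rep (braid n) d \<rho>"
    and d: "2 \<le> d" "n = Suc d" and yz: "y \<noteq> 0" "z \<noteq> 0" and P: "P \<in> carrier (GL d)"
    and B: "B = beta_tilde_gen n z \<or> B = beta_hat_gen n z"
    and n: "4 \<le> n"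
    and eq: "\<And>x. x \<in> wb_gens n \<Longrightarrow> P * \<rho> (wb_gen_class n x) = (X_gen y k x \<cdot>\<^sub>m B x) * P"
  shows "(\<Sum>i<n. z ^ i) \<noteq> 0"
proof
  assume "(\<Sum>i<n. z ^ i) = 0"
  then have "(\<Sum>i<Suc d. z ^ i) = 0" by (simp only: d(2))
  moreover have "1 \<le> d" using d by simp
  ultimately obtain v where v: "v \<in> carrier_vec d" "v \<noteq> 0\<^sub>v d"
    "\<And>i. 1 \<le> i \<Longrightarrow> i \<le> d \<Longrightarrow> row_mat d i z (- z) 1 *\<^sub>v v = v"
    using geometric_vector_fixed by blast
  obtain Q where Pc: "P \<in> carrier_mat d d" and Q: "Q \<in> carrier_mat d d" "P * Q = 1\<^sub>m d" "Q * P = 1\<^sub>m d"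
    using P by (auto simp: GL_iff)
  have nd: "n - 1 = d" using d by simp
  have M: "\<rho> (wb_gen_class n (Sigma i)) \<in> carrier_mat d d" if "1 \<le> i" "i < n" for i
    using hom_in_carrier[of \<rho> "WB n" "GL d"] pres_gen_closed[of "Sigma i" "wb_gens n" "wb_rels n"] \<rho> that
    by (simp add: representation_def WB_def GL_iff)
  have Bc: "B (Sigma i) \<in> carrier_mat d d" if "1 \<le> i" "i < n" for i
    using beta_gen_GL[of n z "Sigma i", unfolded nd] that n yz B by (auto simp: GL_iff)
  have PM: "P *\<^sub>v (\<rho> (wb_gen_class n (Sigma i)) *\<^sub>v w) = y \<cdot>\<^sub>v (B (Sigma i) *\<^sub>v (P *\<^sub>v w))"
    if i: "1 \<le> i" "i < n" and w: "w \<in> carrier_vec d" for i w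
  proof -
    have "P *\<^sub>v (\<rho> (wb_gen_class n (Sigma i)) *\<^sub>v w) = (P * \<rho> (wb_gen_class n (Sigma i))) *\<^sub>v w"
      by (rule assoc_mult_mat_vec[OF Pc M[OF i] w, symmetric])
    also have "\<dots> = ((y \<cdot>\<^sub>m B (Sigma i)) * P) *\<^sub>v w" using eq[of "Sigma i"] i by simp
    also have "\<dots> = (y \<cdot>\<^sub>m B (Sigma i)) *\<^sub>v (P *\<^sub>v w)"
      by (rule assoc_mult_mat_vec[OF smult_carrier_mat[OF Bc[OF i]] Pc w])
    also have "\<dots> = y \<cdot>\<^sub>v (B (Sigma i) *\<^sub>v (P *\<^sub>v w))"
      by (rule smult_mat_vec[OF Bc[OF i]]) (rule mult_mat_vec_carrier[OF Pc w])
    finally show ?thesis .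
  qed
  show False
  proof (cases "B = beta_tilde_gen n z")
    case True
    define w where "w = Q *\<^sub>v v"
    have w: "w \<in> carrier_vec d" unfolding w_def by (rule mult_mat_vec_carrier[OF Q(1) v(1)])
    have Pw: "P *\<^sub>v w = v"
      unfolding w_def using assoc_mult_mat_vec[OF Pc Q(1) v(1)] Q(2) v(1) by simp
    show False
    proof (rule braid_no_common_eigenvector[OF \<rho> irr d(1) w _ yz(1)])
      show "w \<noteq> 0\<^sub>v d"
      proof
        assume "w = 0\<^sub>v d"
        then have "v = 0\<^sub>v d" using Pw Pc by (intro eq_vecI) auto
        then show False using v(2) by simp
      qed
      fix i assume i: "1 \<le> i" "i < n"
      have "B (Sigma i) *\<^sub>v v = v"
        using beta_tilde_gen_row_mat(1)[OF n i] v(3)[of i] i d by (simp add: True)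
      then have "P *\<^sub>v (\<rho> (wb_gen_class n (Sigma i)) *\<^sub>v w) = P *\<^sub>v (y \<cdot>\<^sub>v w)"
        using PM[OF i w] mult_mat_vec[OF Pc w, of y] by (simp add: Pw)
      then show "\<rho> (wb_gen_class n (Sigma i)) *\<^sub>v w = y \<cdot>\<^sub>v w"
        by (rule mat_GL_cancel[OF P, rotated 2]) (use mult_mat_vec_carrier[OF M[OF i] w] w in auto)
    qed
  next
    case False
    then have Bh: "B = beta_hat_gen n z" using B by blast
    define u where "u = transpose_mat P *\<^sub>v v"
    have u: "u \<in> carrier_vec d" unfolding u_def using Pc v(1) by (intro mult_mat_vec_carrier) auto
    have uw: "u \<bullet> w = v \<bullet> (P *\<^sub>v w)" if "w \<in> carrier_vec d" for w
      unfolding u_def using transpose_vec_mult_scalar[OF Pc that v(1)] .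
    show False
    proof (rule braid_no_common_eigenform[OF \<rho> irr d(1) u _ yz(1)])
      show "u \<noteq> 0\<^sub>v d"
      proof
        assume "u = 0\<^sub>v d"
        then have "transpose_mat P *\<^sub>v v = transpose_mat P *\<^sub>v 0\<^sub>v d"
          unfolding u_def using Pc by (intro eq_vecI) auto
        then have "v = 0\<^sub>v d" by (rule mat_GL_cancel[OF transpose_GL[OF P] v(1) zero_carrier_vec])
        then show False using v(2) by simp
      qed
      fix i and w :: "complex vec" assume i: "1 \<le> i" "i < n" and w: "w \<in> carrier_vec d"
      have Pw: "P *\<^sub>v w \<in> carrier_vec d" by (rule mult_mat_vec_carrier[OF Pc w])
      have "u \<bullet> (\<rho> (wb_gen_class n (Sigma i)) *\<^sub>v w) = v \<bullet> (y \<cdot>\<^sub>v (B (Sigma i) *\<^sub>v (P *\<^sub>v w)))"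
        using uw[OF mult_mat_vec_carrier[OF M[OF i] w]] PM[OF i w] by simp
      also have "\<dots> = y * (v \<bullet> (B (Sigma i) *\<^sub>v (P *\<^sub>v w)))"
        by (rule scalar_prod_smult_distrib[OF v(1) mult_mat_vec_carrier[OF Bc[OF i] Pw]])
      also have "v \<bullet> (B (Sigma i) *\<^sub>v (P *\<^sub>v w)) = (transpose_mat (B (Sigma i)) *\<^sub>v v) \<bullet> (P *\<^sub>v w)"
        by (rule transpose_vec_mult_scalar[OF Bc[OF i] Pw v(1), symmetric])
      also have "transpose_mat (B (Sigma i)) *\<^sub>v v = v"
        using beta_hat_gen_row_mat(1)[OF n i] v(3)[of i] i d by (simp add: Bh)
      finally show "u \<bullet> (\<rho> (wb_gen_class n (Sigma i)) *\<^sub>v w) = y * (u \<bullet> w)"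
        using uw[OF w] by simp
    qed
  qed
qed

text \<open>If \<open>q\<close> is a basis in which the operators \<open>M x\<close> have the matrices \<open>\<chi> x B x\<close>, the inverse of the
  matrix with the columns \<open>q\<close> is an equivalence.\<close>

lemma equivalence_from_basis:
  fixes q :: "nat \<Rightarrow> nat \<Rightarrow> complex" and d :: nat
  defines "Q \<equiv> mat d d (\<lambda>(r, c). q (Suc c) (Suc r))"
  assumes Q: "Q \<in> carrier (GL d)"
    and M: "\<And>x. x \<in> S \<Longrightarrow> M x \<in> carrier_mat d d" and B: "\<And>x. x \<in> S \<Longrightarrow> B x \<in> carrier_mat d d"
    and eq: "\<And>x r c. x \<in> S \<Longrightarrow> r < d \<Longrightarrow> c < d \<Longrightarrow>
      act d (M x) (q (Suc c)) (Suc r) = \<chi> x * (Q * B x) $$ (r, c)"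
  shows "\<exists>P\<in>carrier (GL d). \<forall>x\<in>S. P * M x = (\<chi> x \<cdot>\<^sub>m B x) * P"
proof -
  let ?Q = "Q"
  obtain P where Qc: "?Q \<in> carrier_mat d d" and P: "P \<in> carrier_mat d d" "P * ?Q = 1\<^sub>m d" "?Q * P = 1\<^sub>m d"
    using Q by (auto simp: GL_iff)
  have "P \<in> carrier (GL d)" using P Qc by (auto simp: GL_iff)
  moreover have "P * M x = (\<chi> x \<cdot>\<^sub>m B x) * P" if x: "x \<in> S" for x
  proof -
    let ?B = "\<chi> x \<cdot>\<^sub>m B x"
    have c: "M x \<in> carrier_mat d d" "?B \<in> carrier_mat d d" using M[OF x] B[OF x] by auto
    have MQ: "M x * ?Q = ?Q * ?B"
    proof (rule eq_matI)
      fix r c assume "r < dim_row (?Q * ?B)" "c < dim_col (?Q * ?B)"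
      then have rc: "r < d" "c < d" using B[OF x] Qc by auto
      have "?Q * ?B = \<chi> x \<cdot>\<^sub>m (?Q * B x)" by (rule mult_smult_distrib[OF Qc B[OF x]])
      then show "(M x * ?Q) $$ (r, c) = (?Q * ?B) $$ (r, c)"
        using mat_mult_columns[OF M[OF x] rc, of q] eq[OF x rc] B[OF x] Qc rc by (simp add: Q_def)
    qed (use M[OF x] B[OF x] Qc in auto)
    have "P * M x = P * M x * (?Q * P)" using c P by simp
    also have "\<dots> = P * (M x * ?Q) * P"
      using c P(1) Qc by (simp add: assoc_mult_mat[of _ d d _ d _ d])
    also have "\<dots> = (P * ?Q) * ?B * P"
      unfolding MQ using c P(1) Qc by (simp add: assoc_mult_mat[of _ d d _ d _ d])
    also have "\<dots> = ?B * P" unfolding P(2) left_mult_one_mat[OF c(2)] ..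
    finally show ?thesis .
  qed
  ultimately show ?thesis by blast
qed

lemma braid_generators_not_all_equal:
  assumes \<rho>: "representation (WB n) d \<rho>" and irr: "irreducible_rep (braid n) d \<rho>"
    and d: "2 \<le> d" "2 \<le> n"
    and eq: "\<And>i. 1 \<le> i \<Longrightarrow> i < n \<Longrightarrow> \<rho> (wb_gen_class n (Sigma i)) = \<rho> (wb_gen_class n (Sigma 1))"
  shows False
proof -
  define S where "S = \<rho> (wb_gen_class n (Sigma 1))"
  have GL: "S \<in> carrier (GL d)"
    using hom_in_carrier[of \<rho> "WB n" "GL d"] pres_gen_closed[of "Sigma 1" "wb_gens n" "wb_rels n"] \<rho> d
    by (simp add: S_def representation_def WB_def)
  then have Sc: "S \<in> carrier_mat d d" by (simp add: GL_iff)
  obtain e where "eigenvalue S e"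
    using spectrum_non_empty[OF Sc] d by (auto simp: spectrum_def)
  then obtain v where v: "v \<in> carrier_vec d" "v \<noteq> 0\<^sub>v d" "S *\<^sub>v v = e \<cdot>\<^sub>v v"
    using Sc by (auto simp: eigenvalue_def eigenvector_def)
  have "e \<noteq> 0"
  proof
    assume "e = 0"
    then have "S *\<^sub>v v = S *\<^sub>v 0\<^sub>v d" using v Sc by (intro eq_vecI) auto
    then have "v = 0\<^sub>v d" by (rule mat_GL_cancel[OF GL v(1) zero_carrier_vec])
    then show False using v(2) by simp
  qed
  then show False
    by (rule braid_no_common_eigenvector[OF \<rho> irr d(1) v(1,2)]) (simp only: eq S_def[symmetric] v(3))
qed

text \<open>The classification of operators, applied to the coordinate space, yields a basis \<open>q\<close> in which the
  generators have the matrices of one of the two models.\<close>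

lemma existence_on_generators:
  assumes n: "7 \<le> n" "n = Suc d" and \<rho>: "representation (WB n) d \<rho>"
    and irr: "irreducible_rep (braid n) d \<rho>"
  shows "\<exists>y k z B. y \<noteq> 0 \<and> z \<noteq> 0 \<and> k \<in> {- 1, 1} \<and>
    (B = beta_tilde_gen n z \<or> z \<noteq> 1 \<and> B = beta_hat_gen n z) \<and>
    (\<exists>P\<in>carrier (GL d). \<forall>x\<in>wb_gens n. P * \<rho> (wb_gen_class n x) = (X_gen y k x \<cdot>\<^sub>m B x) * P)"
proof -
  define M where "M x = \<rho> (wb_gen_class n x)" for x
  have hom: "\<rho> \<in> hom (WB n) (GL d)" using \<rho> by (simp add: representation_def)
  have MGL: "M x \<in> carrier (GL d)" if "x \<in> wb_gens n" for x
    unfolding M_def using hom_in_carrier[OF hom] pres_gen_closed[OF that] by (simp add: WB_def)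
  have Mc: "M x \<in> carrier_mat d d" if "x \<in> wb_gens n" for x
    using MGL[OF that] by (simp add: GL_iff)
  have R: "wb_relations (GL d) n M"
    unfolding M_def by (rule wb_relations_of_hom[OF group_GL hom])
  note R1 = R[unfolded wb_relations_def GL_simps, THEN conjunct1, rule_format]
  note R2 = R[unfolded wb_relations_def GL_simps, THEN conjunct2, THEN conjunct1, rule_format]
  note R3 = R[unfolded wb_relations_def GL_simps, THEN conjunct2, THEN conjunct2, rule_format]
  define a where "a i = act d (M (Alpha i))" for i
  define s where "s i = act d (M (Sigma i))" for i
  let ?W = "fun_space d"
  have act2: "act d (M x) (act d (M x') w) = act d (M x * M x') w"
    if "x \<in> wb_gens n" "x' \<in> wb_gens n" for x x' w
    using act_mult[OF Mc[OF that(1)] Mc[OF that(2)]] by simp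
  have act3: "act d (M x) (act d (M x') (act d (M x'') w)) = act d (M x * (M x' * M x'')) w"
    if "x \<in> wb_gens n" "x' \<in> wb_gens n" "x'' \<in> wb_gens n" for x x' x'' w
    using act2[OF that(2,3)] act_mult[OF Mc[OF that(1)], of "M x' * M x''"]
      mult_carrier_mat[OF Mc[OF that(2)] Mc[OF that(3)]] by simp
  have A: "complex_funs.sym_action n a ?W"
  proof (rule complex_funs.sym_actionI[OF fun_space_subspace])
    show "Modules.module_hom (\<lambda>c f i. c * f i) (\<lambda>c f i. c * f i) (a i)" if "1 \<le> i" "i < n" for i
      unfolding a_def by (rule act_hom[OF Mc]) (use that in simp)
    show "a i w \<in> ?W" for i w unfolding a_def by (rule act_in_fun_space)
    show "a i (a i w) = w" if "1 \<le> i" "i < n" "w \<in> ?W" for i w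
      unfolding a_def using that by (simp add: act2 R1 act_one)
    show "a i (a j w) = a j (a i w)" if "1 \<le> i" "i + 2 \<le> j" "j < n" for i j w
      unfolding a_def using that R2[of i j] by (simp add: act2)
    show "a i (a (Suc i) (a i w)) = a (Suc i) (a i (a (Suc i) w))" if "1 \<le> i" "Suc i < n" for i w
      unfolding a_def using that R3[OF that] by (simp add: act3)
  qed
  have aas: "a i (a (Suc i) (s i w)) = s (Suc i) (a i (a (Suc i) w))" if "1 \<le> i" "Suc i < n" for i w
    unfolding a_def s_def using that R3[OF that] by (simp add: act3)
  have dis: "\<not> complex_funs.generators_agree n a ?W"
  proof
    assume agree: "complex_funs.generators_agree n a ?W"
    \<comment> \<open>the mixed relation \<open>a\<^sub>i a\<^sub>i\<^sub>+\<^sub>1 s\<^sub>i = s\<^sub>i\<^sub>+\<^sub>1 a\<^sub>i a\<^sub>i\<^sub>+\<^sub>1\<close> collapses, since \<open>a\<^sub>i\<^sub>+\<^sub>1 = a\<^sub>i\<close> is an involution\<close>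
    have "s i w = s (Suc i) w" if i: "1 \<le> i" "Suc i < n" and w: "w \<in> ?W" for i w
    proof -
      have "i \<in> {1..<n}" "Suc i \<in> {1..<n}" using i by auto
      then have "a (Suc i) u = a 1 u" "a i u = a 1 u" if "u \<in> ?W" for u
        using agree that unfolding complex_funs.generators_agree_def by blast+
      then have eq: "a (Suc i) u = a i u" if "u \<in> ?W" for u using that by (simp only:)
      have inv: "a i (a i u) = u" if "u \<in> ?W" for u
        using complex_funs.sym_action_invol[OF A, of i u] i that by simp
      have sW: "s i w \<in> ?W" unfolding s_def by (rule act_in_fun_space)
      show ?thesis using aas[OF i, of w] by (simp add: eq[OF w] eq[OF sW] inv[OF w] inv[OF sW])
    qed
    then have s_eq: "s i w = s 1 w" if "1 \<le> i" "i < n" "w \<in> ?W" for i w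
      by (intro complex_funs.constant_if_adjacent_eq[of 1 "n - 1" "\<lambda>i. s i w" i]) (use that in auto)
    have eq: "M (Sigma i) = M (Sigma 1)" if i: "1 \<le> i" "i < n" for i
    proof (rule mat_eqI_action[of _ d])
      fix v :: "complex vec" assume v: "v \<in> carrier_vec d"
      show "to_fun d (M (Sigma i) *\<^sub>v v) = to_fun d (M (Sigma 1) *\<^sub>v v)"
        using s_eq[OF i to_fun_in_fun_space[of d v]] by (simp add: s_def act_def of_fun_to_fun[OF v])
    qed (use i n in \<open>simp_all add: Mc\<close>)
    show False
    proof (rule braid_generators_not_all_equal[OF \<rho> irr])
      show "\<rho> (wb_gen_class n (Sigma i)) = \<rho> (wb_gen_class n (Sigma 1))" if "1 \<le> i" "i < n" for i
        using eq[OF that] unfolding M_def .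
    qed (use n in simp_all)
  qed
  interpret welded: welded_action "\<lambda>c f i. c * f i" n a s ?W
  proof (rule welded_action.intro[OF complex_funs.char_0_space_axioms],
      rule welded_action_axioms.intro[OF n(1) A])
    show "Modules.module_hom (\<lambda>c f i. c * f i) (\<lambda>c f i. c * f i) (s i)" if "1 \<le> i" "i < n" for i
      unfolding s_def by (rule act_hom[OF Mc]) (use that in simp)
    show "s i w \<in> ?W" for i w unfolding s_def by (rule act_in_fun_space)
    show "w = 0" if "1 \<le> i" "i < n" "w \<in> ?W" "s i w = 0" for i w
      by (rule act_eq_0[OF MGL that(3) that(4)[unfolded s_def]]) (use that in simp)
    show "a i (s j w) = s j (a i w)"
      if "1 \<le> i" "i < n" "1 \<le> j" "j < n" "i + 2 \<le> j \<or> j + 2 \<le> i" for i j w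
      unfolding a_def s_def using that R2[OF that] by (simp add: act2)
    show "s i (s j w) = s j (s i w)" if "1 \<le> i" "i + 2 \<le> j" "j < n" for i j w
      unfolding s_def using that R2[of i j] by (simp add: act2)
    show "s i (s (Suc i) (a i w)) = a (Suc i) (s i (s (Suc i) w))" if "1 \<le> i" "Suc i < n" for i w
      unfolding a_def s_def using that R3[OF that] by (simp add: act3)
  qed (use aas in blast)
  have "card (delta_funs d) < n" using card_delta_funs(2)[of d] n(2) by simp
  from welded.small_welded_classification[OF card_delta_funs(1) this fun_space_span dis]
  obtain k g z q where kgz: "k \<in> {1, - 1}" "g \<noteq> 0" "z \<noteq> 0"
    and qW: "\<forall>i\<in>{1..<n}. q i \<in> ?W" and q: "complex_funs.indep_family (n - 1) (\<lambda>i. q (Suc i))"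
    and cases: "complex_funs.row_action k 1 (- 1) 1 n a q \<and> complex_funs.row_action g z (- z) 1 n s q \<or>
     z \<noteq> 1 \<and> q 0 = 0 \<and> q n = 0 \<and> complex_funs.col_action k z (- 1) (1 / z) n a q \<and>
     complex_funs.col_action g z (- z) 1 n s q"
    by blast
  let ?Q = "mat d d (\<lambda>(r, c). q (Suc c) (Suc r))"
  have Q: "?Q \<in> carrier (GL d)"
    by (rule independent_columns_GL) (use q qW n(2) in auto)
  have Qc: "?Q \<in> carrier_mat d d" by simp
  have nd: "n - 1 = d" "4 \<le> n" using n by auto
  have k: "k \<in> {- 1, 1}" using kgz(1) by auto
  from cases show ?thesis
  proof
    assume row: "complex_funs.row_action k 1 (- 1) 1 n a q \<and> complex_funs.row_action g z (- z) 1 n s q"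
    have "\<exists>P\<in>carrier (GL d). \<forall>x\<in>wb_gens n.
      P * \<rho> (wb_gen_class n x) = (X_gen g k x \<cdot>\<^sub>m beta_tilde_gen n z x) * P"
      unfolding M_def[symmetric]
    proof (rule equivalence_from_basis[OF Q Mc])
      show "beta_tilde_gen n z x \<in> carrier_mat d d" if "x \<in> wb_gens n" for x
        using beta_gen_GL(1)[OF nd(2) kgz(3) that] unfolding nd(1) GL_iff by blast
      fix x r c assume x: "x \<in> wb_gens n" and rc: "r < d" "c < d"
      from x show "act d (M x) (q (Suc c)) (Suc r) = X_gen g k x * (?Q * beta_tilde_gen n z x) $$ (r, c)"
      proof (cases rule: wb_gens_cases)
        case (1 i)
        have "i \<in> {1..<n}" "Suc c \<in> {1..<n}" "i \<le> d" using 1 rc n(2) by auto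
        then show ?thesis
          using row 1(1) columns_mult_row_mat[OF 1(1) _ rc, of q 1 "- 1" 1]
            beta_tilde_gen_row_mat(2)[OF nd(2) 1(1,2), of z]
          by (simp add: 1(3) nd(1)[unfolded One_nat_def] complex_funs.row_action_def a_def[symmetric])
      next
        case (2 i)
        have "i \<in> {1..<n}" "Suc c \<in> {1..<n}" "i \<le> d" using 2 rc n(2) by auto
        then show ?thesis
          using row 2(1) columns_mult_row_mat[OF 2(1) _ rc, of q z "- z" 1]
            beta_tilde_gen_row_mat(1)[OF nd(2) 2(1,2), of z]
          by (simp add: 2(3) nd(1)[unfolded One_nat_def] complex_funs.row_action_def s_def[symmetric])
      qed
    qed
    then show ?thesis using kgz(2,3) k by blast
  next
    assume col: "z \<noteq> 1 \<and> q 0 = 0 \<and> q n = 0 \<and> complex_funs.col_action k z (- 1) (1 / z) n a q \<and>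
     complex_funs.col_action g z (- z) 1 n s q"
    have "\<exists>P\<in>carrier (GL d). \<forall>x\<in>wb_gens n.
      P * \<rho> (wb_gen_class n x) = (X_gen g k x \<cdot>\<^sub>m beta_hat_gen n z x) * P"
      unfolding M_def[symmetric]
    proof (rule equivalence_from_basis[OF Q Mc])
      show "beta_hat_gen n z x \<in> carrier_mat d d" if "x \<in> wb_gens n" for x
        using beta_gen_GL(2)[OF nd(2) kgz(3) that] unfolding nd(1) GL_iff by blast
      have q0: "q 0 = 0" "q (Suc d) = 0" using col n(2) by auto
      fix x r c assume x: "x \<in> wb_gens n" and rc: "r < d" "c < d"
      from x show "act d (M x) (q (Suc c)) (Suc r) = X_gen g k x * (?Q * beta_hat_gen n z x) $$ (r, c)"
      proof (cases rule: wb_gens_cases)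
        case (1 i)
        have "i \<in> {1..<n}" "Suc c \<in> {1..<n}" "i \<le> d" using 1 rc n(2) by auto
        then show ?thesis
          using col 1(1) columns_mult_transpose_row_mat[OF 1(1) _ rc q0, of z "- 1" "1 / z"]
            beta_hat_gen_row_mat(2)[OF nd(2) 1(1,2), of z]
          by (simp add: 1(3) nd(1)[unfolded One_nat_def] complex_funs.col_action_def a_def[symmetric])
      next
        case (2 i)
        have "i \<in> {1..<n}" "Suc c \<in> {1..<n}" "i \<le> d" using 2 rc n(2) by auto
        then show ?thesis
          using col 2(1) columns_mult_transpose_row_mat[OF 2(1) _ rc q0, of z "- z" 1]
            beta_hat_gen_row_mat(1)[OF nd(2) 2(1,2), of z]
          by (simp add: 2(3) nd(1)[unfolded One_nat_def] complex_funs.col_action_def s_def[symmetric])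
      qed
    qed
    then show ?thesis using kgz(2,3) k col by blast
  qed
qed

theorem theorem6p2:
  fixes n :: nat and \<rho> :: "wb_gen gword set \<Rightarrow> complex mat"
  assumes "n \<ge> 7"
    and "representation (WB n) (n - 1) \<rho>"
    and "irreducible_rep (braid n) (n - 1) \<rho>"
  shows "\<exists>!q. case q of (y, k, z, \<beta>') \<Rightarrow>
           y \<noteq> 0 \<and> z \<noteq> 0 \<and> (\<Sum>i<n. z ^ i) \<noteq> 0 \<and> k \<in> {-1, 1} \<and>
           (if z = 1 then \<beta>' = beta_tilde n 1 else \<beta>' \<in> {beta_tilde n z, beta_hat n z}) \<and>
           equivalent_reps (WB n) (n - 1) \<rho> (tensor1 (X_rep y k) \<beta>')"
proof -
  define d where "d = n - 1"
  have nd: "n = Suc d" "4 \<le> n" "6 \<le> d" "2 \<le> d" "d = n - 1" using assms(1) by (auto simp: d_def)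
  note \<rho> = assms(2)[folded d_def] and irr = assms(3)[folded d_def]
  define M where "M x = \<rho> (wb_gen_class n x)" for x
  have hom: "\<rho> \<in> hom (WB n) (GL d)" using \<rho> by (simp add: representation_def)
  have Mc: "M x \<in> carrier_mat d d" if "x \<in> wb_gens n" for x
    using hom_in_carrier[OF hom] pres_gen_closed[OF that] by (simp add: M_def WB_def GL_iff)
  define fits where "fits y k B \<longleftrightarrow>
    (\<exists>P\<in>carrier (GL d). \<forall>x\<in>wb_gens n. P * M x = (X_gen y k x \<cdot>\<^sub>m B x) * P)" for y k B
  have equiv: "equivalent_reps (WB n) d \<rho> (tensor1 (X_rep y k) (beta_tilde n z)) \<longleftrightarrow> fits y k (beta_tilde_gen n z)"
    "equivalent_reps (WB n) d \<rho> (tensor1 (X_rep y k) (beta_hat n z)) \<longleftrightarrow> fits y k (beta_hat_gen n z)"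
    if "y \<noteq> 0" "k \<in> {- 1, 1}" "z \<noteq> 0" for y k z
    unfolding beta_tilde_def beta_hat_def fits_def M_def d_def[symmetric]
    using beta_gen_GL[OF nd(2) that(3), folded nd(5)]
      beta_tilde_relations[OF nd(2,5)] beta_hat_relations[OF nd(2) that(3) nd(5)] that(1,2)
    by (intro equivalent_reps_on_generators[OF \<rho>]; blast)+
  define Adm where "Adm q \<longleftrightarrow> (case q of (y, k, z, \<beta>') \<Rightarrow>
           y \<noteq> 0 \<and> z \<noteq> 0 \<and> (\<Sum>i<n. z ^ i) \<noteq> 0 \<and> k \<in> {-1, 1} \<and>
           (if z = 1 then \<beta>' = beta_tilde n 1 else \<beta>' \<in> {beta_tilde n z, beta_hat n z}) \<and>
           equivalent_reps (WB n) d \<rho> (tensor1 (X_rep y k) \<beta>'))" for q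
  have four: "x \<in> wb_gens n" if "x \<in> {Sigma 1, Sigma 3, Alpha 1, Alpha 3}" for x
    using that assms(1) by auto
  have invariants: "twist_invariants d M y k z \<and>
      (\<beta>' = beta_tilde n z \<and> same_image d M y k \<or> z \<noteq> 1 \<and> \<beta>' = beta_hat n z \<and> \<not> same_image d M y k)"
    if q: "Adm (y, k, z, \<beta>')" for y k z \<beta>'
  proof -
    have yz: "y \<noteq> 0" "z \<noteq> 0" "k \<in> {- 1, 1}" "k \<noteq> 0"
      and E: "equivalent_reps (WB n) d \<rho> (tensor1 (X_rep y k) \<beta>')"
      and \<beta>': "\<beta>' = beta_tilde n z \<or> z \<noteq> 1 \<and> \<beta>' = beta_hat n z"
      using q by (auto simp: Adm_def split: if_splits)
    have transport: "(twist_invariants d (\<lambda>x. X_gen y k x \<cdot>\<^sub>m B x) y k z \<longrightarrow> twist_invariants d M y k z) \<and>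
        (same_image d M y k \<longleftrightarrow> same_image d (\<lambda>x. X_gen y k x \<cdot>\<^sub>m B x) y k)"
      if fit: "fits y k B" and Bc: "\<And>x. x \<in> wb_gens n \<Longrightarrow> B x \<in> carrier (GL d)" for B
    proof -
      obtain P where P: "P \<in> carrier (GL d)"
        "\<And>x. x \<in> wb_gens n \<Longrightarrow> P * M x = (X_gen y k x \<cdot>\<^sub>m B x) * P"
        using fit unfolding fits_def by blast
      have "M x \<in> carrier_mat d d \<and> X_gen y k x \<cdot>\<^sub>m B x \<in> carrier_mat d d \<and>
          P * M x = (X_gen y k x \<cdot>\<^sub>m B x) * P" if "x \<in> {Sigma 1, Sigma 3, Alpha 1, Alpha 3}" for x
        using Mc[OF four[OF that]] Bc[OF four[OF that]] P(2)[OF four[OF that]]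
        unfolding GL_iff by (intro conjI smult_carrier_mat) blast+
      from invariants_transport[where M = M, OF P(1) this] show ?thesis by blast
    qed
    note GL = beta_gen_GL[OF nd(2) yz(2), folded nd(5)]
    from \<beta>' show ?thesis
    proof
      assume t: "\<beta>' = beta_tilde n z"
      have "fits y k (beta_tilde_gen n z)" using E equiv(1)[OF yz(1,3,2)] by (simp add: t)
      from transport[OF this GL(1)] show ?thesis
        using tilde_invariants[OF nd(3,1) yz(1), of k z] t by blast
    next
      assume h: "z \<noteq> 1 \<and> \<beta>' = beta_hat n z"
      have "fits y k (beta_hat_gen n z)" using E equiv(2)[OF yz(1,3,2)] h by simp
      from transport[OF this GL(2)] show ?thesis
        using hat_invariants[OF nd(3,1) yz(1,4,2)] h by blast
    qed
  qed
  obtain y k z B where *: "y \<noteq> 0" "z \<noteq> 0" "k \<in> {- 1, 1}"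
    "B = beta_tilde_gen n z \<or> z \<noteq> 1 \<and> B = beta_hat_gen n z"
    and fit: "\<exists>P\<in>carrier (GL d). \<forall>x\<in>wb_gens n. P * \<rho> (wb_gen_class n x) = (X_gen y k x \<cdot>\<^sub>m B x) * P"
    using existence_on_generators[OF assms(1) nd(1) \<rho> irr] by blast
  obtain P where P: "P \<in> carrier (GL d)"
    "\<And>x. x \<in> wb_gens n \<Longrightarrow> P * \<rho> (wb_gen_class n x) = (X_gen y k x \<cdot>\<^sub>m B x) * P"
    using fit by blast
  have nz: "(\<Sum>i<n. z ^ i) \<noteq> 0"
    by (rule geometric_sum_nonzero[OF \<rho> irr nd(4,1) *(1,2) P(1) _ nd(2) P(2)]) (use *(4) in auto)
  have fits: "fits y k B" using fit by (simp add: fits_def M_def)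
  have ex: "\<exists>q. Adm q"
  proof (cases "B = beta_tilde_gen n z")
    case True
    then have "Adm (y, k, z, beta_tilde n z)"
      using * nz fits equiv(1)[OF *(1,3,2)] by (auto simp: Adm_def)
    then show ?thesis ..
  next
    case False
    then have "Adm (y, k, z, beta_hat n z)"
      using * nz fits equiv(2)[OF *(1,3,2)] by (auto simp: Adm_def)
    then show ?thesis ..
  qed
  have uniq: "q = q'" if "Adm q" "Adm q'" for q q'
  proof -
    obtain y k z \<beta>' where q: "q = (y, k, z, \<beta>')" by (cases q) auto
    obtain y' k' z' \<beta>'' where q': "q' = (y', k', z', \<beta>'')" by (cases q') auto
    note i = invariants[OF that(1)[unfolded q]] and i' = invariants[OF that(2)[unfolded q']]
    have "y \<noteq> 0" using that(1) by (simp add: q Adm_def)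
    then have "y = y' \<and> k = k' \<and> z = z'"
      using twist_invariants_unique[of d M y k z y' k' z'] i i' Mc[OF four] by blast
    then show ?thesis using i i' by (auto simp: q q')
  qed
  have "\<exists>!q. Adm q" using ex uniq by blast
  then show ?thesis unfolding Adm_def d_def .
qed

end
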